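(* Let $(X,\Sigma,\mu)$ be a $\sigma$-finite measure space and let $\mathscr M$ be a countably generated $L^0(\mu)$-Banach $L^0(\mu)$-module. Let $(Q,\mathcal Q,\mathfrak q)$ be a ($\sigma$-finite) measure space and let $Q\ni q\mapsto\mu_q$ be a disjoint measure-valued map from $Q$ to $X$ such that $\mu=\int\mu_q\,\mathrm d\mathfrak q(q)$. Then there exists a Banach module bundle $(\mathscr M_\star,\Theta,\Phi)$ consistent with $q\mapsto\mu_q$ such that $$\mathscr M\cong\int\mathscr M_q\,\mathrm d\mathfrak q(q)$$ as $L^0(\mu)$-Banach $L^0(\mu)$-modules.
   Context: All measures are assumed $\sigma$-finite. Rings and algebras need not be unital; algebras are commutative, associative, over $\mathbb R$. **$L^0$ spaces.** For a measure space $(X,\Sigma,\mu)$, $\mathcal L^0(\Sigma)$ is the space of measurable functions $X\to\mathbb R$ and $L^0(\mu)$ its quotient by $\mu$-a.e. equality; $[\cdot]_\mu$ is the quotient map and $\mathbf 1_E^\mu=[\mathbf 1_E]_\mu$. $L^0(\mu)$ has the complete distance $d_{L^0(\mu)}(f,g)=\int|f-g|\wedge1\,\mathrm d\tilde\mu$, where $\tilde\mu$ is a finite measure with $\mu\ll\tilde\mu\le\mu$ (the topology does not depend on $\tilde\mu$). **Sections.** For a family $A_\star=\{A_q\}_{q\in Q}$ of rings or vector spaces and a measure space $(Q,\mathcal Q,\mathfrak q)$, $\mathscr S(A_\star)=\prod_{q}A_q$, and $\mathscr S_{\mathfrak q}(A_\star)$ is its quotient identifying $v,w$ when $\{q:v_q\ne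 w_q\}$ is contained in some $N\in\mathcal Q$ with $\mathfrak q(N)=0$; $\pi_{\mathfrak q}$ is the quotient map. Operations are componentwise. **Disjoint measure-valued map.** A family $\{\mu_q\}_{q\in Q}$ of measures on $(X,\Sigma)$ is a measure-valued map from $Q$ to $X$ if $q\mapsto\mu_q(E)$ is measurable for every $E\in\Sigma$ and $\mu(E):=\int\mu_q(E)\,\mathrm d\mathfrak q(q)$ defines a $\sigma$-finite measure, denoted $\mu=\int\mu_q\,\mathrm d\mathfrak q(q)$. It is disjoint if there are pairwise disjoint sets $E_q\in\Sigma$, $q\in Q$, with $\mu_q(X\setminus E_q)=0$ for all $q$ and $\bigcup_{q\in A}E_q\in\Sigma$ for all $A\in\mathcal Q$. **The space $L^0(\mathfrak q;L^0(\mu_\star))$.** It is $\pi_{\mathfrak q}$ of the set of $f\in\mathscr S(L^0(\mu_\star))$ for which there is $F\in\mathcal L^0(\Sigma)$ with $[F]_{\mu_q}=f_q$ for $\mathfrak q$-a.e. $q$. The map ${\sf i}_{\mathfrak q}:L^0(\mu)\to L^0(\mathfrak q;L^0(\mu_\star))$ sending $[F]_\mu$ to the class of $q\mapsto[F]_{\mu_q}$ is a linear and ring isomorphism, with inverse ${\sf j}_{\mathfrak q}$. **Normed and Banach modules.** Let $\mathscr A\subseteq L^0(\mu)$ be a subalgebra. An $L^0(\mu)$-normed $\mathscr A$-module is an $\mathscr A$-module $\mathscr M$ that is also a real vector space (same addition; $1\cdot v=v$ if $\mathscr A$ has an identity $1$), with $(\lambda f)\cdot v=\lambda(f\cdot v)$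 for $\lambda\in\mathbb R$, and endowed with a map $|\cdot|:\mathscr M\to L^0(\mu)$ such that $\mu$-a.e.: $|v|\ge0$ with equality iff $v=0$, $|v+w|\le|v|+|w|$, $|\lambda v|=|\lambda||v|$, $|f\cdot v|=|f||v|$ for $f\in\mathscr A$. It is an $L^0(\mu)$-Banach $\mathscr A$-module if $d_{\mathscr M}(v,w)=d_{L^0(\mu)}(|v-w|,0)$ is complete. Isomorphisms of $L^0(\mu)$-Banach $L^0(\mu)$-modules are $L^0(\mu)$-linear bijections preserving the pointwise norm. A vector subspace $V\subseteq\mathscr M$ of an $L^0(\mu)$-Banach $L^0(\mu)$-module generates $\mathscr M$ if the set $\mathcal G(V)$ of all $\sum_{n\in\mathbb N}\mathbf 1_{E_n}^\mu\cdot v_n$, with $(E_n)\subseteq\Sigma$ a partition of $X$ and $(v_n)\subseteq V$, is dense in $\mathscr M$. $\mathscr M$ is countably generated if there is a countable subset of $\mathscr M$ whose linear span generates $\mathscr M$. **Completion.** For a subalgebra $\mathscr A$, let $\hat{\mathscr A}$ be the closure in $L^0(\mu)$ of $\{\sum_n\mathbf 1_{E_n}^\mu f_n:(E_n)\subseteq\Sigma\text{ partition of }X,(f_n)\subseteq\mathscr A\}$. If $\hat{\mathscr A}=L^0(\mu)$, every $L^0(\mu)$-normed $\mathscr A$-module $\mathscr N$ has a completion: the unique (up to unique isomorphism) pair $(\hat{\mathscr N},\iota)$ with $\hat{\mathscr N}$ an $L^0(\mu)$-Banach $L^0(\mu)$-module and $\iota:\mathscr N\to\hat{\mathscr N}$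 linear, with generating image, and $|\iota(v)|=|v|$. **Banach module bundle.** A Banach module bundle consistent with a disjoint measure-valued map $q\mapsto\mu_q$ is a triple $(\mathscr M_\star,\Theta,\Phi)$ where: (a) $\mathscr M_\star=\{\mathscr M_q\}_{q\in Q}$ and each $\mathscr M_q$ is an $L^0(\mu_q)$-Banach $L^0(\mu_q)$-module; (b) $\Phi$ is a subalgebra of $L^0(\mathfrak q;L^0(\mu_\star))$ such that $\mathcal G_{\mathfrak q}(\Phi)=\{\sum_{n}{\sf j}_{\mathfrak q}(\mathbf 1_{S_n}^{\mathfrak q}f_n):(S_n)\subseteq\mathcal Q\text{ partition of }Q,(f_n)\subseteq\Phi\}$ is dense in $L^0(\mu)$, where $\mathbf 1_S^{\mathfrak q}f$ is the section $q\mapsto\mathbf 1_S(q)f_q$; (c) $\Theta$ is a vector subspace of $\mathscr S_{\mathfrak q}(\mathscr M_\star)$ that is also a module over $\Phi$, and for every $v\in\Theta$ the section $|v_\star|:q\mapsto|v_q|$ belongs to $L^0(\mathfrak q;L^0(\mu_\star))$. Then $\Theta$, with $|v|:={\sf j}_{\mathfrak q}(|v_\star|)$, is an $L^0(\mu)$-normed $\Phi$-module ($\Phi$ identified with ${\sf j}_{\mathfrak q}(\Phi)$). Its completion, an $L^0(\mu)$-Banach $L^0(\mu)$-module, is called the integral of the bundle and denoted $\int\mathscr M_q\,\mathrm d\mathfrak q(q)$. *)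

theory Defs
  imports "HOL-Analysis.Analysis" "HOL-Algebra.Ring"
begin

section \<open>Records, real vector spaces and algebras on carriers\<close>

text \<open>
  As for the module records of HOL-Algebra, the fields \<open>mult\<close> and \<open>one\<close> inherited from rings
  carry no meaning in a vector space or in a normed module (\<open>nmodule\<close>); no predicate
  below refers to them there.
\<close>

record 'v ralgebra = "'v ring" +
  rscale :: "real \<Rightarrow> 'v \<Rightarrow> 'v"

record ('a, 'v) nmodule = "'v ralgebra" +
  act :: "'a \<Rightarrow> 'v \<Rightarrow> 'v"
  pnorm :: "'v \<Rightarrow> 'a"

locale real_vs = abelian_group V for V (structure) +
  assumes rscale_closed: "v \<in> carrier V \<Longrightarrow> rscale V c v \<in> carrier V"
    and rscale_add_right: "\<lbrakk>v \<in> carrier V; w \<in> carrier V\<rbrakk> \<Longrightarrow>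
      rscale V c (v \<oplus> w) = rscale V c v \<oplus> rscale V c w"
    and rscale_add_left: "v \<in> carrier V \<Longrightarrow>
      rscale V (c + d) v = rscale V c v \<oplus> rscale V d v"
    and rscale_rscale: "v \<in> carrier V \<Longrightarrow> rscale V c (rscale V d v) = rscale V (c * d) v"
    and rscale_one: "v \<in> carrier V \<Longrightarrow> rscale V 1 v = v"

definition vector_subspace :: "('v, 'z) ralgebra_scheme \<Rightarrow> 'v set \<Rightarrow> bool" where
  "vector_subspace V U \<longleftrightarrow> U \<subseteq> carrier V \<and> \<zero>\<^bsub>V\<^esub> \<in> U \<and>
     (\<forall>u\<in>U. \<forall>w\<in>U. u \<oplus>\<^bsub>V\<^esub> w \<in> U) \<and> (\<forall>c. \<forall>u\<in>U. rscale V c u \<in> U)"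

definition real_subalgebra :: "('v, 'z) ralgebra_scheme \<Rightarrow> 'v set \<Rightarrow> bool" where
  "real_subalgebra B A \<longleftrightarrow> vector_subspace B A \<and> (\<forall>a\<in>A. \<forall>b\<in>A. a \<otimes>\<^bsub>B\<^esub> b \<in> A)"

definition linear_span :: "('v, 'z) ralgebra_scheme \<Rightarrow> 'v set \<Rightarrow> 'v set" where
  "linear_span V S = {finsum V (\<lambda>u. rscale V (c u) u) F | c F. finite F \<and> F \<subseteq> S}"

text \<open>Quotients are represented by sets of representatives; this picks one of them.\<close>

definition class_rep :: "'b set \<Rightarrow> 'b" where
  "class_rep a = (SOME x. x \<in> a)"

section \<open>The spaces \<open>L\<^sup>0\<close>\<close>

definition l0_class :: "'x measure \<Rightarrow> ('x \<Rightarrow> real) \<Rightarrow> ('x \<Rightarrow> real) set" where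
  "l0_class M F = {G \<in> borel_measurable M. AE x in M. G x = F x}"

definition L0 :: "'x measure \<Rightarrow> ('x \<Rightarrow> real) set ralgebra" where
  "L0 M = \<lparr>carrier = l0_class M ` borel_measurable M,
           mult = (\<lambda>a b. l0_class M (\<lambda>x. class_rep a x * class_rep b x)),
           one = l0_class M (\<lambda>x. 1),
           zero = l0_class M (\<lambda>x. 0),
           add = (\<lambda>a b. l0_class M (\<lambda>x. class_rep a x + class_rep b x)),
           rscale = (\<lambda>c a. l0_class M (\<lambda>x. c * class_rep a x))\<rparr>"

definition l0_ind :: "'x measure \<Rightarrow> 'x set \<Rightarrow> ('x \<Rightarrow> real) set" where
  "l0_ind M E = l0_class M (indicat_real E)"

definition l0_abs :: "'x measure \<Rightarrow> ('x \<Rightarrow> real) set \<Rightarrow> ('x \<Rightarrow> real) set" where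
  "l0_abs M a = l0_class M (\<lambda>x. \<bar>class_rep a x\<bar>)"

text \<open>
  A fixed finite measure \<open>\<nu>\<close> with \<open>M \<lless> \<nu> \<le> M\<close>; it exists because \<open>M\<close> is \<open>\<sigma>\<close>-finite,
  and the topology and uniformity of \<open>l0_dist\<close> do not depend on it.
  Note the argument order: \<open>absolutely_continuous \<nu> M\<close> says that \<open>\<nu>\<close>-null sets are \<open>M\<close>-null.
\<close>

definition l0_ref_measure :: "'x measure \<Rightarrow> 'x measure" where
  "l0_ref_measure M = (SOME \<nu>. finite_measure \<nu> \<and> sets \<nu> = sets M \<and>
     absolutely_continuous \<nu> M \<and> (\<forall>A\<in>sets M. emeasure \<nu> A \<le> emeasure M A))"

definition l0_dist :: "'x measure \<Rightarrow> ('x \<Rightarrow> real) set \<Rightarrow> ('x \<Rightarrow> real) set \<Rightarrow> real" where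
  "l0_dist M a b = (LINT x|l0_ref_measure M. min \<bar>class_rep a x - class_rep b x\<bar> 1)"

abbreviation l0_topology :: "'x measure \<Rightarrow> ('x \<Rightarrow> real) set topology" where
  "l0_topology M \<equiv> Metric_space.mtopology (carrier (L0 M)) (l0_dist M)"

text \<open>As usual, members of a countable partition may be empty.\<close>

definition countable_partition :: "'x measure \<Rightarrow> (nat \<Rightarrow> 'x set) \<Rightarrow> bool" where
  "countable_partition M E \<longleftrightarrow>
     range E \<subseteq> sets M \<and> disjoint_family E \<and> (\<Union>n. E n) = space M"

section \<open>Normed and Banach modules\<close>

locale normed_module = real_vs N
  for M :: "'x measure" and A :: "('x \<Rightarrow> real) set set"
    and N :: "(('x \<Rightarrow> real) set, 'v) nmodule" (structure) +
  assumes subalg: "real_subalgebra (L0 M) A"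
    and act_closed: "\<lbrakk>f \<in> A; v \<in> carrier N\<rbrakk> \<Longrightarrow> act N f v \<in> carrier N"
    and act_add_right: "\<lbrakk>f \<in> A; v \<in> carrier N; w \<in> carrier N\<rbrakk> \<Longrightarrow>
      act N f (v \<oplus> w) = act N f v \<oplus> act N f w"
    and act_add_left: "\<lbrakk>f \<in> A; g \<in> A; v \<in> carrier N\<rbrakk> \<Longrightarrow>
      act N (f \<oplus>\<^bsub>L0 M\<^esub> g) v = act N f v \<oplus> act N g v"
    and act_mult: "\<lbrakk>f \<in> A; g \<in> A; v \<in> carrier N\<rbrakk> \<Longrightarrow>
      act N (f \<otimes>\<^bsub>L0 M\<^esub> g) v = act N f (act N g v)"
    and act_unit: "\<lbrakk>e \<in> A; \<And>f. f \<in> A \<Longrightarrow> e \<otimes>\<^bsub>L0 M\<^esub> f = f; v \<in> carrier N\<rbrakk> \<Longrightarrow>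
      act N e v = v"
    and act_rscale: "\<lbrakk>f \<in> A; v \<in> carrier N\<rbrakk> \<Longrightarrow>
      act N (rscale (L0 M) c f) v = rscale N c (act N f v)"
    and pnorm_closed: "v \<in> carrier N \<Longrightarrow> pnorm N v \<in> carrier (L0 M)"
    and pnorm_nonneg: "v \<in> carrier N \<Longrightarrow> AE x in M. 0 \<le> class_rep (pnorm N v) x"
    and pnorm_eq_zero: "v \<in> carrier N \<Longrightarrow> pnorm N v = \<zero>\<^bsub>L0 M\<^esub> \<longleftrightarrow> v = \<zero>"
    and pnorm_triangle: "\<lbrakk>v \<in> carrier N; w \<in> carrier N\<rbrakk> \<Longrightarrow>
      AE x in M. class_rep (pnorm N (v \<oplus> w)) x
        \<le> class_rep (pnorm N v) x + class_rep (pnorm N w) x"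
    and pnorm_rscale: "v \<in> carrier N \<Longrightarrow>
      pnorm N (rscale N c v) = rscale (L0 M) \<bar>c\<bar> (pnorm N v)"
    and pnorm_act: "\<lbrakk>f \<in> A; v \<in> carrier N\<rbrakk> \<Longrightarrow>
      pnorm N (act N f v) = l0_abs M f \<otimes>\<^bsub>L0 M\<^esub> pnorm N v"

text \<open>
  The value off the carrier is irrelevant, but the locale \<open>Metric_space\<close> demands
  symmetry on the whole type.
\<close>

definition nm_dist ::
    "'x measure \<Rightarrow> (('x \<Rightarrow> real) set, 'v) nmodule \<Rightarrow> 'v \<Rightarrow> 'v \<Rightarrow> real" where
  "nm_dist M N v w = (if v \<in> carrier N \<and> w \<in> carrier N
     then l0_dist M (pnorm N (v \<ominus>\<^bsub>N\<^esub> w)) \<zero>\<^bsub>L0 M\<^esub> else 0)"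

abbreviation nm_topology ::
    "'x measure \<Rightarrow> (('x \<Rightarrow> real) set, 'v) nmodule \<Rightarrow> 'v topology" where
  "nm_topology M N \<equiv> Metric_space.mtopology (carrier N) (nm_dist M N)"

definition banach_A_module ::
    "'x measure \<Rightarrow> ('x \<Rightarrow> real) set set \<Rightarrow> (('x \<Rightarrow> real) set, 'v) nmodule \<Rightarrow> bool" where
  "banach_A_module M A N \<longleftrightarrow>
     normed_module M A N \<and> Metric_space.mcomplete (carrier N) (nm_dist M N)"

abbreviation banach_module ::
    "'x measure \<Rightarrow> (('x \<Rightarrow> real) set, 'v) nmodule \<Rightarrow> bool" where
  "banach_module M N \<equiv> banach_A_module M (carrier (L0 M)) N"

definition banach_module_isomorphic ::
    "'x measure \<Rightarrow> (('x \<Rightarrow> real) set, 'v) nmodule \<Rightarrow> (('x \<Rightarrow> real) set, 'w) nmodule \<Rightarrow> bool" where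
  "banach_module_isomorphic M N N' \<longleftrightarrow> (\<exists>\<phi>. bij_betw \<phi> (carrier N) (carrier N') \<and>
     (\<forall>v\<in>carrier N. \<forall>w\<in>carrier N. \<phi> (v \<oplus>\<^bsub>N\<^esub> w) = \<phi> v \<oplus>\<^bsub>N'\<^esub> \<phi> w) \<and>
     (\<forall>f\<in>carrier (L0 M). \<forall>v\<in>carrier N. \<phi> (act N f v) = act N' f (\<phi> v)) \<and>
     (\<forall>v\<in>carrier N. pnorm N' (\<phi> v) = pnorm N v))"

text \<open>The set \<open>\<G>(V)\<close>; the series \<open>\<Sum>\<^sub>n 1\<^bsub>E n\<^esub> v n\<close> is the limit of its partial sums.\<close>

definition glued :: "'x measure \<Rightarrow> (('x \<Rightarrow> real) set, 'v) nmodule \<Rightarrow> 'v set \<Rightarrow> 'v set" where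
  "glued M N V = {s \<in> carrier N. \<exists>E v. countable_partition M E \<and> range v \<subseteq> V \<and>
     limitin (nm_topology M N)
       (\<lambda>k. finsum N (\<lambda>n. act N (l0_ind M (E n)) (v n)) {..<k}) s sequentially}"

definition generates :: "'x measure \<Rightarrow> (('x \<Rightarrow> real) set, 'v) nmodule \<Rightarrow> 'v set \<Rightarrow> bool" where
  "generates M N V \<longleftrightarrow> vector_subspace N V \<and>
     nm_topology M N closure_of glued M N V = carrier N"

definition countably_generated ::
    "'x measure \<Rightarrow> (('x \<Rightarrow> real) set, 'v) nmodule \<Rightarrow> bool" where
  "countably_generated M N \<longleftrightarrow>
     (\<exists>S. countable S \<and> S \<subseteq> carrier N \<and> generates M N (linear_span N S))"

text \<open>
  \<open>(C, \<iota>)\<close> is a completion of the normed module \<open>N\<close> over a subalgebra whose glued functions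
  are dense in \<open>L0 M\<close>; these properties determine \<open>(C, \<iota>)\<close> up to unique isomorphism.
\<close>

definition is_completion ::
    "'x measure \<Rightarrow> (('x \<Rightarrow> real) set, 'v) nmodule \<Rightarrow> (('x \<Rightarrow> real) set, 'w) nmodule \<Rightarrow>
     ('v \<Rightarrow> 'w) \<Rightarrow> bool" where
  "is_completion M N C \<iota> \<longleftrightarrow> banach_module M C \<and> \<iota> \<in> carrier N \<rightarrow> carrier C \<and>
     (\<forall>v\<in>carrier N. \<forall>w\<in>carrier N. \<iota> (v \<oplus>\<^bsub>N\<^esub> w) = \<iota> v \<oplus>\<^bsub>C\<^esub> \<iota> w) \<and>
     (\<forall>c. \<forall>v\<in>carrier N. \<iota> (rscale N c v) = rscale C c (\<iota> v)) \<and>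
     generates M C (\<iota> ` carrier N) \<and>
     (\<forall>v\<in>carrier N. pnorm C (\<iota> v) = pnorm N v)"

section \<open>Sections modulo almost everywhere equality\<close>

definition sec_class ::
    "'q measure \<Rightarrow> ('q \<Rightarrow> ('v, 'z) ralgebra_scheme) \<Rightarrow> ('q \<Rightarrow> 'v) \<Rightarrow> ('q \<Rightarrow> 'v) set" where
  "sec_class Q A v = {w \<in> (\<Pi>\<^sub>E q\<in>space Q. carrier (A q)). AE q in Q. w q = v q}"

definition sec_quot ::
    "'q measure \<Rightarrow> ('q \<Rightarrow> ('v, 'z) ralgebra_scheme) \<Rightarrow> ('q \<Rightarrow> 'v) set ralgebra" where
  "sec_quot Q A = \<lparr>carrier = sec_class Q A ` (\<Pi>\<^sub>E q\<in>space Q. carrier (A q)),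
     mult = (\<lambda>v w. sec_class Q A (\<lambda>q. class_rep v q \<otimes>\<^bsub>A q\<^esub> class_rep w q)),
     one = sec_class Q A (\<lambda>q. \<one>\<^bsub>A q\<^esub>),
     zero = sec_class Q A (\<lambda>q. \<zero>\<^bsub>A q\<^esub>),
     add = (\<lambda>v w. sec_class Q A (\<lambda>q. class_rep v q \<oplus>\<^bsub>A q\<^esub> class_rep w q)),
     rscale = (\<lambda>c v. sec_class Q A (\<lambda>q. rscale (A q) c (class_rep v q)))\<rparr>"

section \<open>Disjoint measure-valued maps\<close>

text \<open>
  Only the measurable space underlying \<open>X\<close> matters in the following three definitions.
  All measures, in particular every \<open>\<mu> q\<close>, are \<open>\<sigma>\<close>-finite by a standing convention.
\<close>

definition integral_measure :: "'q measure \<Rightarrow> 'x measure \<Rightarrow> ('q \<Rightarrow> 'x measure) \<Rightarrow> 'x measure" where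
  "integral_measure Q X \<mu> =
     measure_of (space X) (sets X) (\<lambda>E. \<integral>\<^sup>+ q. emeasure (\<mu> q) E \<partial>Q)"

definition measure_valued_map :: "'q measure \<Rightarrow> 'x measure \<Rightarrow> ('q \<Rightarrow> 'x measure) \<Rightarrow> bool" where
  "measure_valued_map Q X \<mu> \<longleftrightarrow>
     (\<forall>q\<in>space Q. sets (\<mu> q) = sets X \<and> sigma_finite_measure (\<mu> q)) \<and>
     (\<forall>E\<in>sets X. (\<lambda>q. emeasure (\<mu> q) E) \<in> borel_measurable Q) \<and>
     sigma_finite_measure (integral_measure Q X \<mu>)"

definition disjoint_measure_valued_map ::
    "'q measure \<Rightarrow> 'x measure \<Rightarrow> ('q \<Rightarrow> 'x measure) \<Rightarrow> bool" where
  "disjoint_measure_valued_map Q X \<mu> \<longleftrightarrow> measure_valued_map Q X \<mu> \<and>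
     (\<exists>E. (\<forall>q\<in>space Q. E q \<in> sets X \<and> emeasure (\<mu> q) (space X - E q) = 0) \<and>
          disjoint_family_on E (space Q) \<and>
          (\<forall>A\<in>sets Q. (\<Union>q\<in>A. E q) \<in> sets X))"

section \<open>Banach module bundles and their integrals\<close>

text \<open>From here on, \<open>M\<close> is the measure \<open>integral_measure Q M \<mu>\<close>.\<close>

definition L0_sections ::
    "'q measure \<Rightarrow> 'x measure \<Rightarrow> ('q \<Rightarrow> 'x measure) \<Rightarrow> ('q \<Rightarrow> ('x \<Rightarrow> real) set) set set" where
  "L0_sections Q M \<mu> = sec_class Q (\<lambda>q. L0 (\<mu> q)) `
     {f \<in> (\<Pi>\<^sub>E q\<in>space Q. carrier (L0 (\<mu> q))).
        \<exists>F\<in>borel_measurable M. AE q in Q. l0_class (\<mu> q) F = f q}"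

definition to_sections ::
    "'q measure \<Rightarrow> ('q \<Rightarrow> 'x measure) \<Rightarrow> ('x \<Rightarrow> real) set \<Rightarrow> ('q \<Rightarrow> ('x \<Rightarrow> real) set) set" where
  "to_sections Q \<mu> a = sec_class Q (\<lambda>q. L0 (\<mu> q)) (\<lambda>q. l0_class (\<mu> q) (class_rep a))"

text \<open>
  The map \<open>to_sections Q \<mu>\<close> is a bijection from \<open>carrier (L0 M)\<close> onto \<open>L0_sections Q M \<mu>\<close>.
\<close>

definition from_sections ::
    "'q measure \<Rightarrow> 'x measure \<Rightarrow> ('q \<Rightarrow> 'x measure) \<Rightarrow>
     ('q \<Rightarrow> ('x \<Rightarrow> real) set) set \<Rightarrow> ('x \<Rightarrow> real) set" where
  "from_sections Q M \<mu> = the_inv_into (carrier (L0 M)) (to_sections Q \<mu>)"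

definition sec_restrict ::
    "'q measure \<Rightarrow> ('q \<Rightarrow> 'x measure) \<Rightarrow> 'q set \<Rightarrow>
     ('q \<Rightarrow> ('x \<Rightarrow> real) set) set \<Rightarrow> ('q \<Rightarrow> ('x \<Rightarrow> real) set) set" where
  "sec_restrict Q \<mu> S f = sec_class Q (\<lambda>q. L0 (\<mu> q))
     (\<lambda>q. rscale (L0 (\<mu> q)) (indicat_real S q) (class_rep f q))"

definition sec_glued ::
    "'q measure \<Rightarrow> 'x measure \<Rightarrow> ('q \<Rightarrow> 'x measure) \<Rightarrow>
     ('q \<Rightarrow> ('x \<Rightarrow> real) set) set set \<Rightarrow> ('x \<Rightarrow> real) set set" where
  "sec_glued Q M \<mu> \<Phi> = {a \<in> carrier (L0 M). \<exists>S f. countable_partition Q S \<and> range f \<subseteq> \<Phi> \<and>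
     limitin (l0_topology M)
       (\<lambda>k. finsum (L0 M) (\<lambda>n. from_sections Q M \<mu> (sec_restrict Q \<mu> (S n) (f n))) {..<k})
       a sequentially}"

definition sec_act ::
    "'q measure \<Rightarrow> ('q \<Rightarrow> (('x \<Rightarrow> real) set, 'v) nmodule) \<Rightarrow>
     ('q \<Rightarrow> ('x \<Rightarrow> real) set) set \<Rightarrow> ('q \<Rightarrow> 'v) set \<Rightarrow> ('q \<Rightarrow> 'v) set" where
  "sec_act Q Ms f v = sec_class Q Ms (\<lambda>q. act (Ms q) (class_rep f q) (class_rep v q))"

definition sec_norm ::
    "'q measure \<Rightarrow> ('q \<Rightarrow> 'x measure) \<Rightarrow> ('q \<Rightarrow> (('x \<Rightarrow> real) set, 'v) nmodule) \<Rightarrow>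
     ('q \<Rightarrow> 'v) set \<Rightarrow> ('q \<Rightarrow> ('x \<Rightarrow> real) set) set" where
  "sec_norm Q \<mu> Ms v = sec_class Q (\<lambda>q. L0 (\<mu> q)) (\<lambda>q. pnorm (Ms q) (class_rep v q))"

text \<open>
  \<open>\<Theta>\<close> being a module over \<open>\<Phi>\<close> amounts to closedness under the componentwise action, since
  the module identities hold in every fibre.
\<close>

definition banach_module_bundle ::
    "'q measure \<Rightarrow> 'x measure \<Rightarrow> ('q \<Rightarrow> 'x measure) \<Rightarrow>
     ('q \<Rightarrow> (('x \<Rightarrow> real) set, 'v) nmodule) \<Rightarrow> ('q \<Rightarrow> 'v) set set \<Rightarrow>
     ('q \<Rightarrow> ('x \<Rightarrow> real) set) set set \<Rightarrow> bool" where
  "banach_module_bundle Q M \<mu> Ms \<Theta> \<Phi> \<longleftrightarrow>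
     disjoint_measure_valued_map Q M \<mu> \<and> M = integral_measure Q M \<mu> \<and>
     (\<forall>q\<in>space Q. banach_module (\<mu> q) (Ms q)) \<and>
     real_subalgebra (sec_quot Q (\<lambda>q. L0 (\<mu> q))) \<Phi> \<and> \<Phi> \<subseteq> L0_sections Q M \<mu> \<and>
     l0_topology M closure_of sec_glued Q M \<mu> \<Phi> = carrier (L0 M) \<and>
     vector_subspace (sec_quot Q Ms) \<Theta> \<and>
     (\<forall>f\<in>\<Phi>. \<forall>v\<in>\<Theta>. sec_act Q Ms f v \<in> \<Theta>) \<and>
     (\<forall>v\<in>\<Theta>. sec_norm Q \<mu> Ms v \<in> L0_sections Q M \<mu>)"

text \<open>
  \<open>\<Theta>\<close> as a normed module over the subalgebra \<open>from_sections Q M \<mu> ` \<Phi>\<close> of \<open>L0 M\<close>.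
\<close>

definition bundle_sections ::
    "'q measure \<Rightarrow> 'x measure \<Rightarrow> ('q \<Rightarrow> 'x measure) \<Rightarrow>
     ('q \<Rightarrow> (('x \<Rightarrow> real) set, 'v) nmodule) \<Rightarrow> ('q \<Rightarrow> 'v) set set \<Rightarrow>
     (('x \<Rightarrow> real) set, ('q \<Rightarrow> 'v) set) nmodule" where
  "bundle_sections Q M \<mu> Ms \<Theta> =
     \<lparr>carrier = \<Theta>,
      mult = mult (sec_quot Q Ms),
      one = one (sec_quot Q Ms),
      zero = zero (sec_quot Q Ms),
      add = add (sec_quot Q Ms),
      rscale = rscale (sec_quot Q Ms),
      act = (\<lambda>a. sec_act Q Ms (to_sections Q \<mu> a)),
      pnorm = (\<lambda>v. from_sections Q M \<mu> (sec_norm Q \<mu> Ms v))\<rparr>"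

text \<open>
  \<open>I\<close> is the integral of the bundle, an object determined only up to unique isomorphism.
\<close>

definition is_bundle_integral ::
    "'q measure \<Rightarrow> 'x measure \<Rightarrow> ('q \<Rightarrow> 'x measure) \<Rightarrow>
     ('q \<Rightarrow> (('x \<Rightarrow> real) set, 'v) nmodule) \<Rightarrow> ('q \<Rightarrow> 'v) set set \<Rightarrow>
     (('x \<Rightarrow> real) set, 'w) nmodule \<Rightarrow> bool" where
  "is_bundle_integral Q M \<mu> Ms \<Theta> I \<longleftrightarrow>
     (\<exists>\<iota>. is_completion M (bundle_sections Q M \<mu> Ms \<Theta>) I \<iota>)"

text \<open>
  HOL cannot quantify existentially over types, so the elements of the fibre modules of a bundle
  that is claimed to exist have to be drawn from a type built from those of the data.
  The following one is large enough: if \<open>W\<close> is the countable \<open>\<rat>\<close>-span of a countable set of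
  generators of a module with elements in \<open>'m\<close>, an element of a fibre is an equivalence class of
  maps sending a point of the base space to a sequence in \<open>W\<close>. For a module that is to be
  isomorphic to a given one, the type of the latter is large enough.
\<close>

type_synonym ('x, 'm) fibre = "('x \<Rightarrow> nat \<Rightarrow> 'm) set"

end

theory Submission
  imports Defs
begin

text \<open>
  A countably generated module embeds isometrically and \<open>L\<^sup>0\<close>-linearly into the module of
  (classes of) measurable maps into \<open>\<ell>\<^sup>\<infinity>\<close>, by a sequence of functionals \<open>T n\<close> with
  \<open>\<bar>v\<bar> = sup\<^sub>n \<bar>T n v\<bar>\<close> almost everywhere. Such functionals are first built on a countable dense
  subgroup, pointwise in \<open>x\<close> and by formulas that preserve measurability. Since a map into
  \<open>\<ell>\<^sup>\<infinity>\<close> can be reduced modulo \<open>\<mu> q\<close> for every \<open>q\<close>, one may take the space of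
  \<open>\<ell>\<^sup>\<infinity>\<close>-valued maps modulo \<open>\<mu> q\<close> as the fibre at every \<open>q\<close>, the image of the
  whole module as \<open>\<Theta>\<close>, and all sections as \<open>\<Phi>\<close>. The fibres are larger than necessary, but
  the integral only sees the closure of \<open>\<Theta>\<close>, which is the given module itself.
\<close>

section \<open>Calculus with classes of functions\<close>

text \<open>Vectors are tied to points only through \<open>pnorm\<close>, and only up to null sets.
  At a single x countably many relations can be used at once, but not all of them. Therefore the
  Hahn-Banach argument runs on a countable group that approximates each vector at almost every x,
  and its functionals are carried to all vectors by an infimum over that group. What results is
  additive and bounded by the norm; linearity over \<open>L0 M\<close> follows from these two
  properties, so the construction itself only has to respect sums. For arbitrary vectors each
  identity holds off a null set depending on the vectors. This is harmless: an \<open>M\<close>-null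
  set is \<open>\<mu> q\<close>-null for almost every q, and sections are only compared for almost
  every q. The elements of the fibres have to be built from sequences in the given module. Sequences
  of reals are coded there as sequences of multiples of one fixed nonzero vector.\<close>

lemma l0_class_eqI:
  assumes "AE x in M. F x = G x"
  shows "l0_class M F = l0_class M G"
  using assms unfolding l0_class_def by (auto elim!: eventually_elim2)

lemma class_rep_in: "a \<noteq> {} \<Longrightarrow> class_rep a \<in> a"
  unfolding class_rep_def by (simp add: some_in_eq)

lemma l0_class_self: "F \<in> borel_measurable M \<Longrightarrow> F \<in> l0_class M F"
  by (simp add: l0_class_def)

lemma class_rep_l0_class:
  assumes "F \<in> borel_measurable M"
  shows "class_rep (l0_class M F) \<in> borel_measurable M"
    and "AE x in M. class_rep (l0_class M F) x = F x"
  using class_rep_in[of "l0_class M F"] l0_class_self[OF assms] unfolding l0_class_def by auto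

lemma l0_class_eq_iff:
  assumes "F \<in> borel_measurable M" "G \<in> borel_measurable M"
  shows "l0_class M F = l0_class M G \<longleftrightarrow> (AE x in M. F x = G x)"
  using l0_class_eqI l0_class_self[OF assms(1)] unfolding l0_class_def
  by (metis (mono_tags, lifting) mem_Collect_eq)

lemma L0_carrier: "a \<in> carrier (L0 M) \<longleftrightarrow> (\<exists>F\<in>borel_measurable M. a = l0_class M F)"
  by (auto simp: L0_def)

lemma l0_class_in_carrier [simp]: "F \<in> borel_measurable M \<Longrightarrow> l0_class M F \<in> carrier (L0 M)"
  by (auto simp: L0_carrier)

lemma class_rep_measurable: "a \<in> carrier (L0 M) \<Longrightarrow> class_rep a \<in> borel_measurable M"
  by (auto simp: L0_carrier class_rep_l0_class)

lemma l0_class_class_rep: "a \<in> carrier (L0 M) \<Longrightarrow> l0_class M (class_rep a) = a"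
  by (auto simp: L0_carrier intro!: l0_class_eqI class_rep_l0_class)

lemma L0_eqI:
  assumes "a \<in> carrier (L0 M)" "b \<in> carrier (L0 M)" "AE x in M. class_rep a x = class_rep b x"
  shows "a = b"
  using assms l0_class_eqI l0_class_class_rep by metis

context
  fixes M :: "'x measure" and F G :: "'x \<Rightarrow> real"
  assumes F: "F \<in> borel_measurable M" and G: "G \<in> borel_measurable M"
begin

lemma L0_add: "l0_class M F \<oplus>\<^bsub>L0 M\<^esub> l0_class M G = l0_class M (\<lambda>x. F x + G x)"
  using class_rep_l0_class(2)[OF F] class_rep_l0_class(2)[OF G]
  by (auto simp: L0_def intro!: l0_class_eqI)

lemma L0_mult: "l0_class M F \<otimes>\<^bsub>L0 M\<^esub> l0_class M G = l0_class M (\<lambda>x. F x * G x)"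
  using class_rep_l0_class(2)[OF F] class_rep_l0_class(2)[OF G]
  by (auto simp: L0_def intro!: l0_class_eqI)

end

lemma L0_rscale:
  assumes "F \<in> borel_measurable M"
  shows "rscale (L0 M) c (l0_class M F) = l0_class M (\<lambda>x. c * F x)"
  using class_rep_l0_class(2)[OF assms] by (auto simp: L0_def intro!: l0_class_eqI)

lemma L0_abs:
  assumes "F \<in> borel_measurable M"
  shows "l0_abs M (l0_class M F) = l0_class M (\<lambda>x. \<bar>F x\<bar>)"
  using class_rep_l0_class(2)[OF assms] by (auto simp: l0_abs_def intro!: l0_class_eqI)

lemma L0_zero: "\<zero>\<^bsub>L0 M\<^esub> = l0_class M (\<lambda>x. 0)"
  by (simp add: L0_def)

lemmas L0_ops = L0_add L0_mult L0_rscale L0_abs L0_zero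

lemma L0_closed [simp]:
  "\<zero>\<^bsub>L0 M\<^esub> \<in> carrier (L0 M)"
  "\<lbrakk>a \<in> carrier (L0 M); b \<in> carrier (L0 M)\<rbrakk> \<Longrightarrow> a \<oplus>\<^bsub>L0 M\<^esub> b \<in> carrier (L0 M)"
  "\<lbrakk>a \<in> carrier (L0 M); b \<in> carrier (L0 M)\<rbrakk> \<Longrightarrow> a \<otimes>\<^bsub>L0 M\<^esub> b \<in> carrier (L0 M)"
  "a \<in> carrier (L0 M) \<Longrightarrow> rscale (L0 M) c a \<in> carrier (L0 M)"
  by (auto simp: L0_carrier L0_ops)

lemma L0_add_commute: "\<lbrakk>a \<in> carrier (L0 M); b \<in> carrier (L0 M)\<rbrakk> \<Longrightarrow> a \<oplus>\<^bsub>L0 M\<^esub> b = b \<oplus>\<^bsub>L0 M\<^esub> a"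
  by (auto simp: L0_carrier L0_ops add.commute)

lemma L0_abelian_monoid: "abelian_monoid (L0 M)"
proof (rule abelian_monoidI)
  fix a b c assume "a \<in> carrier (L0 M)" "b \<in> carrier (L0 M)" "c \<in> carrier (L0 M)"
  then show "a \<oplus>\<^bsub>L0 M\<^esub> b \<oplus>\<^bsub>L0 M\<^esub> c = a \<oplus>\<^bsub>L0 M\<^esub> (b \<oplus>\<^bsub>L0 M\<^esub> c)"
    by (auto simp: L0_carrier L0_ops add.assoc)
qed (auto simp: L0_add_commute L0_carrier L0_ops)

lemma real_subalgebra_L0: "real_subalgebra (L0 M) (carrier (L0 M))"
  by (auto simp: real_subalgebra_def vector_subspace_def)

lemma l0_ind_closed [simp]: "E \<in> sets M \<Longrightarrow> l0_ind M E \<in> carrier (L0 M)"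
  by (simp add: l0_ind_def)

text \<open>The axiom \<open>act_unit\<close> speaks of an arbitrary identity of the algebra. The
  product of e with the class of 1 is e by computation and the class of 1 by the identity
  property.\<close>

lemma L0_unit:
  assumes e: "e \<in> carrier (L0 M)" and unit: "\<And>f. f \<in> carrier (L0 M) \<Longrightarrow> e \<otimes>\<^bsub>L0 M\<^esub> f = f"
  shows "e = l0_class M (\<lambda>x. 1)"
proof -
  obtain F where F: "F \<in> borel_measurable M" "e = l0_class M F"
    using e by (auto simp: L0_carrier)
  then have "e \<otimes>\<^bsub>L0 M\<^esub> l0_class M (\<lambda>x. 1) = e"
    by (simp add: L0_ops)
  with unit show ?thesis by simp
qed

section \<open>Convergence in measure\<close>

lemma l0_ref_measure:
  assumes "sigma_finite_measure M"
  shows "finite_measure (l0_ref_measure M)" and "sets (l0_ref_measure M) = sets M"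
    and "(AE x in l0_ref_measure M. P x) \<longleftrightarrow> (AE x in M. P x)"
proof -
  interpret sigma_finite_measure M by fact
  obtain h where h [measurable]: "h \<in> borel_measurable M"
    and hfin: "integral\<^sup>N M h \<noteq> \<infinity>" and hpos: "\<And>x. x \<in> space M \<Longrightarrow> 0 < h x"
    using Ex_finite_integrable_function by auto
  \<comment> \<open>Since \<open>h\<close> is positive with finite integral, the density gives a
    finite measure and creates no new null sets; the truncation at 1 keeps it below
    \<open>M\<close>.\<close>
  define \<nu> where "\<nu> = density M (\<lambda>x. min (h x) 1)"
  have "finite_measure \<nu>"
  proof
    have "emeasure \<nu> (space \<nu>) = (\<integral>\<^sup>+ x. min (h x) 1 \<partial>M)"
      by (auto simp: \<nu>_def emeasure_density intro!: nn_integral_cong)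
    also have "\<dots> \<le> integral\<^sup>N M h"
      by (intro nn_integral_mono) auto
    finally show "emeasure \<nu> (space \<nu>) \<noteq> \<infinity>"
      using hfin by (auto simp: top_unique)
  qed
  moreover have "absolutely_continuous \<nu> M"
    unfolding absolutely_continuous_def \<nu>_def
  proof
    fix A assume "A \<in> null_sets (density M (\<lambda>x. min (h x) 1))"
    then have A: "A \<in> sets M" and "AE x in M. x \<in> A \<longrightarrow> min (h x) 1 = 0"
      by (simp_all add: null_sets_density_iff)
    from this(2) AE_space have "AE x in M. x \<notin> A"
    proof eventually_elim
      case (elim x)
      then show ?case using hpos[of x] by (auto simp: min_def split: if_splits)
    qed
    then show "A \<in> null_sets M"
      using A AE_iff_null_sets by blast
  qed
  moreover have "emeasure \<nu> A \<le> emeasure M A" if "A \<in> sets M" for A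
  proof -
    have "emeasure \<nu> A = (\<integral>\<^sup>+ x. min (h x) 1 * indicator A x \<partial>M)"
      using that by (simp add: \<nu>_def emeasure_density)
    also have "\<dots> \<le> (\<integral>\<^sup>+ x. indicator A x \<partial>M)"
      by (intro nn_integral_mono) (auto simp: indicator_def)
    finally show ?thesis using that by simp
  qed
  moreover have "sets \<nu> = sets M" by (simp add: \<nu>_def)
  ultimately have ex: "finite_measure \<nu> \<and> sets \<nu> = sets M \<and>
     absolutely_continuous \<nu> M \<and> (\<forall>A\<in>sets M. emeasure \<nu> A \<le> emeasure M A)"
    by blast
  define \<rho> where "\<rho> = l0_ref_measure M"
  have \<rho>: "finite_measure \<rho> \<and> sets \<rho> = sets M \<and>
     absolutely_continuous \<rho> M \<and> (\<forall>A\<in>sets M. emeasure \<rho> A \<le> emeasure M A)"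
    unfolding \<rho>_def l0_ref_measure_def using ex by (rule someI)
  then show "finite_measure (l0_ref_measure M)" "sets (l0_ref_measure M) = sets M"
    by (auto simp: \<rho>_def)
  have "null_sets \<rho> = null_sets M"
    using \<rho> by (auto simp: absolutely_continuous_def null_sets_def)
  then show "(AE x in l0_ref_measure M. P x) \<longleftrightarrow> (AE x in M. P x)"
    using \<rho> sets_eq_imp_space_eq[of \<rho> M] by (simp add: eventually_ae_filter flip: \<rho>_def)
qed

text \<open>The distance to 0, for a function instead of a class. Measurable functions that agree
  almost everywhere have the same size (\<open>l0_size_cong\<close>), so estimates can be made on
  representatives.\<close>

definition l0_size :: "'x measure \<Rightarrow> ('x \<Rightarrow> real) \<Rightarrow> real" where
  "l0_size M g = (LINT x|l0_ref_measure M. min \<bar>g x\<bar> 1)"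

context
  fixes M :: "'x measure"
  assumes sf: "sigma_finite_measure M"
begin

lemma measurable_l0_ref_measure: "g \<in> borel_measurable M \<Longrightarrow> g \<in> borel_measurable (l0_ref_measure M)"
  using l0_ref_measure(2)[OF sf] by (simp cong: measurable_cong_sets)

lemma l0_size_integrable:
  assumes "g \<in> borel_measurable M"
  shows "integrable (l0_ref_measure M) (\<lambda>x. min \<bar>g x\<bar> 1 :: real)"
proof -
  interpret finite_measure "l0_ref_measure M" by (rule l0_ref_measure[OF sf])
  show ?thesis
    using measurable_l0_ref_measure[OF assms]
    by (intro integrable_const_bound[where B=1]) auto
qed

lemma l0_size_nonneg: "0 \<le> l0_size M g"
  unfolding l0_size_def by simp

lemma l0_size_mono:
  assumes "f \<in> borel_measurable M" "g \<in> borel_measurable M" "AE x in M. \<bar>f x\<bar> \<le> \<bar>g x\<bar>"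
  shows "l0_size M f \<le> l0_size M g"
  unfolding l0_size_def using assms
  by (intro integral_mono_AE l0_size_integrable) (auto simp: l0_ref_measure[OF sf] elim!: eventually_mono)

lemma l0_size_cong:
  assumes "f \<in> borel_measurable M" "g \<in> borel_measurable M" "AE x in M. \<bar>f x\<bar> = \<bar>g x\<bar>"
  shows "l0_size M f = l0_size M g"
  using assms by (intro antisym l0_size_mono) (auto elim!: eventually_mono)

lemma l0_size_triangle:
  assumes "f \<in> borel_measurable M" "g \<in> borel_measurable M" "h \<in> borel_measurable M"
    and "AE x in M. \<bar>f x\<bar> \<le> \<bar>g x\<bar> + \<bar>h x\<bar>"
  shows "l0_size M f \<le> l0_size M g + l0_size M h"
proof -
  have "l0_size M f \<le> (LINT x|l0_ref_measure M. min \<bar>g x\<bar> 1 + min \<bar>h x\<bar> 1)"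
    unfolding l0_size_def using assms
    by (intro integral_mono_AE Bochner_Integration.integrable_add l0_size_integrable)
       (auto simp: l0_ref_measure[OF sf] elim!: eventually_mono)
  also have "\<dots> = l0_size M g + l0_size M h"
    unfolding l0_size_def by (simp add: l0_size_integrable assms)
  finally show ?thesis .
qed

lemma l0_size_eq_0_iff:
  assumes "g \<in> borel_measurable M"
  shows "l0_size M g = 0 \<longleftrightarrow> (AE x in M. g x = 0)"
proof -
  have "l0_size M g = 0 \<longleftrightarrow> (AE x in l0_ref_measure M. min \<bar>g x\<bar> 1 = 0)"
    unfolding l0_size_def using assms
    by (intro integral_nonneg_eq_0_iff_AE l0_size_integrable) auto
  also have "\<dots> \<longleftrightarrow> (AE x in M. g x = 0)"
    unfolding l0_ref_measure(3)[OF sf] by (intro AE_cong) (auto simp: min_def)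
  finally show ?thesis .
qed

lemma l0_size_tendsto_0:
  assumes [measurable]: "\<And>k. g k \<in> borel_measurable M" and "AE x in M. (\<lambda>k. g k x) \<longlonglongrightarrow> 0"
  shows "(\<lambda>k. l0_size M (g k)) \<longlonglongrightarrow> 0"
proof -
  interpret finite_measure "l0_ref_measure M" by (rule l0_ref_measure[OF sf])
  have "(\<lambda>k. LINT x|l0_ref_measure M. min \<bar>g k x\<bar> 1) \<longlonglongrightarrow> (LINT x|l0_ref_measure M. 0)"
  proof (rule integral_dominated_convergence[where w="\<lambda>_. 1"])
    show "AE x in l0_ref_measure M. (\<lambda>k. min \<bar>g k x\<bar> 1) \<longlonglongrightarrow> 0"
      unfolding l0_ref_measure(3)[OF sf] using assms(2)
    proof eventually_elim
      case (elim x)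
      have "(\<lambda>k. min \<bar>g k x\<bar> 1) \<longlonglongrightarrow> min \<bar>0\<bar> 1"
        by (intro tendsto_intros elim)
      then show ?case by simp
    qed
  qed (auto intro!: borel_measurable_min borel_measurable_abs measurable_l0_ref_measure)
  then show ?thesis by (simp add: l0_size_def)
qed

text \<open>The sum of the truncated terms has a finite integral and so is finite almost everywhere.
  Its terms then tend to 0, hence the truncation at 1 affects only finitely many of them.\<close>

lemma l0_size_summable_AE:
  assumes g [measurable]: "\<And>k. g k \<in> borel_measurable M" and "summable (\<lambda>k. l0_size M (g k))"
  shows "AE x in M. summable (\<lambda>k. \<bar>g k x\<bar>)"
proof -
  note [measurable] = measurable_l0_ref_measure[OF g]
  have "(\<integral>\<^sup>+x. (\<Sum>k. ennreal (min \<bar>g k x\<bar> 1)) \<partial>l0_ref_measure M)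
      = (\<Sum>k. \<integral>\<^sup>+x. ennreal (min \<bar>g k x\<bar> 1) \<partial>l0_ref_measure M)"
    by (rule nn_integral_suminf) measurable
  also have "\<dots> = (\<Sum>k. ennreal (l0_size M (g k)))"
    unfolding l0_size_def
    by (intro suminf_cong nn_integral_eq_integral l0_size_integrable) auto
  also have "\<dots> = ennreal (\<Sum>k. l0_size M (g k))"
    by (intro suminf_ennreal2 assms l0_size_nonneg)
  finally have "(\<integral>\<^sup>+x. (\<Sum>k. ennreal (min \<bar>g k x\<bar> 1)) \<partial>l0_ref_measure M) \<noteq> \<infinity>"
    by simp
  then have "AE x in l0_ref_measure M. (\<Sum>k. ennreal (min \<bar>g k x\<bar> 1)) \<noteq> \<infinity>"
    by (intro nn_integral_PInf_AE) auto
  then have "AE x in M. (\<Sum>k. ennreal (min \<bar>g k x\<bar> 1)) \<noteq> \<infinity>"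
    by (simp add: l0_ref_measure(3)[OF sf])
  then show ?thesis
  proof eventually_elim
    case (elim x)
    then have s: "summable (\<lambda>k. min \<bar>g k x\<bar> 1)"
      by (intro summable_suminf_not_top) auto
    then have "(\<lambda>k. min \<bar>g k x\<bar> 1) \<longlonglongrightarrow> 0" by (rule summable_LIMSEQ_zero)
    then have "\<forall>\<^sub>F k in sequentially. min \<bar>g k x\<bar> 1 < 1"
      by (rule order_tendstoD) simp
    then have "\<forall>\<^sub>F k in sequentially. min \<bar>g k x\<bar> 1 = \<bar>g k x\<bar>"
      by eventually_elim auto
    then show ?case using s summable_cong by fast
  qed
qed

lemma l0_dist_eq: "l0_dist M a b = l0_size M (\<lambda>x. class_rep a x - class_rep b x)"
  by (simp add: l0_dist_def l0_size_def)

lemma Metric_space_L0: "Metric_space (carrier (L0 M)) (l0_dist M)"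
proof
  fix a b c assume a: "a \<in> carrier (L0 M)" and b: "b \<in> carrier (L0 M)" and c: "c \<in> carrier (L0 M)"
  note m = class_rep_measurable[OF a] class_rep_measurable[OF b] class_rep_measurable[OF c]
  show "l0_dist M a b = 0 \<longleftrightarrow> a = b"
    unfolding l0_dist_eq using m L0_eqI[OF a b] by (auto simp: l0_size_eq_0_iff)
  show "l0_dist M a c \<le> l0_dist M a b + l0_dist M b c"
    unfolding l0_dist_eq using m by (intro l0_size_triangle) auto
qed (simp_all add: l0_dist_def abs_minus_commute)

end

section \<open>Normed modules\<close>

context real_vs
begin

lemma rscale_zero_left [simp]: "v \<in> carrier V \<Longrightarrow> rscale V 0 v = \<zero>"
  using rscale_add_left[of v 0 0] rscale_closed[of v 0] by (simp add: add.r_cancel_one')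

lemma rscale_zero_right [simp]: "rscale V c \<zero> = \<zero>"
  using rscale_add_right[of "\<zero>" "\<zero>" c] rscale_closed[of "\<zero>" c] by (simp add: add.r_cancel_one')

lemma rscale_minus_one: "v \<in> carrier V \<Longrightarrow> rscale V (-1) v = \<ominus> v"
  using rscale_add_left[of v "-1" 1] by (simp add: rscale_one rscale_closed minus_equality)

lemma minus_zero [simp]: "\<ominus> \<zero> = \<zero>"
  by (rule minus_equality) simp_all

lemma minus_eq_zero_iff: "\<lbrakk>v \<in> carrier V; w \<in> carrier V\<rbrakk> \<Longrightarrow> v \<ominus> w = \<zero> \<longleftrightarrow> v = w"
  using minus_equality[of v "\<ominus> w"] by (auto simp: minus_eq r_neg)

lemma rscale_diff: "v \<in> carrier V \<Longrightarrow> rscale V (c - d) v = rscale V c v \<ominus> rscale V d v"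
  using rscale_add_left[of v c "-d"]
  by (simp add: minus_eq rscale_closed rscale_rscale flip: rscale_minus_one)

lemma add_minus_add:
  assumes "a \<in> carrier V" "b \<in> carrier V" "c \<in> carrier V" "d \<in> carrier V"
  shows "(a \<oplus> b) \<ominus> (c \<oplus> d) = (a \<ominus> c) \<oplus> (b \<ominus> d)"
  using assms by (simp add: minus_eq minus_add a_ac)

lemma minus_split:
  assumes "a \<in> carrier V" "b \<in> carrier V" "c \<in> carrier V"
  shows "a \<ominus> c = (a \<ominus> b) \<oplus> (b \<ominus> c)"
proof -
  have "(a \<ominus> b) \<oplus> (b \<ominus> c) = a \<oplus> (\<ominus> b \<oplus> (b \<oplus> \<ominus> c))"
    using assms by (simp add: minus_eq a_assoc)
  also have "\<ominus> b \<oplus> (b \<oplus> \<ominus> c) = \<ominus> c"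
    using assms by (simp add: r_neg1)
  finally show ?thesis by (simp add: minus_eq)
qed

end

context normed_module
begin

abbreviation pn :: "'v \<Rightarrow> 'x \<Rightarrow> real" where
  "pn v \<equiv> class_rep (pnorm N v)"

lemma A_subset: "f \<in> A \<Longrightarrow> f \<in> carrier (L0 M)"
  using subalg by (auto simp: real_subalgebra_def vector_subspace_def)

lemma pn_measurable [measurable]: "v \<in> carrier N \<Longrightarrow> pn v \<in> borel_measurable M"
  by (simp add: class_rep_measurable pnorm_closed)

lemma pn_zero: "AE x in M. pn \<zero> x = 0"
  using pnorm_eq_zero[of "\<zero>"] class_rep_l0_class(2)[of "\<lambda>_. 0" M] by (simp add: L0_zero)

lemma pn_eq_zeroD:
  assumes "v \<in> carrier N" "AE x in M. pn v x = 0"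
  shows "v = \<zero>"
proof -
  have "l0_class M (pn v) = l0_class M (\<lambda>_. 0)"
    using assms by (intro l0_class_eqI)
  then show ?thesis
    using assms pnorm_eq_zero by (simp add: l0_class_class_rep pnorm_closed L0_zero)
qed

lemma pn_rscale:
  assumes "v \<in> carrier N"
  shows "AE x in M. pn (rscale N c v) x = \<bar>c\<bar> * pn v x"
proof -
  have "pnorm N (rscale N c v) = rscale (L0 M) \<bar>c\<bar> (l0_class M (pn v))"
    using assms by (simp add: pnorm_rscale l0_class_class_rep pnorm_closed)
  also have "\<dots> = l0_class M (\<lambda>x. \<bar>c\<bar> * pn v x)"
    using assms by (intro L0_rscale) simp
  finally show ?thesis
    using assms class_rep_l0_class(2)[of "\<lambda>x. \<bar>c\<bar> * pn v x" M] by simp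
qed

lemma pn_act:
  assumes "f \<in> A" "v \<in> carrier N"
  shows "AE x in M. pn (act N f v) x = \<bar>class_rep f x\<bar> * pn v x"
proof -
  note f = class_rep_measurable[OF A_subset[OF assms(1)]]
  have "pnorm N (act N f v) = l0_abs M (l0_class M (class_rep f)) \<otimes>\<^bsub>L0 M\<^esub> l0_class M (pn v)"
    using assms by (simp add: pnorm_act l0_class_class_rep pnorm_closed A_subset)
  also have "\<dots> = l0_class M (\<lambda>x. \<bar>class_rep f x\<bar> * pn v x)"
    using assms f by (simp add: L0_ops)
  finally show ?thesis
    using assms f class_rep_l0_class(2)[of "\<lambda>x. \<bar>class_rep f x\<bar> * pn v x" M] by simp
qed

lemma pn_minus_triangle:
  assumes "u \<in> carrier N" "v \<in> carrier N" "w \<in> carrier N"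
  shows "AE x in M. pn (u \<ominus> w) x \<le> pn (u \<ominus> v) x + pn (v \<ominus> w) x"
  using pnorm_triangle[of "u \<ominus> v" "v \<ominus> w"] minus_split[of u v w] assms by simp

lemma pn_uminus:
  assumes "v \<in> carrier N"
  shows "AE x in M. pn (\<ominus> v) x = pn v x"
  using pn_rscale[OF assms, of "-1"] assms by (simp add: rscale_minus_one)

lemma pn_minus_commute:
  assumes "v \<in> carrier N" "w \<in> carrier N"
  shows "AE x in M. pn (v \<ominus> w) x = pn (w \<ominus> v) x"
proof -
  have "\<ominus> (w \<ominus> v) = v \<ominus> w"
    using assms by (simp add: minus_eq minus_add a_comm)
  then show ?thesis
    using pn_uminus[of "w \<ominus> v"] assms by simp
qed

text \<open>Allows two coefficients to be compared at a point; it is applied to an indicator against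
  the constant 1 and to a function against rational constants.\<close>

lemma act_diff:
  assumes "f \<in> A" "g \<in> A" "v \<in> carrier N"
  shows "AE x in M. pn (act N f v \<ominus> act N g v) x = \<bar>class_rep f x - class_rep g x\<bar> * pn v x"
proof -
  define h where "h = rscale (L0 M) (-1) g"
  have h: "h \<in> A" and fh: "f \<oplus>\<^bsub>L0 M\<^esub> h \<in> A"
    using assms subalg by (auto simp: h_def real_subalgebra_def vector_subspace_def)
  have "act N h v = \<ominus> act N g v"
    using assms by (simp add: h_def act_rscale rscale_minus_one act_closed)
  then have "act N f v \<ominus> act N g v = act N (f \<oplus>\<^bsub>L0 M\<^esub> h) v"
    using assms h by (simp add: act_add_left minus_eq)
  moreover have "AE x in M. class_rep (f \<oplus>\<^bsub>L0 M\<^esub> h) x = class_rep f x - class_rep g x"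
  proof -
    note m = class_rep_measurable[OF A_subset[OF assms(1)]] class_rep_measurable[OF A_subset[OF assms(2)]]
    have "f \<oplus>\<^bsub>L0 M\<^esub> h = l0_class M (class_rep f) \<oplus>\<^bsub>L0 M\<^esub> rscale (L0 M) (-1) (l0_class M (class_rep g))"
      using assms by (simp add: h_def l0_class_class_rep A_subset)
    also have "\<dots> = l0_class M (\<lambda>x. class_rep f x - class_rep g x)"
      using m by (simp add: L0_ops)
    finally show ?thesis
      using m class_rep_l0_class(2)[of "\<lambda>x. class_rep f x - class_rep g x" M] by simp
  qed
  ultimately show ?thesis
    using pn_act[OF fh assms(3)] by auto
qed

section \<open>The metric of a normed module\<close>

context
  assumes sf: "sigma_finite_measure M"
begin

lemma nm_dist_eq:
  assumes "v \<in> carrier N" "w \<in> carrier N"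
  shows "nm_dist M N v w = l0_size M (pn (v \<ominus> w))"
proof -
  have "AE x in M. class_rep \<zero>\<^bsub>L0 M\<^esub> x = 0"
    unfolding L0_zero by (rule class_rep_l0_class) simp
  then show ?thesis
    using assms class_rep_measurable[of "\<zero>\<^bsub>L0 M\<^esub>" M]
    by (auto simp: nm_dist_def l0_dist_eq[OF sf] intro!: l0_size_cong[OF sf] elim!: eventually_mono)
qed

lemma Metric_space_nm: "Metric_space (carrier N) (nm_dist M N)"
proof
  fix u v show "0 \<le> nm_dist M N u v"
    by (cases "u \<in> carrier N \<and> v \<in> carrier N")
       (auto simp: nm_dist_eq l0_size_nonneg[OF sf], auto simp: nm_dist_def)
  show "nm_dist M N u v = nm_dist M N v u"
  proof (cases "u \<in> carrier N \<and> v \<in> carrier N")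
    case True
    then show ?thesis using pn_minus_commute[of u v]
      by (auto simp: nm_dist_eq intro!: l0_size_cong[OF sf] elim!: eventually_mono)
  qed (auto simp: nm_dist_def)
next
  fix u v w assume uvw: "u \<in> carrier N" "v \<in> carrier N" "w \<in> carrier N"
  have "nm_dist M N u v = 0 \<longleftrightarrow> u \<ominus> v = \<zero>"
    using uvw pn_eq_zeroD[of "u \<ominus> v"] pn_zero by (auto simp: nm_dist_eq l0_size_eq_0_iff[OF sf])
  then show "nm_dist M N u v = 0 \<longleftrightarrow> u = v"
    using uvw by (simp add: minus_eq_zero_iff)
  show "nm_dist M N u w \<le> nm_dist M N u v + nm_dist M N v w"
  proof -
    have "AE x in M. \<bar>pn (u \<ominus> w) x\<bar> \<le> \<bar>pn (u \<ominus> v) x\<bar> + \<bar>pn (v \<ominus> w) x\<bar>"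
      using pn_minus_triangle[OF uvw] pnorm_nonneg[OF minus_closed[OF uvw(1,3)]]
      by eventually_elim auto
    then show ?thesis
      using uvw by (auto simp: nm_dist_eq intro!: l0_size_triangle[OF sf])
  qed
qed

lemma limitin_nm_iff:
  assumes "range \<sigma> \<subseteq> carrier N" "v \<in> carrier N"
  shows "limitin (nm_topology M N) \<sigma> v sequentially \<longleftrightarrow> (\<lambda>k. l0_size M (pn (\<sigma> k \<ominus> v))) \<longlonglongrightarrow> 0"
  using assms
  by (auto simp: Metric_space.limitin_metric_dist_null[OF Metric_space_nm] nm_dist_eq range_subsetD)

text \<open>A Cauchy sequence has a subsequence whose successive distances are at most
  \<open>(1/2)^k\<close>, and by \<open>l0_size_summable_AE\<close> the norms of its steps are
  summable at almost every x. So completeness becomes a question about convergence at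
  points.\<close>

lemma mcompleteI:
  assumes lim: "\<And>\<sigma>. \<lbrakk>range \<sigma> \<subseteq> carrier N; AE x in M. summable (\<lambda>k. \<bar>pn (\<sigma> (Suc k) \<ominus> \<sigma> k) x\<bar>)\<rbrakk> \<Longrightarrow>
    \<exists>v\<in>carrier N. AE x in M. (\<lambda>k. pn (\<sigma> k \<ominus> v) x) \<longlonglongrightarrow> 0"
  shows "Metric_space.mcomplete (carrier N) (nm_dist M N)"
proof -
  interpret S: Metric_space "carrier N" "nm_dist M N" by (rule Metric_space_nm)
  show ?thesis
    unfolding S.mcomplete_def
  proof (intro allI impI)
    fix \<sigma> assume \<sigma>: "S.MCauchy \<sigma>"
    then have ran: "range \<sigma> \<subseteq> carrier N" by (simp add: S.MCauchy_def)
    have "\<forall>k. \<exists>m. \<forall>n n'. m \<le> n \<longrightarrow> m \<le> n' \<longrightarrow> nm_dist M N (\<sigma> n) (\<sigma> n') < (1/2)^k"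
      using \<sigma> by (simp add: S.MCauchy_def)
    then obtain m where m: "\<And>k n n'. \<lbrakk>m k \<le> n; m k \<le> n'\<rbrakk> \<Longrightarrow> nm_dist M N (\<sigma> n) (\<sigma> n') < (1/2)^k"
      by metis
    \<comment> \<open>The sum makes \<open>r\<close> strictly increasing and keeps
      \<open>r k\<close> at or above \<open>m k\<close>.\<close>
    define r where "r k = (\<Sum>i\<le>k. Suc (m i))" for k
    have r: "strict_mono r" by (rule strict_mono_Suc_iff[THEN iffD2]) (simp add: r_def)
    have mr: "m k \<le> r k" for k
      by (cases k) (auto simp: r_def)
    define \<tau> where "\<tau> = \<sigma> \<circ> r"
    have \<tau>: "range \<tau> \<subseteq> carrier N" using ran by (auto simp: \<tau>_def)
    then have \<tau>c [simp]: "\<tau> k \<in> carrier N" for k by auto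
    have "l0_size M (pn (\<tau> (Suc k) \<ominus> \<tau> k)) \<le> (1/2)^k" for k
      using m[OF order_trans[OF mr strict_mono_leD[OF r]] mr, of k "Suc k"]
      by (simp add: \<tau>_def nm_dist_eq range_subsetD[OF ran])
    then have "summable (\<lambda>k. l0_size M (pn (\<tau> (Suc k) \<ominus> \<tau> k)))"
      by (intro summable_comparison_test'[OF summable_geometric[of "1/2::real"]])
         (simp_all add: l0_size_nonneg[OF sf])
    then have "AE x in M. summable (\<lambda>k. \<bar>pn (\<tau> (Suc k) \<ominus> \<tau> k) x\<bar>)"
      by (intro l0_size_summable_AE[OF sf]) simp_all
    from lim[OF \<tau> this] obtain v where v: "v \<in> carrier N"
      and "AE x in M. (\<lambda>k. pn (\<tau> k \<ominus> v) x) \<longlonglongrightarrow> 0" by blast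
    then have "limitin S.mtopology \<tau> v sequentially"
      by (subst limitin_nm_iff[OF \<tau> v]) (auto intro!: l0_size_tendsto_0[OF sf])
    then have "limitin S.mtopology \<sigma> v sequentially"
      unfolding \<tau>_def by (rule S.MCauchy_convergent_subsequence[OF \<sigma> r])
    then show "\<exists>v. limitin S.mtopology \<sigma> v sequentially" ..
  qed
qed

end

end

section \<open>A countable dense subgroup\<close>

locale l0_module = normed_module M "carrier (L0 M)" N
  for M :: "'x measure" and N :: "(('x \<Rightarrow> real) set, 'v) nmodule" (structure) +
  assumes sf: "sigma_finite_measure M"
begin

lemma act_l0_class_one: "v \<in> carrier N \<Longrightarrow> act N (l0_class M (\<lambda>_. 1)) v = v"
  by (rule act_unit) (auto simp: L0_carrier L0_ops)

lemma pn_act_ind: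
  assumes "E \<in> sets M" "v \<in> carrier N"
  shows "AE x in M. pn (act N (l0_ind M E) v) x = indicat_real E x * pn v x"
proof -
  have "AE x in M. class_rep (l0_ind M E) x = indicat_real E x"
    unfolding l0_ind_def using assms by (intro class_rep_l0_class) simp
  then show ?thesis
    using pn_act[of "l0_ind M E" v] assms by auto
qed

lemma pn_act_ind_minus:
  assumes "E \<in> sets M" "v \<in> carrier N"
  shows "AE x in M. x \<in> E \<longrightarrow> pn (act N (l0_ind M E) v \<ominus> v) x = 0"
proof -
  have "AE x in M. class_rep (l0_ind M E) x = indicat_real E x"
    unfolding l0_ind_def using assms by (intro class_rep_l0_class) simp
  moreover have "AE x in M. class_rep (l0_class M (\<lambda>_. 1)) x = 1"
    by (rule class_rep_l0_class) simp
  ultimately show ?thesis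
    using act_diff[of "l0_ind M E" "l0_class M (\<lambda>_. 1)" v] assms
    by (auto simp: act_l0_class_one)
qed

text \<open>Vectors have no values at points; vanishing of the norm of a difference at x stands for
  agreement at x. In the step from k to k + 1 the new summand vanishes off \<open>E k\<close>, and
  on \<open>E k\<close> it agrees with \<open>v k\<close> while all earlier summands vanish.\<close>

lemma glued_partial_sums:
  assumes E: "countable_partition M E" and v: "range v \<subseteq> carrier N"
  defines "P \<equiv> \<lambda>k. finsum N (\<lambda>n. act N (l0_ind M (E n)) (v n)) {..<k}"
  shows "P k \<in> carrier N"
    and "AE x in M. \<forall>n. x \<in> E n \<longrightarrow> pn (P k \<ominus> (if n < k then v n else \<zero>)) x = 0"
proof -
  have E': "E n \<in> sets M" "n \<noteq> m \<Longrightarrow> E n \<inter> E m = {}" for n m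
    using E by (auto simp: countable_partition_def disjoint_family_on_def)
  have v': "v n \<in> carrier N" for n using v by auto
  have a: "act N (l0_ind M (E n)) (v n) \<in> carrier N" for n
    by (intro act_closed l0_ind_closed E' v')
  show Pc: "P k \<in> carrier N" for k
    unfolding P_def using a by (intro finsum_closed) auto
  show "AE x in M. \<forall>n. x \<in> E n \<longrightarrow> pn (P k \<ominus> (if n < k then v n else \<zero>)) x = 0"
  proof (induction k)
    case 0
    have "P 0 \<ominus> \<zero> = \<zero>" by (simp add: P_def minus_eq)
    then show ?case using pn_zero by auto
  next
    case (Suc k)
    define w where "w n = (if n < k then v n else \<zero>)" for n
    have wc: "w n \<in> carrier N" for n by (simp add: w_def v')
    have PS: "P (Suc k) = act N (l0_ind M (E k)) (v k) \<oplus> P k"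
      unfolding P_def lessThan_Suc using a by (subst finsum_insert) auto
    have 1: "AE x in M. \<forall>n. pn (P (Suc k) \<ominus> w n) x \<le> pn (act N (l0_ind M (E k)) (v k)) x + pn (P k \<ominus> w n) x"
      unfolding AE_all_countable
    proof
      fix n
      have "P (Suc k) \<ominus> w n = act N (l0_ind M (E k)) (v k) \<oplus> (P k \<ominus> w n)"
        using a Pc wc by (simp add: PS minus_eq a_assoc)
      then show "AE x in M. pn (P (Suc k) \<ominus> w n) x
          \<le> pn (act N (l0_ind M (E k)) (v k)) x + pn (P k \<ominus> w n) x"
        using pnorm_triangle[of "act N (l0_ind M (E k)) (v k)" "P k \<ominus> w n"] a Pc wc by simp
    qed
    have 2: "AE x in M. pn (P (Suc k) \<ominus> v k) x \<le> pn (act N (l0_ind M (E k)) (v k) \<ominus> v k) x + pn (P k) x"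
    proof -
      have "P (Suc k) \<ominus> v k = (act N (l0_ind M (E k)) (v k) \<ominus> v k) \<oplus> P k"
        using a Pc v' by (simp add: PS minus_eq a_ac)
      then show ?thesis
        using pnorm_triangle[of "act N (l0_ind M (E k)) (v k) \<ominus> v k" "P k"] a Pc v' by simp
    qed
    have 3: "AE x in M. \<forall>n. 0 \<le> pn (P (Suc k) \<ominus> w n) x"
      unfolding AE_all_countable by (auto intro!: pnorm_nonneg Pc wc)
    have 4: "AE x in M. 0 \<le> pn (P (Suc k) \<ominus> v k) x"
      by (auto intro!: pnorm_nonneg Pc v')
    show ?case
      using Suc 1 2 3 4 pn_act_ind[OF E'(1) v', of k k] pn_act_ind_minus[OF E'(1) v', of k k]
    proof eventually_elim
      case (elim x)
      show ?case
      proof (intro allI impI)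
        fix n assume n: "x \<in> E n"
        show "pn (P (Suc k) \<ominus> (if n < Suc k then v n else \<zero>)) x = 0"
        \<comment> \<open>For n = k the induction hypothesis still has zero in the place of
          \<open>v n\<close>: it says that \<open>P k\<close> vanishes on
          \<open>E k\<close>.\<close>
        proof (cases "n = k")
          case True
          moreover have "pn (P k) x = 0"
            using elim(1) n True Pc by (auto simp: minus_eq dest!: spec[of _ n])
          ultimately show ?thesis using elim n by auto
        next
          case False
          then have "x \<notin> E k" using E' n by auto
          moreover have "(if n < Suc k then v n else \<zero>) = w n"
            using False by (simp add: w_def)
          moreover have "pn (P k \<ominus> w n) x = 0"
            using elim(1) n by (simp add: w_def)
          ultimately show ?thesis using elim(2,4,6) by (auto intro!: antisym dest: spec[of _ n])
        qed
      qed
    qed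
  qed
qed

text \<open>The approximating w may depend on x, so a countable W can approximate glued vectors
  without being closed under gluing. The null set may depend on u, but not on e.\<close>

definition approx :: "'v set \<Rightarrow> 'v \<Rightarrow> bool" where
  "approx W u \<longleftrightarrow> (AE x in M. \<forall>e>0. \<exists>w\<in>W. pn (u \<ominus> w) x < e)"

text \<open>For k > n the partial sum \<open>P k\<close> agrees with \<open>v n\<close> on
  \<open>E n\<close>. Hence the part over \<open>E n\<close> of the norm of the difference between s
  and \<open>v n\<close> has size at most the distance from \<open>P k\<close> to s, which tends to
  0. So s agrees with \<open>v n\<close> on \<open>E n\<close> and inherits its approximations
  there.\<close>

lemma approx_glued:
  assumes W: "countable W" "W \<subseteq> carrier N" and V: "V \<subseteq> carrier N" "\<And>v. v \<in> V \<Longrightarrow> approx W v"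
    and s: "s \<in> glued M N V"
  shows "approx W s"
proof -
  obtain E v where E: "countable_partition M E" and v: "range v \<subseteq> V" and sc: "s \<in> carrier N"
    and lim: "limitin (nm_topology M N)
       (\<lambda>k. finsum N (\<lambda>n. act N (l0_ind M (E n)) (v n)) {..<k}) s sequentially"
    using s unfolding glued_def by blast
  define P where "P k = finsum N (\<lambda>n. act N (l0_ind M (E n)) (v n)) {..<k}" for k
  have vc: "range v \<subseteq> carrier N" and vn: "v n \<in> carrier N" for n using v V by auto
  have En: "E n \<in> sets M" for n using E by (auto simp: countable_partition_def)
  note P = glued_partial_sums[OF E vc, folded P_def]
  have lim: "(\<lambda>k. l0_size M (pn (P k \<ominus> s))) \<longlonglongrightarrow> 0"
    using lim P(1) sc unfolding P_def[abs_def] by (subst limitin_nm_iff[OF sf, symmetric]) auto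
  have "AE x in M. x \<in> E n \<longrightarrow> pn (s \<ominus> v n) x = 0" for n
  proof -
    define g where "g x = indicat_real (E n) x * pn (s \<ominus> v n) x" for x
    have [measurable]: "g \<in> borel_measurable M"
      unfolding g_def using En sc vn by (intro borel_measurable_times borel_measurable_indicator pn_measurable) simp_all
    have "l0_size M g \<le> l0_size M (pn (P k \<ominus> s))" if "n < k" for k
    proof (rule l0_size_mono[OF sf])
      show "AE x in M. \<bar>g x\<bar> \<le> \<bar>pn (P k \<ominus> s) x\<bar>"
        using P(2)[of k] pn_minus_triangle[OF sc P(1) vn, of n k] pn_minus_commute[OF sc P(1), of k]
          pnorm_nonneg[OF minus_closed[OF sc vn[of n]]]
      proof eventually_elim
        case (elim x)
        show ?case
        proof (cases "x \<in> E n")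
          case True
          then have "pn (P k \<ominus> v n) x = 0" using elim(1) that by (auto dest: spec[of _ n])
          then show ?thesis using elim True by (simp add: g_def)
        qed (simp add: g_def)
      qed
    qed (use sc P(1) in simp_all)
    then have "l0_size M g \<le> 0"
      by (intro LIMSEQ_le_const[OF lim] exI[of _ "Suc n"]) auto
    then have "AE x in M. g x = 0"
      using l0_size_nonneg[OF sf, of g] by (simp add: l0_size_eq_0_iff[OF sf, symmetric])
    then show ?thesis by eventually_elim (auto simp: g_def)
  qed
  then have 1: "AE x in M. \<forall>n. x \<in> E n \<longrightarrow> pn (s \<ominus> v n) x = 0"
    by (simp add: AE_all_countable)
  have 2: "AE x in M. \<forall>n. \<forall>w\<in>W. pn (s \<ominus> w) x \<le> pn (s \<ominus> v n) x + pn (v n \<ominus> w) x"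
    using W sc vn by (auto simp: AE_all_countable AE_ball_countable intro!: pn_minus_triangle)
  have 3: "AE x in M. \<forall>n. \<forall>e>0. \<exists>w\<in>W. pn (v n \<ominus> w) x < e"
    using V v by (auto simp: AE_all_countable approx_def image_subset_iff)
  show ?thesis
    unfolding approx_def using 1 2 3 AE_space
  proof eventually_elim
    case (elim x)
    then obtain n where n: "x \<in> E n"
      using E unfolding countable_partition_def by blast
    show ?case
    proof (intro allI impI)
      fix e :: real assume "0 < e"
      then obtain w where w: "w \<in> W" "pn (v n \<ominus> w) x < e" using elim(3) by blast
      have "pn (s \<ominus> w) x \<le> pn (s \<ominus> v n) x + pn (v n \<ominus> w) x" using elim(2) w(1) by blast
      moreover have "pn (s \<ominus> v n) x = 0" using elim(1) n by blast
      ultimately have "pn (s \<ominus> w) x < e" using w(2) by simp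
      with w(1) show "\<exists>w\<in>W. pn (s \<ominus> w) x < e" by blast
    qed
  qed
qed

text \<open>The function \<open>g u\<close> measures at each x how far u is from W. It is dominated
  by the norm of the difference between u and any s in G, so its size is below every positive number
  and it vanishes almost everywhere.\<close>

lemma approx_closure:
  assumes W: "countable W" "W \<subseteq> carrier N" "W \<noteq> {}"
    and G: "G \<subseteq> carrier N" "\<And>s. s \<in> G \<Longrightarrow> approx W s"
    and u: "u \<in> nm_topology M N closure_of G"
  shows "approx W u"
proof -
  interpret S: Metric_space "carrier N" "nm_dist M N" by (rule Metric_space_nm[OF sf])
  define g where "g u x = (INF w\<in>W. pn (u \<ominus> w) x)" for u x
  have uc: "u \<in> carrier N" using u by (auto simp: S.metric_closure_of)
  have gm [measurable]: "g u \<in> borel_measurable M" if "u \<in> carrier N" for u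
    unfolding g_def[abs_def] using W that by (intro borel_measurable_cINF_real) auto
  have nonneg: "AE x in M. \<forall>w\<in>W. 0 \<le> pn (u \<ominus> w) x" if "u \<in> carrier N" for u
    using W that by (auto simp: AE_ball_countable intro!: pnorm_nonneg)
  have "l0_size M (g u) \<le> r" if "r > 0" for r
  proof -
    obtain s where s: "s \<in> G" and d: "nm_dist M N u s < r"
      using u \<open>r > 0\<close> by (auto simp: S.metric_closure_of)
    have sc: "s \<in> carrier N" using s G by auto
    have "l0_size M (g u) \<le> l0_size M (pn (u \<ominus> s))"
    proof (rule l0_size_mono[OF sf])
      have tri: "AE x in M. \<forall>w\<in>W. pn (u \<ominus> w) x \<le> pn (u \<ominus> s) x + pn (s \<ominus> w) x"
        using W uc sc by (auto simp: AE_ball_countable intro!: pn_minus_triangle)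
      have "AE x in M. \<forall>e>0. \<exists>w\<in>W. pn (s \<ominus> w) x < e"
        using G(2)[OF s] by (simp add: approx_def)
      then show "AE x in M. \<bar>g u x\<bar> \<le> \<bar>pn (u \<ominus> s) x\<bar>"
        using tri nonneg[OF uc] 
      proof eventually_elim
        case (elim x)
        have bdd: "bdd_below ((\<lambda>w. pn (u \<ominus> w) x) ` W)"
          using elim(3) by (auto simp: bdd_below_def)
        have "g u x \<le> pn (u \<ominus> s) x + e" if e: "e > 0" for e
        proof -
          obtain w where w: "w \<in> W" "pn (s \<ominus> w) x < e" using elim(1) e by blast
          have "g u x \<le> pn (u \<ominus> w) x" unfolding g_def using bdd w by (intro cINF_lower) auto
          then show ?thesis using elim(2) w by force
        qed
        then have "g u x \<le> pn (u \<ominus> s) x" by (rule field_le_epsilon)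
        moreover have "0 \<le> g u x"
          unfolding g_def using elim(3) W by (intro cINF_greatest) auto
        ultimately show ?case by simp
      qed
    qed (use uc sc in simp_all)
    then show ?thesis using d uc sc by (simp add: nm_dist_eq[OF sf])
  qed
  then have "l0_size M (g u) \<le> 0" by (metis field_le_epsilon add_0)
  then have "AE x in M. g u x = 0"
    using l0_size_nonneg[OF sf, of "g u"] uc by (simp add: l0_size_eq_0_iff[OF sf, symmetric])
  then show ?thesis
    unfolding approx_def using nonneg[OF uc]
  proof eventually_elim
    case (elim x)
    have "bdd_below ((\<lambda>w. pn (u \<ominus> w) x) ` W)"
      using elim(2) by (auto simp: bdd_below_def)
    then show ?case using elim(1) W(3) by (simp add: g_def cINF_less_iff flip: elim(1))
  qed
qed

text \<open>Lists make the set of combinations visibly countable, and since entries may repeat, sums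
  of combinations are just concatenations.\<close>

definition rat_comb :: "(rat \<times> 'v) list \<Rightarrow> 'v" where
  "rat_comb xs = foldr (\<lambda>(r, s) v. rscale N (of_rat r) s \<oplus> v) xs \<zero>"

lemma rat_comb_simps [simp]:
  "rat_comb [] = \<zero>" "rat_comb ((r, s) # xs) = rscale N (of_rat r) s \<oplus> rat_comb xs"
  by (simp_all add: rat_comb_def)

lemma rat_comb_closed: "xs \<in> lists (UNIV \<times> carrier N) \<Longrightarrow> rat_comb xs \<in> carrier N"
  by (induction xs) (auto simp: rscale_closed)

lemma rat_comb_append:
  "\<lbrakk>xs \<in> lists (UNIV \<times> carrier N); ys \<in> lists (UNIV \<times> carrier N)\<rbrakk> \<Longrightarrow>
    rat_comb (xs @ ys) = rat_comb xs \<oplus> rat_comb ys"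
proof (induction xs)
  case (Cons a xs)
  then show ?case
    using rat_comb_closed[of xs] rat_comb_closed[of ys]
    by (cases a) (simp add: rscale_closed a_assoc)
qed (simp add: rat_comb_closed)

lemma rat_comb_uminus:
  "xs \<in> lists (UNIV \<times> carrier N) \<Longrightarrow>
    rat_comb (map (\<lambda>(r, s). (- r, s)) xs) = \<ominus> rat_comb xs"
proof (induction xs)
  case (Cons a xs)
  obtain r s where a: "a = (r, s)" by force
  have "rscale N (- of_rat r) s = \<ominus> rscale N (of_rat r) s"
    using Cons a rscale_rscale[of s "-1" "of_rat r"] by (simp add: rscale_minus_one rscale_closed)
  then show ?case
    using Cons a by (simp add: of_rat_minus rscale_closed rat_comb_closed minus_add a_comm)
qed simp

lemma approx_add:
  assumes W: "countable W" "W \<subseteq> carrier N" "\<And>v w. \<lbrakk>v \<in> W; w \<in> W\<rbrakk> \<Longrightarrow> v \<oplus> w \<in> W"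
    and u: "u \<in> carrier N" "approx W u" and v: "v \<in> carrier N" "approx W v"
  shows "approx W (u \<oplus> v)"
proof -
  have "AE x in M. \<forall>w\<in>W. \<forall>z\<in>W. pn ((u \<oplus> v) \<ominus> (w \<oplus> z)) x \<le> pn (u \<ominus> w) x + pn (v \<ominus> z) x"
    using W u v by (auto simp: AE_ball_countable add_minus_add subsetD intro!: pnorm_triangle)
  moreover note u(2)[unfolded approx_def] v(2)[unfolded approx_def]
  ultimately show ?thesis
    unfolding approx_def
  proof eventually_elim
    case (elim x)
    show ?case
    proof (intro allI impI)
      fix e :: real assume "0 < e"
      then obtain w z where "w \<in> W" "z \<in> W" "pn (u \<ominus> w) x < e/2" "pn (v \<ominus> z) x < e/2"
        using elim(2,3) half_gt_zero by blast
      then show "\<exists>w\<in>W. pn (u \<oplus> v \<ominus> w) x < e"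
        using elim(1) W(3) by (intro bexI[of _ "w \<oplus> z"]) (fastforce, blast)
    qed
  qed
qed

text \<open>W consists of the rational combinations of the generators. The property
  \<open>approx W\<close> passes from real multiples of generators to their finite sums, then to
  glued vectors, and finally to the closure, which is the whole module.\<close>

lemma countable_dense_subgroup:
  assumes "countably_generated M N"
  obtains W where "countable W" "W \<subseteq> carrier N" "\<zero> \<in> W"
    "\<And>v w. \<lbrakk>v \<in> W; w \<in> W\<rbrakk> \<Longrightarrow> v \<oplus> w \<in> W" "\<And>v. v \<in> W \<Longrightarrow> \<ominus> v \<in> W"
    "\<And>u. u \<in> carrier N \<Longrightarrow> approx W u"
proof -
  obtain S where S: "countable S" "S \<subseteq> carrier N" and gen: "generates M N (linear_span N S)"
    using assms by (auto simp: countably_generated_def)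
  let ?L = "lists (UNIV \<times> S) :: (rat \<times> 'v) list set"
  have L: "xs \<in> lists (UNIV \<times> carrier N)" if "xs \<in> ?L" for xs
    using that lists_mono[of "UNIV \<times> S" "UNIV \<times> carrier N"] S by auto
  define W where "W = rat_comb ` ?L"
  have W1: "countable W"
    unfolding W_def using S by (intro countable_image countable_lists countable_SIGMA) auto
  have W2: "W \<subseteq> carrier N"
    unfolding W_def using L rat_comb_closed by blast
  have W3: "\<zero> \<in> W"
    unfolding W_def by (rule image_eqI[of _ _ "[]"]) auto
  note W = W1 W2 W3
  have add: "v \<oplus> w \<in> W" if vw: "v \<in> W" "w \<in> W" for v w
  proof -
    obtain xs ys where xy: "xs \<in> ?L" "ys \<in> ?L" and vw: "v = rat_comb xs" "w = rat_comb ys"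
      using vw unfolding W_def by blast
    have "xs @ ys \<in> ?L" using xy by simp
    moreover have "v \<oplus> w = rat_comb (xs @ ys)"
      using xy[THEN L] by (simp add: vw rat_comb_append)
    ultimately show ?thesis unfolding W_def by blast
  qed
  have um: "\<ominus> v \<in> W" if v: "v \<in> W" for v
  proof -
    obtain xs where xs: "xs \<in> ?L" "v = rat_comb xs" using v unfolding W_def by blast
    then have "\<ominus> v = rat_comb (map (\<lambda>(r, s). (- r, s)) xs)"
      using rat_comb_uminus[OF L] by simp
    moreover have "map (\<lambda>(r, s). (- r, s)) xs \<in> ?L"
      using xs(1) by (induction xs) auto
    ultimately show ?thesis unfolding W_def by blast
  qed
  have scal: "approx W (rscale N c s)" if s: "s \<in> S" for c s
  proof -
    have sc: "s \<in> carrier N" using s S by auto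
    have "AE x in M. \<forall>r. pn (rscale N c s \<ominus> rscale N (of_rat r) s) x = \<bar>c - of_rat r\<bar> * pn s x"
      unfolding AE_all_countable using sc by (auto simp flip: rscale_diff intro!: pn_rscale)
    then show ?thesis
      unfolding approx_def using pnorm_nonneg[OF sc]
    proof eventually_elim
      case (elim x)
      show ?case
      proof (intro allI impI)
        fix e :: real assume "0 < e"
        \<comment> \<open>Replacing c by a rational q costs the distance of c and q times
          \<open>pn s x\<close>; adding 1 keeps the denominator positive where the norm
          vanishes.\<close>
        then have "c < c + e / (pn s x + 1)" using elim by simp
        then obtain q where q: "c < of_rat q" "of_rat q < c + e / (pn s x + 1)"
          using of_rat_dense by blast
        have "rat_comb [(q, s)] = rscale N (of_rat q) s" using sc by (simp add: rscale_closed)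
        then have "rscale N (of_rat q) s \<in> W" unfolding W_def using s by (metis (no_types) UNIV_I SigmaI imageI lists.simps)
        moreover have "\<bar>c - of_rat q\<bar> * pn s x < e"
        proof -
          have "\<bar>c - of_rat q\<bar> * pn s x \<le> \<bar>c - of_rat q\<bar> * (pn s x + 1)"
            by (intro mult_left_mono) auto
          also have "\<dots> < e"
            using q elim by (simp add: less_divide_eq flip: less_diff_eq) (auto simp: field_simps)
          finally show ?thesis .
        qed
        ultimately show "\<exists>w\<in>W. pn (rscale N c s \<ominus> w) x < e"
          using elim(1) by (intro bexI[of _ "rscale N (of_rat q) s"]) simp_all
      qed
    qed
  qed
  have zero: "approx W \<zero>"
    unfolding approx_def using pn_zero
  proof eventually_elim
    case (elim x)
    then show ?case using W(3) by (intro allI impI bexI[of _ "\<zero>"]) (auto simp: minus_eq)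
  qed
  have span: "linear_span N S \<subseteq> carrier N"
    using gen by (simp add: generates_def vector_subspace_def)
  have "approx W v" if vS: "v \<in> linear_span N S" for v
  proof -
    obtain c F where F: "finite F" "F \<subseteq> S" and v: "v = finsum N (\<lambda>u. rscale N (c u) u) F"
      using vS by (auto simp: linear_span_def)
    have "approx W (finsum N (\<lambda>u. rscale N (c u) u) F)"
      using F
    proof (induction F)
      case (insert a F)
      have c: "rscale N (c u) u \<in> carrier N" if "u \<in> insert a F" for u
        using that insert S by (auto intro: rscale_closed)
      have "finsum N (\<lambda>u. rscale N (c u) u) (insert a F) = rscale N (c a) a \<oplus> finsum N (\<lambda>u. rscale N (c u) u) F"
        using insert c by (intro finsum_insert) auto
      then show ?case
        using insert c scal by (auto intro!: approx_add W add finsum_closed)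
    qed (simp add: zero)
    then show ?thesis using v by simp
  qed
  then have gl: "approx W s" if "s \<in> glued M N (linear_span N S)" for s
    using approx_glued[OF W(1,2) span _ that] by blast
  have "approx W u" if "u \<in> carrier N" for u
  proof (rule approx_closure[OF W(1,2) _ _ gl])
    show "u \<in> nm_topology M N closure_of glued M N (linear_span N S)"
      using that gen by (simp add: generates_def)
  qed (use W(3) in \<open>auto simp: glued_def\<close>)
  with W add um show ?thesis by (rule that)
qed

end

section \<open>A Hahn--Banach construction without choices\<close>

text \<open>
  Replacing \<open>p\<close> by \<open>v \<mapsto> lim\<^sub>n p (v + 2\<^sup>n w) - 2\<^sup>n p w\<close> makes a sublinear functional odd at \<open>w\<close>.
  Doing this successively for every element of a countable group makes it additive. All steps are
  given by limits, so that measurability in a parameter is preserved.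
\<close>

locale countable_subgroup = abelian_group G for G (structure) +
  fixes W e
  assumes W_sub: "W \<subseteq> carrier G"
    and W_zero: "\<zero> \<in> W"
    and W_add: "\<lbrakk>v \<in> W; w \<in> W\<rbrakk> \<Longrightarrow> v \<oplus> w \<in> W"
    and W_uminus: "v \<in> W \<Longrightarrow> \<ominus> v \<in> W"
    and W_enum: "W = range (e :: nat \<Rightarrow> _)"
begin

lemma W_carrier: "v \<in> W \<Longrightarrow> v \<in> carrier G"
  using W_sub by auto

text \<open>Homogeneity appears for the factor 2 alone: a group has no scalars, and the limit in
  \<open>hb_step\<close> runs through the multiples by \<open>2 ^ n\<close>.\<close>

definition sublin :: "('a \<Rightarrow> real) \<Rightarrow> bool" where
  "sublin p \<longleftrightarrow> (\<forall>v\<in>W. \<forall>w\<in>W. p (v \<oplus> w) \<le> p v + p w) \<and> (\<forall>v\<in>W. p (v \<oplus> v) = 2 * p v)"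

definition dbl :: "nat \<Rightarrow> 'a \<Rightarrow> 'a" where
  "dbl n w = ((\<lambda>v. v \<oplus> v) ^^ n) w"

lemma dbl_simps [simp]: "dbl 0 w = w" "dbl (Suc n) w = dbl n w \<oplus> dbl n w"
  by (simp_all add: dbl_def)

lemma dbl_closed [simp]: "w \<in> W \<Longrightarrow> dbl n w \<in> W"
  by (induction n) (auto intro: W_add)

definition hb_step :: "('a \<Rightarrow> real) \<Rightarrow> 'a \<Rightarrow> 'a \<Rightarrow> real" where
  "hb_step p w v = lim (\<lambda>n. p (v \<oplus> dbl n w) - 2 ^ n * p w)"

lemma sublin_dbl: "\<lbrakk>sublin p; w \<in> W\<rbrakk> \<Longrightarrow> p (dbl n w) = 2 ^ n * p w"
  by (induction n) (simp_all add: sublin_def)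

lemma sublin_zero: "sublin p \<Longrightarrow> p \<zero> = 0"
  using W_zero by (force simp: sublin_def)

lemma sublin_minus_le:
  assumes "sublin p" "v \<in> W"
  shows "- p (\<ominus> v) \<le> p v"
proof -
  have "p (v \<oplus> \<ominus> v) \<le> p v + p (\<ominus> v)"
    using assms W_uminus by (auto simp: sublin_def)
  then show ?thesis using assms W_carrier by (simp add: r_neg sublin_zero)
qed

text \<open>The sequence decreases because v + 2^(n+1) w is the sum of v + 2^n w and 2^n w. It is
  bounded below by -p(-v) because 2^n w is the sum of v + 2^n w and -v. So the limit is also the
  infimum.\<close>

lemma hb_step_lim:
  assumes p: "sublin p" and v: "v \<in> W" and w: "w \<in> W"
  shows "(\<lambda>n. p (v \<oplus> dbl n w) - 2 ^ n * p w) \<longlonglongrightarrow> hb_step p w v"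
    and "hb_step p w v \<le> p (v \<oplus> dbl n w) - 2 ^ n * p w"
proof -
  define X where "X n = p (v \<oplus> dbl n w) - 2 ^ n * p w" for n
  have "decseq X"
  proof (rule decseq_SucI)
    fix n
    have "v \<oplus> dbl (Suc n) w = (v \<oplus> dbl n w) \<oplus> dbl n w"
      using v w by (simp add: W_carrier a_assoc)
    then have "p (v \<oplus> dbl (Suc n) w) \<le> p (v \<oplus> dbl n w) + 2 ^ n * p w"
      using p v w W_add by (simp add: sublin_def flip: sublin_dbl[OF p w])
    then show "X (Suc n) \<le> X n" by (simp add: X_def algebra_simps)
  qed
  moreover have "- p (\<ominus> v) \<le> X n" for n
  proof -
    have "dbl n w = (v \<oplus> dbl n w) \<oplus> \<ominus> v"
      using v w W_carrier[of v] W_carrier[of "dbl n w"] by (simp add: a_ac r_neg2)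
    then have "p (dbl n w) \<le> p (v \<oplus> dbl n w) + p (\<ominus> v)"
      using p v w W_add W_uminus by (metis dbl_closed sublin_def)
    then show ?thesis using p w by (simp add: X_def sublin_dbl)
  qed
  ultimately obtain L where "X \<longlonglongrightarrow> L" "\<forall>n. L \<le> X n"
    using decseq_convergent by blast
  then have "X \<longlonglongrightarrow> hb_step p w v \<and> hb_step p w v \<le> X n"
    by (simp add: hb_step_def limI flip: X_def)
  then show "(\<lambda>n. p (v \<oplus> dbl n w) - 2 ^ n * p w) \<longlonglongrightarrow> hb_step p w v"
    and "hb_step p w v \<le> p (v \<oplus> dbl n w) - 2 ^ n * p w"
    by (simp_all add: X_def[abs_def])
qed

lemma hb_step_le: "\<lbrakk>sublin p; v \<in> W; w \<in> W\<rbrakk> \<Longrightarrow> hb_step p w v \<le> p v"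
  using hb_step_lim(2)[of p v w 0] by (force simp: sublin_def)

text \<open>The term for n = 0 is p(-w + w) - p(w) = -p(w). Since the step only lowers the
  functional, its new value at -w is at most minus its new value at w, which is the nontrivial half
  of being odd at w.\<close>

lemma hb_step_uminus: "\<lbrakk>sublin p; w \<in> W\<rbrakk> \<Longrightarrow> hb_step p w (\<ominus> w) \<le> - p w"
  using hb_step_lim(2)[of p "\<ominus> w" w 0] W_uminus by (simp add: W_carrier l_neg sublin_zero)

text \<open>Doubling uses up one index: u + v + 2^(n+1) w splits into u + 2^n w and v + 2^n w, so
  the term n + 1 for the sum is compared with the terms n for the summands. The shift does not
  change the limits.\<close>

lemma sublin_hb_step:
  assumes p: "sublin p" and w: "w \<in> W"
  shows "sublin (hb_step p w)"
  unfolding sublin_def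
proof (intro conjI ballI)
  fix v assume v: "v \<in> W"
  have "(v \<oplus> v) \<oplus> dbl (Suc n) w = (v \<oplus> dbl n w) \<oplus> (v \<oplus> dbl n w)" for n
    using v w W_carrier[of v] W_carrier[of "dbl n w"] by (simp add: a_ac)
  then have "p ((v \<oplus> v) \<oplus> dbl (Suc n) w) - 2 ^ Suc n * p w = 2 * (p (v \<oplus> dbl n w) - 2 ^ n * p w)" for n
    using p v w W_add[of v "dbl n w"] by (simp add: sublin_def)
  then have "(\<lambda>n. 2 * (p (v \<oplus> dbl n w) - 2 ^ n * p w)) \<longlonglongrightarrow> hb_step p w (v \<oplus> v)"
    using LIMSEQ_Suc[OF hb_step_lim(1)[OF p W_add[OF v v] w]] by presburger
  moreover have "(\<lambda>n. 2 * (p (v \<oplus> dbl n w) - 2 ^ n * p w)) \<longlonglongrightarrow> 2 * hb_step p w v"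
    by (intro tendsto_mult_left hb_step_lim p v w)
  ultimately show "hb_step p w (v \<oplus> v) = 2 * hb_step p w v"
    by (rule LIMSEQ_unique)
next
  fix u v assume u: "u \<in> W" and v: "v \<in> W"
  have le: "p ((u \<oplus> v) \<oplus> dbl (Suc n) w) - 2 ^ Suc n * p w
      \<le> (p (u \<oplus> dbl n w) - 2 ^ n * p w) + (p (v \<oplus> dbl n w) - 2 ^ n * p w)" for n
  proof -
    have "(u \<oplus> v) \<oplus> dbl (Suc n) w = (u \<oplus> dbl n w) \<oplus> (v \<oplus> dbl n w)"
      using u v w W_carrier[of u] W_carrier[of v] W_carrier[of "dbl n w"] by (simp add: a_ac)
    then show ?thesis
      using p W_add[OF u, of "dbl n w"] W_add[OF v, of "dbl n w"] w by (simp add: sublin_def)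
  qed
  show "hb_step p w (u \<oplus> v) \<le> hb_step p w u + hb_step p w v"
    by (rule LIMSEQ_le[OF LIMSEQ_Suc[OF hb_step_lim(1)[OF p W_add[OF u v] w]]
          tendsto_add[OF hb_step_lim(1)[OF p u w] hb_step_lim(1)[OF p v w]]])
       (use le in auto)
qed

text \<open>The point \<open>w0\<close> is treated first, with p itself: this bounds the value at
  its negative by -p(w0). Later steps only lower the functional, so the bound survives and oddness
  turns it into the value p(w0) at \<open>w0\<close>.\<close>

primrec hb_iter :: "'a \<Rightarrow> ('a \<Rightarrow> real) \<Rightarrow> nat \<Rightarrow> 'a \<Rightarrow> real" where
  "hb_iter w0 p 0 = hb_step p w0"
| "hb_iter w0 p (Suc k) = hb_step (hb_iter w0 p k) (e k)"

definition hb :: "'a \<Rightarrow> ('a \<Rightarrow> real) \<Rightarrow> 'a \<Rightarrow> real" where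
  "hb w0 p v = lim (\<lambda>k. hb_iter w0 p k v)"

lemma e_in_W: "e k \<in> W"
  by (simp add: W_enum)

context
  fixes p w0
  assumes p: "sublin p" and w0: "w0 \<in> W"
begin

lemma sublin_hb_iter: "sublin (hb_iter w0 p k)"
  by (induction k) (auto intro: sublin_hb_step p w0 e_in_W)

text \<open>The iterates decrease. The k-th one at v is at least minus its value at -v, which in
  turn is at least minus the value of the first iterate at -v; this is a lower bound independent of
  k.\<close>

lemma hb_lim:
  assumes v: "v \<in> W"
  shows "(\<lambda>k. hb_iter w0 p k v) \<longlonglongrightarrow> hb w0 p v" and "hb w0 p v \<le> hb_iter w0 p k v"
proof -
  have dec: "decseq (\<lambda>k. hb_iter w0 p k v)" if "v \<in> W" for v
    using hb_step_le[OF sublin_hb_iter that e_in_W] by (intro decseq_SucI) simp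
  have "- hb_iter w0 p 0 (\<ominus> v) \<le> hb_iter w0 p k v" for k
    using decseqD[OF dec[OF W_uminus[OF v]], of 0 k] sublin_minus_le[OF sublin_hb_iter v, of k]
    by linarith
  then obtain L where "(\<lambda>k. hb_iter w0 p k v) \<longlonglongrightarrow> L" "\<forall>k. L \<le> hb_iter w0 p k v"
    using decseq_convergent[OF dec[OF v]] by blast
  then show "(\<lambda>k. hb_iter w0 p k v) \<longlonglongrightarrow> hb w0 p v" and "hb w0 p v \<le> hb_iter w0 p k v"
    by (simp_all add: hb_def limI)
qed

lemma hb_le: "v \<in> W \<Longrightarrow> hb w0 p v \<le> p v"
  using hb_lim(2)[of v 0] hb_step_le[OF p, of v w0] w0 by simp

lemma hb_subadd:
  assumes u: "u \<in> W" and v: "v \<in> W"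
  shows "hb w0 p (u \<oplus> v) \<le> hb w0 p u + hb w0 p v"
proof (rule LIMSEQ_le[OF hb_lim(1)[OF W_add[OF u v]] tendsto_add[OF hb_lim(1)[OF u] hb_lim(1)[OF v]]])
  show "\<exists>N. \<forall>n\<ge>N. hb_iter w0 p n (u \<oplus> v) \<le> hb_iter w0 p n u + hb_iter w0 p n v"
    using sublin_hb_iter u v by (auto simp: sublin_def)
qed

lemma hb_zero: "hb w0 p \<zero> = 0"
  using hb_lim(1)[OF W_zero] sublin_zero[OF sublin_hb_iter] by (simp add: LIMSEQ_const_iff)

text \<open>Every v is some \<open>e k\<close>. The step at \<open>e k\<close> bounds the next
  iterate at -v by minus the k-th iterate at v, and passing to the limit \<open>hb\<close> only
  decreases the left side and increases the right side.\<close>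

lemma hb_uminus:
  assumes v: "v \<in> W"
  shows "hb w0 p (\<ominus> v) = - hb w0 p v"
proof -
  obtain k where k: "v = e k" using v W_enum by auto
  have "hb w0 p (\<ominus> v) \<le> hb_iter w0 p (Suc k) (\<ominus> v)"
    by (intro hb_lim W_uminus v)
  also have "\<dots> \<le> - hb_iter w0 p k v"
    using hb_step_uminus[OF sublin_hb_iter v] k by simp
  also have "\<dots> \<le> - hb w0 p v"
    using hb_lim(2)[OF v] by simp
  finally have "hb w0 p (\<ominus> v) \<le> - hb w0 p v" .
  moreover have "0 \<le> hb w0 p v + hb w0 p (\<ominus> v)"
    using hb_subadd[OF v W_uminus[OF v]] v by (simp add: W_carrier r_neg hb_zero)
  ultimately show ?thesis by simp
qed

lemma hb_add:
  assumes u: "u \<in> W" and v: "v \<in> W"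
  shows "hb w0 p (u \<oplus> v) = hb w0 p u + hb w0 p v"
proof -
  have "u = (u \<oplus> v) \<oplus> \<ominus> v"
    using u v W_carrier[of u] W_carrier[of v] by (simp add: a_assoc r_neg)
  then have "hb w0 p u \<le> hb w0 p (u \<oplus> v) + hb w0 p (\<ominus> v)"
    using hb_subadd[OF W_add[OF u v] W_uminus[OF v]] by simp
  then show ?thesis using hb_subadd[OF u v] hb_uminus[OF v] by simp
qed

lemma hb_attained: "hb w0 p w0 = p w0"
proof (rule antisym)
  have "hb w0 p (\<ominus> w0) \<le> - p w0"
    using hb_lim(2)[OF W_uminus[OF w0], of 0] hb_step_uminus[OF p w0] by simp
  then show "p w0 \<le> hb w0 p w0" using hb_uminus[OF w0] by simp
qed (rule hb_le[OF w0])

text \<open>The Lipschitz estimate that allows the functional to be extended from the group to all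
  vectors.\<close>

lemma hb_diff_le:
  assumes u: "u \<in> W" and v: "v \<in> W"
  shows "hb w0 p u - hb w0 p v \<le> p (u \<ominus> v)"
proof -
  have uv: "u \<ominus> v \<in> W" using W_add[OF u W_uminus[OF v]] by (simp add: minus_eq)
  have "u = (u \<ominus> v) \<oplus> v"
    using u v W_carrier[of u] W_carrier[of v] by (simp add: minus_eq a_assoc l_neg)
  then have "hb w0 p u = hb w0 p (u \<ominus> v) + hb w0 p v"
    using hb_add[OF uv v] by simp
  then show ?thesis using hb_le[OF uv] by simp
qed

end

text \<open>In the application \<open>p x\<close> is sublinear for almost every x only. The function
  given by \<open>lim\<close> is measurable even if the limit fails to exist at some points, so the
  exceptional x cause no trouble.\<close>

lemma hb_measurable:
  assumes p: "\<And>v. v \<in> W \<Longrightarrow> (\<lambda>x. p x v) \<in> borel_measurable M" and w0: "w0 \<in> W" and v: "v \<in> W"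
  shows "(\<lambda>x. hb w0 (p x) v) \<in> borel_measurable M"
proof -
  have step: "(\<lambda>x. hb_step (p x) w v) \<in> borel_measurable M"
    if "\<And>v. v \<in> W \<Longrightarrow> (\<lambda>x. p x v) \<in> borel_measurable M" "w \<in> W" "v \<in> W" for p w v
    unfolding hb_step_def using that(1)[OF W_add[OF that(3) dbl_closed[OF that(2)]]] that(1)[OF that(2)]
    by (intro borel_measurable_lim_metric borel_measurable_diff borel_measurable_times
        borel_measurable_const)
  have "\<And>v. v \<in> W \<Longrightarrow> (\<lambda>x. hb_iter w0 (p x) k v) \<in> borel_measurable M" for k
    by (induction k) (auto intro!: step p w0 e_in_W)
  then show ?thesis
    unfolding hb_def using v by (intro borel_measurable_lim_metric)
qed

end

section \<open>Norming functionals\<close>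

text \<open>The functionals constructed below are known to be additive; this recovers their rational
  homogeneity at a fixed point.\<close>

lemma additive_rat_real:
  fixes h :: "rat \<Rightarrow> real"
  assumes add: "\<And>r s. h (r + s) = h r + h s"
  shows "h q = of_rat q * h 1"
proof -
  have zero: "h 0 = 0" using add[of 0 0] by simp
  have uminus: "h (- r) = - h r" for r using add[of r "- r"] zero by simp
  have nat: "h (of_nat n * r) = of_nat n * h r" for n r
    by (induction n) (simp_all add: zero add distrib_right)
  have int: "h (of_int z * r) = of_int z * h r" for z r
    by (cases z) (use nat uminus[of "of_nat n * r" for n] in \<open>simp_all del: of_nat_Suc\<close>)
  obtain a b where q: "q = Fract a b" and b: "b > 0" by (cases q) auto
  have "of_int b * q = of_int a * 1"
    using q b by (simp add: Fract_of_int_quotient)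
  then have "of_int b * h q = of_int a * h 1"
    using int by metis
  moreover have "(of_rat q :: real) = of_int a / of_int b"
    using q b by (simp add: of_rat_rat)
  ultimately have "of_int b * h q = of_int b * (of_rat q * h 1)" using b by simp
  then show ?thesis using b by simp
qed

context l0_module
begin

lemma act_l0_class_const: "v \<in> carrier N \<Longrightarrow> act N (l0_class M (\<lambda>_. c)) v = rscale N c v"
  using act_rscale[of "l0_class M (\<lambda>_. 1)" v c] by (simp add: L0_ops act_l0_class_one)

text \<open>
  At almost every \<open>x\<close>, \<open>f\<close> is compared with all rational constants simultaneously; no
  approximation by simple functions is needed.
\<close>

lemma additive_bounded_imp_l0_linear:
  assumes add: "\<And>u v. \<lbrakk>u \<in> carrier N; v \<in> carrier N\<rbrakk> \<Longrightarrow> AE x in M. T (u \<oplus> v) x = T u x + T v x"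
    and bound: "\<And>u. u \<in> carrier N \<Longrightarrow> AE x in M. \<bar>T u x\<bar> \<le> pn u x"
    and f: "f \<in> carrier (L0 M)" and u: "u \<in> carrier N"
  shows "AE x in M. T (act N f u) x = class_rep f x * T u x"
proof -
  have diff: "AE x in M. \<bar>T v x - T w x\<bar> \<le> pn (v \<ominus> w) x" if "v \<in> carrier N" "w \<in> carrier N" for v w
  proof -
    have "v = (v \<ominus> w) \<oplus> w" using that by (simp add: minus_eq a_assoc l_neg)
    then have "AE x in M. T v x = T (v \<ominus> w) x + T w x"
      using add[of "v \<ominus> w" w] that by simp
    with bound[OF minus_closed[OF that]] show ?thesis by eventually_elim simp
  qed
  have au: "act N f u \<in> carrier N" using f u by (rule act_closed)
  have "AE x in M. \<forall>r s. T (rscale N (of_rat (r + s)) u) x = T (rscale N (of_rat r) u) x + T (rscale N (of_rat s) u) x"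
    unfolding AE_all_countable
    using u by (auto simp: of_rat_add rscale_add_left intro!: add rscale_closed)
  moreover have "AE x in M. \<forall>q. \<bar>T (act N f u) x - T (rscale N (of_rat q) u) x\<bar> \<le> \<bar>class_rep f x - of_rat q\<bar> * pn u x"
    unfolding AE_all_countable
  proof
    fix q :: rat
    let ?c = "l0_class M (\<lambda>_. of_rat q :: real)"
    have "AE x in M. class_rep ?c x = of_rat q" by (rule class_rep_l0_class) simp
    moreover have "AE x in M. pn (act N f u \<ominus> rscale N (of_rat q) u) x = \<bar>class_rep f x - class_rep ?c x\<bar> * pn u x"
      using act_diff[of f ?c u] f u by (simp add: act_l0_class_const)
    moreover note diff[OF au rscale_closed[OF u], of "of_rat q"]
    ultimately show "AE x in M. \<bar>T (act N f u) x - T (rscale N (of_rat q) u) x\<bar> \<le> \<bar>class_rep f x - of_rat q\<bar> * pn u x"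
      by eventually_elim simp
  qed
  moreover note bound[OF u]
  ultimately show ?thesis
  proof eventually_elim
    case (elim x)
    have lin: "T (rscale N (of_rat q) u) x = of_rat q * T u x" for q
      using additive_rat_real[of "\<lambda>q. T (rscale N (of_rat q) u) x" q] elim(1) u by (simp add: rscale_one)
    have "\<bar>T (act N f u) x - class_rep f x * T u x\<bar> \<le> 0 + d" if d: "d > 0" for d
    proof -
      \<comment> \<open>Replacing f by a rational q at x costs the distance of f and q times
        \<open>pn u x\<close> twice, once on each side of the identity; adding 1 keeps
        \<open>c\<close> positive.\<close>
      define c where "c = 2 * (pn u x + 1)"
      have c: "c > 0" using elim(3) by (simp add: c_def)
      have "class_rep f x < class_rep f x + d / c" using d c by simp
      then obtain q where q: "class_rep f x < of_rat q" "of_rat q < class_rep f x + d / c"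
        using of_rat_dense by blast
      have "\<bar>T (act N f u) x - class_rep f x * T u x\<bar>
          \<le> \<bar>T (act N f u) x - of_rat q * T u x\<bar> + \<bar>(of_rat q - class_rep f x) * T u x\<bar>"
        by (simp add: algebra_simps)
      also have "\<dots> \<le> \<bar>class_rep f x - of_rat q\<bar> * pn u x + \<bar>of_rat q - class_rep f x\<bar> * pn u x"
        using elim(2,3) lin[of q] by (intro add_mono) (auto simp: abs_mult intro!: mult_left_mono dest: spec[of _ q])
      also have "\<dots> = (of_rat q - class_rep f x) * (2 * pn u x)"
        using q by simp
      also have "\<dots> \<le> (of_rat q - class_rep f x) * c"
        using q by (intro mult_left_mono) (auto simp: c_def)
      also have "\<dots> \<le> d / c * c"
        using q c by (intro mult_right_mono) auto
      finally show ?thesis using c by simp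
    qed
    then have "\<bar>T (act N f u) x - class_rep f x * T u x\<bar> \<le> 0" by (rule field_le_epsilon)
    then show ?case by simp
  qed
qed

text \<open>The n-th functional attains the norm at the n-th element of the countable group
  (\<open>hb_attained\<close>). If a vector is close to that element at x, the functional takes
  nearly its full norm there. The index n thus depends on x and d, but one sequence serves all
  vectors.\<close>

theorem norming_functionals:
  assumes "countably_generated M N"
  obtains T :: "nat \<Rightarrow> 'v \<Rightarrow> 'x \<Rightarrow> real" where
    "\<And>n u. u \<in> carrier N \<Longrightarrow> T n u \<in> borel_measurable M"
    "\<And>n u v. \<lbrakk>u \<in> carrier N; v \<in> carrier N\<rbrakk> \<Longrightarrow> AE x in M. T n (u \<oplus> v) x = T n u x + T n v x"
    "\<And>n u. u \<in> carrier N \<Longrightarrow> AE x in M. \<bar>T n u x\<bar> \<le> pn u x"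
    "\<And>u. u \<in> carrier N \<Longrightarrow> AE x in M. \<forall>d>0. \<exists>n. pn u x - d < T n u x"
proof -
  obtain W where cW: "countable W" and W: "W \<subseteq> carrier N" "\<zero> \<in> W"
    "\<And>v w. \<lbrakk>v \<in> W; w \<in> W\<rbrakk> \<Longrightarrow> v \<oplus> w \<in> W" "\<And>v. v \<in> W \<Longrightarrow> \<ominus> v \<in> W"
    and approx: "\<And>u. u \<in> carrier N \<Longrightarrow> approx W u"
    using countable_dense_subgroup[OF assms] by blast
  define e where "e = from_nat_into W"
  have "W \<noteq> {}" using W(2) by auto
  then have e: "W = range e" using cW by (simp add: e_def range_from_nat_into)
  interpret C: countable_subgroup N W e
    by unfold_locales (use W e in auto)
  have Wc: "v \<in> carrier N" if "v \<in> W" for v using W that by auto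
  define p where "p x v = pn v x" for x v
  define \<phi> where "\<phi> w x v = C.hb w (p x) v" for w x v
  \<comment> \<open>The greatest extension of \<open>\<phi> (e n) x\<close> that is 1-Lipschitz for the seminorm at \<open>x\<close>; by density it is the only one.\<close>
  define T where "T n u x = (INF v\<in>W. pn (u \<ominus> v) x + \<phi> (e n) x v)" for n u x
  have "AE x in M. \<forall>v\<in>W. \<forall>w\<in>W. p x (v \<oplus> w) \<le> p x v + p x w"
    using cW by (auto simp: AE_ball_countable p_def intro!: pnorm_triangle Wc)
  moreover have "AE x in M. \<forall>v\<in>W. p x (v \<oplus> v) = 2 * p x v"
  proof -
    have "v \<oplus> v = rscale N 2 v" if "v \<in> W" for v
      using rscale_add_left[OF Wc[OF that], of 1 1] by (simp add: rscale_one Wc[OF that])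
    then show ?thesis
      using cW pn_rscale[OF Wc, of _ 2] by (auto simp: AE_ball_countable p_def)
  qed
  ultimately have good: "AE x in M. C.sublin (p x)"
    unfolding C.sublin_def by eventually_elim blast
  have \<phi>m: "(\<lambda>x. \<phi> w x v) \<in> borel_measurable M" if "w \<in> W" "v \<in> W" for w v
    unfolding \<phi>_def using that by (intro C.hb_measurable) (auto simp: p_def intro!: pn_measurable Wc)
  have Tm: "T n u \<in> borel_measurable M" if "u \<in> carrier N" for n u
    unfolding T_def using cW
    by (intro borel_measurable_cINF_real borel_measurable_add pn_measurable \<phi>m minus_closed[OF that Wc] C.e_in_W)
  \<comment> \<open>Additivity, the bound and the norming property all follow from this estimate,
    since v can be chosen close to u at x. The inequality \<open>lower\<close> also shows that the
    infimum is taken over a set that is bounded below.\<close>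
  have near: "AE x in M. \<forall>n. \<forall>v\<in>W. \<bar>T n u x - \<phi> (e n) x v\<bar> \<le> pn (u \<ominus> v) x" if u: "u \<in> carrier N" for u
  proof -
    have "AE x in M. \<forall>v\<in>W. \<forall>w\<in>W. pn (v \<ominus> w) x \<le> pn (v \<ominus> u) x + pn (u \<ominus> w) x"
      using cW by (auto simp: AE_ball_countable intro!: pn_minus_triangle Wc u)
    moreover have "AE x in M. \<forall>v\<in>W. pn (v \<ominus> u) x = pn (u \<ominus> v) x"
      using cW by (auto simp: AE_ball_countable intro!: pn_minus_commute Wc u)
    moreover note good
    ultimately show ?thesis
    proof eventually_elim
      case (elim x)
      have lower: "\<phi> (e n) x v - pn (u \<ominus> v) x \<le> pn (u \<ominus> w) x + \<phi> (e n) x w" if "v \<in> W" "w \<in> W" for n v w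
      proof -
        have "\<phi> (e n) x v - \<phi> (e n) x w \<le> pn (v \<ominus> w) x"
          using C.hb_diff_le[OF elim(3) C.e_in_W that] by (simp add: \<phi>_def p_def)
        also have "\<dots> \<le> pn (u \<ominus> v) x + pn (u \<ominus> w) x"
          using elim(1,2) that by force
        finally show ?thesis by simp
      qed
      show ?case
      proof (intro allI ballI)
        fix n v assume v: "v \<in> W"
        have "T n u x \<le> pn (u \<ominus> v) x + \<phi> (e n) x v"
          unfolding T_def using lower[OF v] v by (intro cINF_lower) (auto simp: bdd_below_def)
        moreover have "\<phi> (e n) x v - pn (u \<ominus> v) x \<le> T n u x"
          unfolding T_def using lower[OF v] v by (intro cINF_greatest) auto
        ultimately show "\<bar>T n u x - \<phi> (e n) x v\<bar> \<le> pn (u \<ominus> v) x" by simp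
      qed
    qed
  qed
  show ?thesis
  proof (rule that)
    show "T n u \<in> borel_measurable M" if "u \<in> carrier N" for n u by (rule Tm[OF that])
  next
    fix n u v assume u: "u \<in> carrier N" and v: "v \<in> carrier N"
    have "AE x in M. \<forall>w\<in>W. \<forall>z\<in>W. pn ((u \<oplus> v) \<ominus> (w \<oplus> z)) x \<le> pn (u \<ominus> w) x + pn (v \<ominus> z) x"
      using cW u v Wc by (auto simp: AE_ball_countable add_minus_add intro!: pnorm_triangle)
    with near[OF u] near[OF v] near[OF a_closed[OF u v]] good
      approx[OF u, unfolded approx_def] approx[OF v, unfolded approx_def]
    show "AE x in M. T n (u \<oplus> v) x = T n u x + T n v x"
    proof eventually_elim
      case (elim x)
      have "\<bar>T n (u \<oplus> v) x - (T n u x + T n v x)\<bar> \<le> 0 + d" if d: "d > 0" for d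
      proof -
        \<comment> \<open>The approximations of u and v enter once through their own values and once
          more through the value at the sum, four errors in all.\<close>
        obtain w z where w: "w \<in> W" "pn (u \<ominus> w) x < d/4" and z: "z \<in> W" "pn (v \<ominus> z) x < d/4"
          using elim(5,6) d by (meson divide_pos_pos zero_less_numeral)
        have "\<phi> (e n) x (w \<oplus> z) = \<phi> (e n) x w + \<phi> (e n) x z"
          unfolding \<phi>_def by (rule C.hb_add[OF elim(4) C.e_in_W w(1) z(1)])
        moreover have "\<bar>T n u x - \<phi> (e n) x w\<bar> \<le> pn (u \<ominus> w) x" using elim(1) w by blast
        moreover have "\<bar>T n v x - \<phi> (e n) x z\<bar> \<le> pn (v \<ominus> z) x" using elim(2) z by blast
        moreover have "\<bar>T n (u \<oplus> v) x - \<phi> (e n) x (w \<oplus> z)\<bar> \<le> pn ((u \<oplus> v) \<ominus> (w \<oplus> z)) x"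
          using elim(3) W(3)[OF w(1) z(1)] by blast
        moreover have "pn ((u \<oplus> v) \<ominus> (w \<oplus> z)) x \<le> pn (u \<ominus> w) x + pn (v \<ominus> z) x"
          using elim(7) w z by blast
        ultimately show ?thesis using w z by linarith
      qed
      then have "\<bar>T n (u \<oplus> v) x - (T n u x + T n v x)\<bar> \<le> 0" by (rule field_le_epsilon)
      then show ?case by simp
    qed
  next
    fix n u assume u: "u \<in> carrier N"
    have u0: "u \<ominus> \<zero> = u" using u by (simp add: minus_eq)
    from near[OF u] good show "AE x in M. \<bar>T n u x\<bar> \<le> pn u x"
    proof eventually_elim
      case (elim x)
      have "\<bar>T n u x - \<phi> (e n) x \<zero>\<bar> \<le> pn (u \<ominus> \<zero>) x" using elim(1) W(2) by blast
      then show ?case using C.hb_zero[OF elim(2) C.e_in_W] by (simp add: \<phi>_def u0)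
    qed
  next
    fix u assume u: "u \<in> carrier N"
    have "AE x in M. \<forall>w\<in>W. pn u x \<le> pn (u \<ominus> w) x + pn w x"
    proof -
      have "pn u = pn ((u \<ominus> w) \<oplus> w)" if "w \<in> W" for w
        using u Wc[OF that] by (simp add: minus_eq a_assoc l_neg)
      then show ?thesis
        using cW u pnorm_triangle[of "u \<ominus> w" w for w] by (auto simp: AE_ball_countable Wc)
    qed
    with near[OF u] good approx[OF u, unfolded approx_def]
    show "AE x in M. \<forall>d>0. \<exists>n. pn u x - d < T n u x"
    proof eventually_elim
      case (elim x)
      show ?case
      proof (intro allI impI)
        fix d :: real assume "d > 0"
        then obtain w where w: "w \<in> W" "pn (u \<ominus> w) x < d/2"
          using elim(3) half_gt_zero by blast
        then obtain n where n: "w = e n" using e by auto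
        have "\<phi> (e n) x w = pn w x"
          using C.hb_attained[OF elim(2) w(1)] n by (simp add: \<phi>_def p_def)
        moreover have "\<bar>T n u x - \<phi> (e n) x w\<bar> \<le> pn (u \<ominus> w) x" using elim(1) w by blast
        moreover have "pn u x \<le> pn (u \<ominus> w) x + pn w x" using elim(4) w by blast
        ultimately have "pn u x - d < T n u x" using w(2) by linarith
        then show "\<exists>n. pn u x - d < T n u x" ..
      qed
    qed
  qed
qed

end

section \<open>Bounded sequences of measurable functions\<close>

definition sup_norm :: "(nat \<Rightarrow> real) \<Rightarrow> real" where
  "sup_norm s = (SUP n. \<bar>s n\<bar>)"

definition bdd_seq :: "(nat \<Rightarrow> real) \<Rightarrow> bool" where
  "bdd_seq s \<longleftrightarrow> bdd_above (range (\<lambda>n. \<bar>s n\<bar>))"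

lemma sup_norm_upper: "bdd_seq s \<Longrightarrow> \<bar>s n\<bar> \<le> sup_norm s"
  unfolding sup_norm_def bdd_seq_def by (intro cSUP_upper) auto

lemma sup_norm_least: "(\<And>n. \<bar>s n\<bar> \<le> c) \<Longrightarrow> sup_norm s \<le> c"
  unfolding sup_norm_def by (intro cSUP_least) auto

lemma bdd_seqI: "(\<And>n. \<bar>s n\<bar> \<le> c) \<Longrightarrow> bdd_seq s"
  by (auto simp: bdd_seq_def bdd_above_def)

lemma sup_norm_nonneg: "bdd_seq s \<Longrightarrow> 0 \<le> sup_norm s"
  using sup_norm_upper[of s 0] by linarith

lemma sup_norm_zero [simp]: "sup_norm (\<lambda>_. 0) = 0"
  by (simp add: sup_norm_def)

lemma sup_norm_eq_0_iff: "bdd_seq s \<Longrightarrow> sup_norm s = 0 \<longleftrightarrow> s = (\<lambda>_. 0)"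
  using sup_norm_upper[of s] by fastforce

lemma bdd_seq_zero [simp]: "bdd_seq (\<lambda>_. 0)"
  by (rule bdd_seqI[of _ 0]) simp

lemma bdd_seq_add:
  assumes "bdd_seq s" "bdd_seq t"
  shows "bdd_seq (\<lambda>n. s n + t n)" and "sup_norm (\<lambda>n. s n + t n) \<le> sup_norm s + sup_norm t"
proof -
  have "\<bar>s n + t n\<bar> \<le> sup_norm s + sup_norm t" for n
    using sup_norm_upper[OF assms(1), of n] sup_norm_upper[OF assms(2), of n] by linarith
  then show "bdd_seq (\<lambda>n. s n + t n)" "sup_norm (\<lambda>n. s n + t n) \<le> sup_norm s + sup_norm t"
    by (auto intro: bdd_seqI sup_norm_least)
qed

lemma bdd_seq_cmult:
  assumes "bdd_seq s"
  shows "bdd_seq (\<lambda>n. c * s n)" and "sup_norm (\<lambda>n. c * s n) = \<bar>c\<bar> * sup_norm s"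
proof -
  have le: "\<bar>c * s n\<bar> \<le> \<bar>c\<bar> * sup_norm s" if "bdd_seq s" for c s n
    using sup_norm_upper[OF that, of n] by (simp add: abs_mult mult_left_mono)
  show bdd: "bdd_seq (\<lambda>n. c * s n)"
    using le[OF assms] by (rule bdd_seqI)
  show "sup_norm (\<lambda>n. c * s n) = \<bar>c\<bar> * sup_norm s"
  proof (cases "c = 0")
    case False
    have "sup_norm s \<le> \<bar>1 / c\<bar> * sup_norm (\<lambda>n. c * s n)"
      using le[OF bdd, of "1 / c"] False by (intro sup_norm_least) simp
    then have "\<bar>c\<bar> * sup_norm s \<le> sup_norm (\<lambda>n. c * s n)"
      using False by (simp add: field_simps)
    then show ?thesis
      using sup_norm_least[OF le[OF assms]] by (intro antisym)
  qed simp
qed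

text \<open>The steps are small uniformly in the coordinate, so the coordinatewise limit is a
  uniform one. It is given by the term \<open>lim\<close> because, when F depends on a point x, the
  limit has to be measurable in x.\<close>

lemma sup_norm_complete:
  fixes F :: "nat \<Rightarrow> nat \<Rightarrow> real"
  assumes bdd: "\<And>k. bdd_seq (F k)" and sm: "summable (\<lambda>k. sup_norm (\<lambda>n. F (Suc k) n - F k n))"
  shows "bdd_seq (\<lambda>n. lim (\<lambda>k. F k n))"
    and "(\<lambda>k. sup_norm (\<lambda>n. F k n - lim (\<lambda>k. F k n))) \<longlonglongrightarrow> 0"
proof -
  define d where "d k = sup_norm (\<lambda>n. F (Suc k) n - F k n)" for k
  have bdiff: "bdd_seq (\<lambda>n. s n - t n)" if "bdd_seq s" "bdd_seq t" for s t
    using bdd_seq_add(1)[OF that(1) bdd_seq_cmult(1)[OF that(2), of "-1"]] by simp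
  have d: "\<bar>F (Suc k) n - F k n\<bar> \<le> d k" for k n
    unfolding d_def using sup_norm_upper[OF bdiff[OF bdd[of "Suc k"] bdd[of k]], of n] .
  have smd: "summable d" using sm by (simp add: d_def[abs_def])
  have lim: "(\<lambda>k. F k n) \<longlonglongrightarrow> lim (\<lambda>k. F k n)" for n
  proof -
    have "summable (\<lambda>k. F (Suc k) n - F k n)"
      using d by (intro summable_comparison_test'[OF smd]) simp
    then have "convergent (\<lambda>m. \<Sum>k<m. F (Suc k) n - F k n)"
      by (simp add: summable_iff_convergent)
    then have "convergent (\<lambda>m. (F m n - F 0 n) + F 0 n)"
      by (intro convergent_add convergent_const) (simp add: sum_lessThan_telescope[of "\<lambda>k. F k n"])
    then show ?thesis by (simp add: convergent_LIMSEQ_iff)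
  qed
  \<comment> \<open>The tail of the series of step norms bounds the error in all coordinates at
    once.\<close>
  define t where "t k = suminf d - sum d {..<k}" for k
  have tail: "\<bar>F k n - lim (\<lambda>k. F k n)\<bar> \<le> t k" for k n
  proof -
    have fin: "\<bar>F k n - F (k + m) n\<bar> \<le> sum d {..<k + m} - sum d {..<k}" for m
    proof (induction m)
      case (Suc m)
      have "\<bar>F k n - F (k + Suc m) n\<bar> \<le> \<bar>F k n - F (k + m) n\<bar> + \<bar>F (Suc (k + m)) n - F (k + m) n\<bar>"
        by simp
      also have "\<dots> \<le> sum d {..<k + m} - sum d {..<k} + d (k + m)"
        using Suc d by (intro add_mono) auto
      finally show ?case by simp
    qed simp
    have "(\<lambda>m. \<bar>F k n - F (k + m) n\<bar>) \<longlonglongrightarrow> \<bar>F k n - lim (\<lambda>k. F k n)\<bar>"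
      using LIMSEQ_ignore_initial_segment[OF lim[of n], of k] by (intro tendsto_intros) (simp add: add.commute)
    moreover have "(\<lambda>m. sum d {..<k + m} - sum d {..<k}) \<longlonglongrightarrow> t k"
      unfolding t_def using LIMSEQ_ignore_initial_segment[OF summable_LIMSEQ[OF smd], of k]
      by (intro tendsto_intros) (simp add: add.commute)
    ultimately show ?thesis by (rule LIMSEQ_le) (use fin in auto)
  qed
  have "bdd_seq (\<lambda>n. F 0 n - lim (\<lambda>k. F k n))"
    using tail by (rule bdd_seqI)
  then have "bdd_seq (\<lambda>n. F 0 n - (F 0 n - lim (\<lambda>k. F k n)))"
    by (rule bdiff[OF bdd])
  then show bl: "bdd_seq (\<lambda>n. lim (\<lambda>k. F k n))" by simp
  have t0: "t \<longlonglongrightarrow> 0"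
    unfolding t_def using tendsto_diff[OF tendsto_const summable_LIMSEQ[OF smd], of "suminf d"] by simp
  show "(\<lambda>k. sup_norm (\<lambda>n. F k n - lim (\<lambda>k. F k n))) \<longlonglongrightarrow> 0"
    by (rule tendsto_sandwich[OF _ _ tendsto_const t0])
       (auto intro!: always_eventually sup_norm_least tail sup_norm_nonneg bdiff bdd bl)
qed

text \<open>
  The index set \<open>I\<close> only serves to allow the zero module (\<open>I = {}\<close>), which is needed
  because the type of the fibres is too small for sequences of reals if the given module is trivial.
\<close>

definition linf_fun :: "nat set \<Rightarrow> 'x measure \<Rightarrow> ('x \<Rightarrow> nat \<Rightarrow> real) set" where
  "linf_fun I M = {F. (\<forall>n. (\<lambda>x. F x n) \<in> borel_measurable M) \<and> (\<forall>x. bdd_seq (F x)) \<and>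
     (\<forall>x n. n \<notin> I \<longrightarrow> F x n = 0)}"

definition linf_class :: "nat set \<Rightarrow> 'x measure \<Rightarrow> ('x \<Rightarrow> nat \<Rightarrow> real) \<Rightarrow> ('x \<Rightarrow> nat \<Rightarrow> real) set" where
  "linf_class I M F = {G \<in> linf_fun I M. AE x in M. G x = F x}"

text \<open>Every representative is bounded at every point, not just almost everywhere, so for a in
  the carrier \<open>sup_norm (class_rep a x)\<close> is a true supremum at each x.\<close>

definition linf :: "nat set \<Rightarrow> 'x measure \<Rightarrow> (('x \<Rightarrow> real) set, ('x \<Rightarrow> nat \<Rightarrow> real) set) nmodule" where
  "linf I M = \<lparr>carrier = linf_class I M ` linf_fun I M,
     mult = (\<lambda>a b. a),
     one = linf_class I M (\<lambda>x n. 0),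
     zero = linf_class I M (\<lambda>x n. 0),
     add = (\<lambda>a b. linf_class I M (\<lambda>x n. class_rep a x n + class_rep b x n)),
     rscale = (\<lambda>c a. linf_class I M (\<lambda>x n. c * class_rep a x n)),
     act = (\<lambda>f a. linf_class I M (\<lambda>x n. class_rep f x * class_rep a x n)),
     pnorm = (\<lambda>a. l0_class M (\<lambda>x. sup_norm (class_rep a x)))\<rparr>"

lemma linf_funD:
  assumes "F \<in> linf_fun I M"
  shows "(\<lambda>x. F x n) \<in> borel_measurable M" "bdd_seq (F x)" "n \<notin> I \<Longrightarrow> F x n = 0"
  using assms by (auto simp: linf_fun_def)

lemma linf_fun_zero: "(\<lambda>x n. 0) \<in> linf_fun I M"
  by (simp add: linf_fun_def)

lemma linf_fun_add:
  "\<lbrakk>F \<in> linf_fun I M; G \<in> linf_fun I M\<rbrakk> \<Longrightarrow> (\<lambda>x n. F x n + G x n) \<in> linf_fun I M"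
  by (auto simp: linf_fun_def bdd_seq_add intro!: borel_measurable_add)

lemma linf_fun_mult:
  "\<lbrakk>f \<in> borel_measurable M; F \<in> linf_fun I M\<rbrakk> \<Longrightarrow> (\<lambda>x n. f x * F x n) \<in> linf_fun I M"
  by (auto simp: linf_fun_def bdd_seq_cmult intro!: borel_measurable_times)

lemma linf_fun_cmult: "F \<in> linf_fun I M \<Longrightarrow> (\<lambda>x n. c * F x n) \<in> linf_fun I M"
  by (rule linf_fun_mult) auto

lemma linf_fun_uminus: "F \<in> linf_fun I M \<Longrightarrow> (\<lambda>x n. - F x n) \<in> linf_fun I M"
  using linf_fun_cmult[of F I M "-1"] by simp

lemma sup_norm_measurable: "F \<in> linf_fun I M \<Longrightarrow> (\<lambda>x. sup_norm (F x)) \<in> borel_measurable M"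
  unfolding sup_norm_def by (intro borel_measurable_cSUP borel_measurable_abs)
    (auto simp: linf_funD(2)[unfolded bdd_seq_def] intro: linf_funD)

lemma linf_class_eqI: "AE x in M. F x = G x \<Longrightarrow> linf_class I M F = linf_class I M G"
  unfolding linf_class_def by (auto elim!: eventually_elim2)

lemma class_rep_linf_class:
  assumes "F \<in> linf_fun I M"
  shows "class_rep (linf_class I M F) \<in> linf_fun I M"
    and "AE x in M. class_rep (linf_class I M F) x = F x"
proof -
  have "F \<in> linf_class I M F" using assms by (simp add: linf_class_def)
  then have "class_rep (linf_class I M F) \<in> linf_class I M F" by (intro class_rep_in) auto
  then show "class_rep (linf_class I M F) \<in> linf_fun I M"
    and "AE x in M. class_rep (linf_class I M F) x = F x"
    by (auto simp: linf_class_def)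
qed

lemma linf_class_eq_iff:
  assumes "F \<in> linf_fun I M" "G \<in> linf_fun I M"
  shows "linf_class I M F = linf_class I M G \<longleftrightarrow> (AE x in M. F x = G x)"
proof
  assume "linf_class I M F = linf_class I M G"
  then show "AE x in M. F x = G x"
    using assms by (auto simp: linf_class_def)
qed (rule linf_class_eqI)

lemma linf_carrier: "a \<in> carrier (linf I M) \<longleftrightarrow> (\<exists>F\<in>linf_fun I M. a = linf_class I M F)"
  by (auto simp: linf_def)

lemma linf_zero: "\<zero>\<^bsub>linf I M\<^esub> = linf_class I M (\<lambda>x n. 0)"
  by (simp add: linf_def)

lemma linf_add:
  assumes "F \<in> linf_fun I M" "G \<in> linf_fun I M"
  shows "linf_class I M F \<oplus>\<^bsub>linf I M\<^esub> linf_class I M G = linf_class I M (\<lambda>x n. F x n + G x n)"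
  using class_rep_linf_class(2)[OF assms(1)] class_rep_linf_class(2)[OF assms(2)]
  by (auto simp: linf_def intro!: linf_class_eqI)

lemma linf_rscale:
  assumes "F \<in> linf_fun I M"
  shows "rscale (linf I M) c (linf_class I M F) = linf_class I M (\<lambda>x n. c * F x n)"
  using class_rep_linf_class(2)[OF assms] by (auto simp: linf_def intro!: linf_class_eqI)

lemma linf_act:
  assumes "f \<in> borel_measurable M" "F \<in> linf_fun I M"
  shows "act (linf I M) (l0_class M f) (linf_class I M F) = linf_class I M (\<lambda>x n. f x * F x n)"
  using class_rep_l0_class(2)[OF assms(1)] class_rep_linf_class(2)[OF assms(2)]
  by (auto simp: linf_def intro!: linf_class_eqI)

lemma linf_pnorm:
  assumes "F \<in> linf_fun I M"
  shows "pnorm (linf I M) (linf_class I M F) = l0_class M (\<lambda>x. sup_norm (F x))"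
  using class_rep_linf_class(2)[OF assms] by (auto simp: linf_def intro!: l0_class_eqI)

lemmas linf_ops = linf_zero linf_add linf_rscale linf_act linf_pnorm
  linf_fun_zero linf_fun_add linf_fun_mult linf_fun_cmult linf_fun_uminus

lemma linf_pnorm_AE:
  assumes "F \<in> linf_fun I M"
  shows "AE x in M. class_rep (pnorm (linf I M) (linf_class I M F)) x = sup_norm (F x)"
  using assms by (simp add: linf_pnorm class_rep_l0_class sup_norm_measurable)

lemma real_vs_linf: "real_vs (linf I M)"
proof -
  interpret abelian_group "linf I M"
  proof (rule abelian_groupI)
    fix a assume "a \<in> carrier (linf I M)"
    then obtain F where F: "F \<in> linf_fun I M" "a = linf_class I M F" by (auto simp: linf_carrier)
    then show "\<exists>b\<in>carrier (linf I M). b \<oplus>\<^bsub>linf I M\<^esub> a = \<zero>\<^bsub>linf I M\<^esub>"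
      by (intro bexI[of _ "rscale (linf I M) (-1) a"]) (auto simp: linf_ops linf_carrier)
  qed (auto simp: linf_carrier linf_ops add.commute add.left_commute)
  show ?thesis
    by unfold_locales (auto simp: linf_carrier linf_ops algebra_simps)
qed

lemma normed_module_linf: "normed_module M (carrier (L0 M)) (linf I M)"
proof -
  interpret real_vs "linf I M" by (rule real_vs_linf)
  show ?thesis
  proof
    fix e v assume "e \<in> carrier (L0 M)" "\<And>f. f \<in> carrier (L0 M) \<Longrightarrow> e \<otimes>\<^bsub>L0 M\<^esub> f = f"
      and "v \<in> carrier (linf I M)"
    then show "act (linf I M) e v = v"
      using L0_unit[of e M] by (auto simp: linf_carrier linf_ops)
  next
    fix v assume "v \<in> carrier (linf I M)"
    then obtain F where F: "F \<in> linf_fun I M" "v = linf_class I M F" by (auto simp: linf_carrier)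
    show "AE x in M. 0 \<le> class_rep (pnorm (linf I M) v) x"
      using linf_pnorm_AE[OF F(1)] linf_funD(2)[OF F(1)]
      by (auto simp: F(2) sup_norm_nonneg elim!: eventually_mono)
    show "pnorm (linf I M) v = \<zero>\<^bsub>L0 M\<^esub> \<longleftrightarrow> v = \<zero>\<^bsub>linf I M\<^esub>"
      using F linf_funD(2)[OF F(1)]
      by (simp add: linf_ops L0_zero l0_class_eq_iff sup_norm_measurable sup_norm_eq_0_iff linf_class_eq_iff)
    show "pnorm (linf I M) (rscale (linf I M) c v) = rscale (L0 M) \<bar>c\<bar> (pnorm (linf I M) v)" for c
      using F linf_funD(2)[OF F(1)] by (simp add: linf_ops L0_ops sup_norm_measurable bdd_seq_cmult)
    show "pnorm (linf I M) v \<in> carrier (L0 M)"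
      using F by (simp add: linf_ops sup_norm_measurable)
    show "pnorm (linf I M) (act (linf I M) f v) = l0_abs M f \<otimes>\<^bsub>L0 M\<^esub> pnorm (linf I M) v"
      if f: "f \<in> carrier (L0 M)" for f
      using f F linf_funD(2)[OF F(1)] by (auto simp: L0_carrier linf_ops L0_ops sup_norm_measurable bdd_seq_cmult)
    fix w assume "w \<in> carrier (linf I M)"
    then obtain G where G: "G \<in> linf_fun I M" "w = linf_class I M G" by (auto simp: linf_carrier)
    have "AE x in M. class_rep (pnorm (linf I M) (v \<oplus>\<^bsub>linf I M\<^esub> w)) x = sup_norm (\<lambda>n. F x n + G x n)"
      using linf_pnorm_AE[OF linf_fun_add[OF F(1) G(1)]] F G by (simp add: linf_ops)
    with linf_pnorm_AE[OF F(1)] linf_pnorm_AE[OF G(1)]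
    show "AE x in M. class_rep (pnorm (linf I M) (v \<oplus>\<^bsub>linf I M\<^esub> w)) x
        \<le> class_rep (pnorm (linf I M) v) x + class_rep (pnorm (linf I M) w) x"
    proof eventually_elim
      case (elim x)
      then show ?case
        using bdd_seq_add(2)[OF linf_funD(2)[OF F(1)] linf_funD(2)[OF G(1)], of x x]
        by (simp add: F(2) G(2))
    qed
  qed (auto simp: real_subalgebra_L0 L0_carrier linf_carrier linf_ops L0_ops algebra_simps)
qed

lemma banach_module_linf:
  assumes sf: "sigma_finite_measure M"
  shows "banach_module M (linf I M)"
proof -
  interpret normed_module M "carrier (L0 M)" "linf I M" by (rule normed_module_linf)
  have minus: "linf_class I M F \<ominus>\<^bsub>linf I M\<^esub> linf_class I M G = linf_class I M (\<lambda>x n. F x n - G x n)"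
    and fun_minus: "(\<lambda>x n. F x n - G x n) \<in> linf_fun I M"
    if "F \<in> linf_fun I M" "G \<in> linf_fun I M" for F G
  proof -
    have c: "linf_class I M G \<in> carrier (linf I M)" using that by (auto simp: linf_carrier)
    show "linf_class I M F \<ominus>\<^bsub>linf I M\<^esub> linf_class I M G = linf_class I M (\<lambda>x n. F x n - G x n)"
      unfolding minus_eq rscale_minus_one[OF c, symmetric] using that by (simp add: linf_ops)
    show "(\<lambda>x n. F x n - G x n) \<in> linf_fun I M"
      using linf_fun_add[OF that(1) linf_fun_cmult[OF that(2), of "-1"]] by simp
  qed
  have "Metric_space.mcomplete (carrier (linf I M)) (nm_dist M (linf I M))"
  proof (rule mcompleteI[OF sf])
    fix \<sigma> assume "range \<sigma> \<subseteq> carrier (linf I M)"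
      and sm: "AE x in M. summable (\<lambda>k. \<bar>pn (\<sigma> (Suc k) \<ominus>\<^bsub>linf I M\<^esub> \<sigma> k) x\<bar>)"
    then have "\<forall>k. \<exists>F. F \<in> linf_fun I M \<and> \<sigma> k = linf_class I M F"
      using linf_carrier by (metis rangeI subsetD)
    then obtain F where F: "\<And>k. F k \<in> linf_fun I M" and \<sigma>: "\<And>k. \<sigma> k = linf_class I M (F k)"
      by metis
    have "AE x in M. \<forall>k. pn (\<sigma> (Suc k) \<ominus>\<^bsub>linf I M\<^esub> \<sigma> k) x = sup_norm (\<lambda>n. F (Suc k) x n - F k x n)"
      unfolding AE_all_countable \<sigma> using linf_pnorm_AE[OF fun_minus[OF F F]] by (simp add: minus F)
    with sm have "AE x in M. summable (\<lambda>k. sup_norm (\<lambda>n. F (Suc k) x n - F k x n))"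
    proof eventually_elim
      case (elim x)
      have "\<bar>pn (\<sigma> (Suc k) \<ominus>\<^bsub>linf I M\<^esub> \<sigma> k) x\<bar> = sup_norm (\<lambda>n. F (Suc k) x n - F k x n)" for k
        using elim(2) sup_norm_nonneg[OF linf_funD(2)[OF fun_minus[OF F F]], of "Suc k" x k] by simp
      then show ?case using elim(1) by simp
    qed
    then obtain Z where Z: "Z \<in> null_sets M"
      "\<And>x. x \<in> space M - Z \<Longrightarrow> summable (\<lambda>k. sup_norm (\<lambda>n. F (Suc k) x n - F k x n))"
      by (auto elim!: AE_E3)
    \<comment> \<open>Summability is known only off \<open>Z\<close>. The value 0 elsewhere keeps
      \<open>L x\<close> bounded at every x, also outside \<open>space M\<close>.\<close>
    define L where "L x n = indicat_real (space M - Z) x * lim (\<lambda>k. F k x n)" for x n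
    have L: "L \<in> linf_fun I M"
      unfolding linf_fun_def mem_Collect_eq
    proof (intro conjI allI impI)
      show "(\<lambda>x. L x n) \<in> borel_measurable M" for n
        unfolding L_def using Z(1) linf_funD(1)[OF F]
        by (intro borel_measurable_times borel_measurable_lim_metric borel_measurable_indicator) auto
      show "bdd_seq (L x)" for x
      proof (cases "x \<in> space M - Z")
        case True
        then have "L x = (\<lambda>n. lim (\<lambda>k. F k x n))" by (auto simp: L_def)
        then show ?thesis
          using sup_norm_complete(1)[OF linf_funD(2)[OF F] Z(2)[OF True]] by simp
      next
        case False
        then have "L x = (\<lambda>n. 0)" by (auto simp: L_def)
        then show ?thesis by simp
      qed
      show "L x n = 0" if "n \<notin> I" for x n
        using linf_funD(3)[OF F that] by (simp add: L_def limI)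
    qed
    show "\<exists>v\<in>carrier (linf I M). AE x in M. (\<lambda>k. pn (\<sigma> k \<ominus>\<^bsub>linf I M\<^esub> v) x) \<longlonglongrightarrow> 0"
    proof (rule bexI[of _ "linf_class I M L"])
      have "AE x in M. \<forall>k. pn (\<sigma> k \<ominus>\<^bsub>linf I M\<^esub> linf_class I M L) x = sup_norm (\<lambda>n. F k x n - L x n)"
        unfolding AE_all_countable \<sigma> using linf_pnorm_AE[OF fun_minus[OF F L]] by (simp add: minus F L)
      with AE_not_in[OF Z(1)] AE_space
      show "AE x in M. (\<lambda>k. pn (\<sigma> k \<ominus>\<^bsub>linf I M\<^esub> linf_class I M L) x) \<longlonglongrightarrow> 0"
      proof eventually_elim
        case (elim x)
        then show ?case
          using sup_norm_complete(2)[OF linf_funD(2)[OF F] Z(2), of x] by (simp add: L_def)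
      qed
    qed (use L in \<open>auto simp: linf_carrier\<close>)
  qed
  then show ?thesis
    by (simp add: banach_A_module_def normed_module_linf)
qed

section \<open>Transport of structure\<close>

text \<open>The type of the fibre elements is prescribed and differs from that of
  \<open>linf\<close>, so the structure is carried along an injection with inverse
  \<open>g\<close>.\<close>

definition nm_transport :: "('v \<Rightarrow> 'w) \<Rightarrow> ('a, 'v) nmodule \<Rightarrow> ('a, 'w) nmodule" where
  "nm_transport h B = (let g = the_inv_into (carrier B) h in
     \<lparr>carrier = h ` carrier B,
      mult = (\<lambda>a b. a),
      one = h \<zero>\<^bsub>B\<^esub>,
      zero = h \<zero>\<^bsub>B\<^esub>,
      add = (\<lambda>a b. h (g a \<oplus>\<^bsub>B\<^esub> g b)),
      rscale = (\<lambda>c a. h (rscale B c (g a))),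
      act = (\<lambda>f a. h (act B f (g a))),
      pnorm = (\<lambda>a. pnorm B (g a))\<rparr>)"

lemma nm_transport_simps:
  "carrier (nm_transport h B) = h ` carrier B"
  "\<zero>\<^bsub>nm_transport h B\<^esub> = h \<zero>\<^bsub>B\<^esub>"
  by (simp_all add: nm_transport_def Let_def)

lemma nm_transport_ops:
  assumes "inj_on h (carrier B)"
  shows "\<lbrakk>a \<in> carrier B; b \<in> carrier B\<rbrakk> \<Longrightarrow> h a \<oplus>\<^bsub>nm_transport h B\<^esub> h b = h (a \<oplus>\<^bsub>B\<^esub> b)"
    and "a \<in> carrier B \<Longrightarrow> rscale (nm_transport h B) c (h a) = h (rscale B c a)"
    and "a \<in> carrier B \<Longrightarrow> act (nm_transport h B) f (h a) = h (act B f a)"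
    and "a \<in> carrier B \<Longrightarrow> pnorm (nm_transport h B) (h a) = pnorm B a"
  using assms by (simp_all add: nm_transport_def Let_def the_inv_into_f_f)

text \<open>The map h preserves norms of differences and so becomes an isometry; Cauchy sequences
  and limits correspond.\<close>

lemma banach_module_transport:
  assumes sf: "sigma_finite_measure M" and B: "banach_module M B" and h: "inj_on h (carrier B)"
  shows "banach_module M (nm_transport h B)"
proof -
  interpret B: normed_module M "carrier (L0 M)" B using B by (simp add: banach_A_module_def)
  let ?T = "nm_transport h B"
  note [simp] = nm_transport_simps nm_transport_ops[OF h]
  have [simp]: "pnorm B \<zero>\<^bsub>B\<^esub> = \<zero>\<^bsub>L0 M\<^esub>" by (simp add: B.pnorm_eq_zero)
  have inj: "h a = h b \<longleftrightarrow> a = b" if "a \<in> carrier B" "b \<in> carrier B" for a b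
    using inj_on_eq_iff[OF h that] .
  interpret T: abelian_group ?T
  proof (rule abelian_groupI)
    fix a assume "a \<in> carrier ?T"
    then obtain b where b: "b \<in> carrier B" "a = h b" by auto
    then show "\<exists>c\<in>carrier ?T. c \<oplus>\<^bsub>?T\<^esub> a = \<zero>\<^bsub>?T\<^esub>"
      by (intro bexI[of _ "h (\<ominus>\<^bsub>B\<^esub> b)"]) (auto simp: B.l_neg)
  qed (auto simp: B.a_ac)
  interpret T: real_vs ?T
    by unfold_locales
       (auto simp: B.rscale_closed B.rscale_add_right B.rscale_add_left B.rscale_rscale B.rscale_one)
  interpret T: normed_module M "carrier (L0 M)" ?T
  proof
    show "act ?T e v = v" if "e \<in> carrier (L0 M)" "\<And>f. f \<in> carrier (L0 M) \<Longrightarrow> e \<otimes>\<^bsub>L0 M\<^esub> f = f"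
      "v \<in> carrier ?T" for e v
      using that B.act_unit[OF that(1,2)] by auto
  qed (auto simp: real_subalgebra_L0 B.act_closed B.act_add_right B.act_add_left B.act_mult B.act_rscale
      B.rscale_closed B.pnorm_closed B.pnorm_nonneg B.pnorm_eq_zero B.pnorm_triangle B.pnorm_rscale B.pnorm_act inj)
  have minus: "h a \<ominus>\<^bsub>?T\<^esub> h b = h (a \<ominus>\<^bsub>B\<^esub> b)" if "a \<in> carrier B" "b \<in> carrier B" for a b
    using that T.rscale_minus_one[of "h b"]
    by (simp add: T.minus_eq B.minus_eq B.rscale_minus_one flip: T.rscale_minus_one)
  have dist: "nm_dist M ?T (h a) (h b) = nm_dist M B a b" if "a \<in> carrier B" "b \<in> carrier B" for a b
    using that by (simp add: nm_dist_def minus)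
  interpret TM: Metric_space "carrier ?T" "nm_dist M ?T" by (rule T.Metric_space_nm[OF sf])
  interpret BM: Metric_space "carrier B" "nm_dist M B" by (rule B.Metric_space_nm[OF sf])
  have "TM.mcomplete"
    unfolding TM.mcomplete_def
  proof (intro allI impI)
    fix \<tau> assume \<tau>: "TM.MCauchy \<tau>"
    then have "\<forall>k. \<exists>b. b \<in> carrier B \<and> \<tau> k = h b"
      unfolding TM.MCauchy_def by (auto simp: image_subset_iff)
    then obtain \<sigma> where \<sigma>: "\<And>k. \<sigma> k \<in> carrier B" "\<And>k. \<tau> k = h (\<sigma> k)" by metis
    have "\<forall>\<epsilon>>0. \<exists>N. \<forall>n n'. N \<le> n \<longrightarrow> N \<le> n' \<longrightarrow> nm_dist M ?T (\<tau> n) (\<tau> n') < \<epsilon>"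
      using \<tau> unfolding TM.MCauchy_def by blast
    then have "BM.MCauchy \<sigma>"
      using \<sigma> unfolding BM.MCauchy_def by (auto simp: dist)
    then obtain b where b: "limitin BM.mtopology \<sigma> b sequentially"
      using B by (auto simp: banach_A_module_def BM.mcomplete_def)
    then have "limitin TM.mtopology \<tau> (h b) sequentially"
      unfolding TM.limitin_metric BM.limitin_metric by (auto simp: \<sigma> dist)
    then show "\<exists>x. limitin TM.mtopology \<tau> x sequentially" ..
  qed
  then show ?thesis
    by (simp add: banach_A_module_def T.normed_module_axioms)
qed

section \<open>Sections\<close>

lemma sec_class_eqI: "AE q in Q. v q = w q \<Longrightarrow> sec_class Q A v = sec_class Q A w"
  unfolding sec_class_def by (auto elim!: eventually_elim2)

lemma restrict_in_sec_class:
  assumes "\<And>q. q \<in> space Q \<Longrightarrow> v q \<in> carrier (A q)"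
  shows "restrict v (space Q) \<in> sec_class Q A v"
  unfolding sec_class_def mem_Collect_eq
proof (intro conjI)
  show "restrict v (space Q) \<in> (\<Pi>\<^sub>E q\<in>space Q. carrier (A q))"
    using assms by (rule restrict_PiE_iff[THEN iffD2, rule_format])
qed (auto intro!: AE_I2)

lemma class_rep_sec_class:
  assumes "\<And>q. q \<in> space Q \<Longrightarrow> v q \<in> carrier (A q)"
  shows "AE q in Q. class_rep (sec_class Q A v) q = v q"
proof -
  have "class_rep (sec_class Q A v) \<in> sec_class Q A v"
    using restrict_in_sec_class[of Q v A] assms by (intro class_rep_in) auto
  then show ?thesis by (simp add: sec_class_def)
qed

lemma sec_class_eqD:
  assumes "\<And>q. q \<in> space Q \<Longrightarrow> v q \<in> carrier (A q)" "\<And>q. q \<in> space Q \<Longrightarrow> w q \<in> carrier (A q)"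
    and "sec_class Q A v = sec_class Q A w"
  shows "AE q in Q. v q = w q"
  using class_rep_sec_class[of Q v A] class_rep_sec_class[of Q w A] assms
  by (auto elim!: eventually_elim2)

lemma sec_class_in_carrier:
  assumes "\<And>q. q \<in> space Q \<Longrightarrow> v q \<in> carrier (A q)"
  shows "sec_class Q A v \<in> carrier (sec_quot Q A)"
proof -
  have "sec_class Q A v = sec_class Q A (restrict v (space Q))"
    by (rule sec_class_eqI) (auto intro!: AE_I2)
  moreover have "restrict v (space Q) \<in> (\<Pi>\<^sub>E q\<in>space Q. carrier (A q))"
    using restrict_in_sec_class[of Q v A] assms by (simp add: sec_class_def)
  ultimately show ?thesis by (auto simp: sec_quot_def)
qed

lemma sec_quot_ops:
  assumes v: "\<And>q. q \<in> space Q \<Longrightarrow> v q \<in> carrier (A q)"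
    and w: "\<And>q. q \<in> space Q \<Longrightarrow> w q \<in> carrier (A q)"
  shows "sec_class Q A v \<oplus>\<^bsub>sec_quot Q A\<^esub> sec_class Q A w = sec_class Q A (\<lambda>q. v q \<oplus>\<^bsub>A q\<^esub> w q)"
    and "sec_class Q A v \<otimes>\<^bsub>sec_quot Q A\<^esub> sec_class Q A w = sec_class Q A (\<lambda>q. v q \<otimes>\<^bsub>A q\<^esub> w q)"
  using class_rep_sec_class[of Q v A, OF v] class_rep_sec_class[of Q w A, OF w]
  by (auto simp: sec_quot_def intro!: sec_class_eqI)

lemma sec_quot_rscale:
  assumes v: "\<And>q. q \<in> space Q \<Longrightarrow> v q \<in> carrier (A q)"
  shows "rscale (sec_quot Q A) c (sec_class Q A v) = sec_class Q A (\<lambda>q. rscale (A q) c (v q))"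
  using class_rep_sec_class[of Q v A, OF v] by (auto simp: sec_quot_def intro!: sec_class_eqI)

lemma sec_quot_zero: "\<zero>\<^bsub>sec_quot Q A\<^esub> = sec_class Q A (\<lambda>q. \<zero>\<^bsub>A q\<^esub>)"
  by (simp add: sec_quot_def)

section \<open>Disintegration\<close>

locale disintegration =
  fixes Q :: "'q measure" and M :: "'x measure" and \<mu> :: "'q \<Rightarrow> 'x measure"
  assumes mvm: "measure_valued_map Q M \<mu>"
    and M_eq: "M = integral_measure Q M \<mu>"
begin

lemma sets_\<mu>: "q \<in> space Q \<Longrightarrow> sets (\<mu> q) = sets M"
  using mvm by (simp add: measure_valued_map_def)

lemma sigma_finite_\<mu>: "q \<in> space Q \<Longrightarrow> sigma_finite_measure (\<mu> q)"
  using mvm by (simp add: measure_valued_map_def)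

lemma sigma_finite_M: "sigma_finite_measure M"
  using mvm M_eq by (simp add: measure_valued_map_def)

lemma measurable_\<mu>: "\<lbrakk>F \<in> borel_measurable M; q \<in> space Q\<rbrakk> \<Longrightarrow> F \<in> borel_measurable (\<mu> q)"
  using sets_\<mu> by (simp cong: measurable_cong_sets)

text \<open>\<open>measure_of\<close> returns the intended set function only once this is known to
  be a measure; countable additivity is the interchange of sum and integral over
  \<open>Q\<close>.\<close>

lemma emeasure_disintegration:
  assumes "E \<in> sets M"
  shows "emeasure M E = (\<integral>\<^sup>+ q. emeasure (\<mu> q) E \<partial>Q)"
proof (rule emeasure_measure_of[OF M_eq[unfolded integral_measure_def]])
  have meas: "(\<lambda>q. emeasure (\<mu> q) E) \<in> borel_measurable Q" if "E \<in> sets M" for E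
    using that mvm by (simp add: measure_valued_map_def)
  show "countably_additive (sets M) (\<lambda>E. \<integral>\<^sup>+ q. emeasure (\<mu> q) E \<partial>Q)"
  proof (rule countably_additiveI)
    fix A :: "nat \<Rightarrow> 'x set" assume A: "range A \<subseteq> sets M" "disjoint_family A"
    have "(\<Sum>i. \<integral>\<^sup>+ q. emeasure (\<mu> q) (A i) \<partial>Q) = (\<integral>\<^sup>+ q. (\<Sum>i. emeasure (\<mu> q) (A i)) \<partial>Q)"
      using A by (intro nn_integral_suminf[symmetric] meas) auto
    also have "\<dots> = (\<integral>\<^sup>+ q. emeasure (\<mu> q) (\<Union>i. A i) \<partial>Q)"
      using A by (intro nn_integral_cong suminf_emeasure) (auto simp: sets_\<mu>)
    finally show "(\<Sum>i. \<integral>\<^sup>+ q. emeasure (\<mu> q) (A i) \<partial>Q) = (\<integral>\<^sup>+ q. emeasure (\<mu> q) (\<Union> (range A)) \<partial>Q)" .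
  qed
qed (use assms sets.space_closed in \<open>auto simp: positive_def\<close>)

text \<open>For an \<open>M\<close>-null set Z the nonnegative function sending q to
  \<open>emeasure (\<mu> q) Z\<close> has integral 0, hence vanishes almost everywhere. The
  exceptional q depend on P.\<close>

lemma AE_disintegration:
  assumes "AE x in M. P x"
  shows "AE q in Q. AE x in \<mu> q. P x"
proof -
  obtain Z where Z: "Z \<in> null_sets M" "\<And>x. x \<in> space M - Z \<Longrightarrow> P x"
    using assms by (auto elim!: AE_E3)
  have "(\<integral>\<^sup>+ q. emeasure (\<mu> q) Z \<partial>Q) = 0"
    using Z(1) emeasure_disintegration[of Z] by (simp add: null_sets_def)
  moreover have "(\<lambda>q. emeasure (\<mu> q) Z) \<in> borel_measurable Q"
    using Z(1) mvm by (auto simp: measure_valued_map_def)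
  ultimately have "AE q in Q. emeasure (\<mu> q) Z = 0"
    by (simp add: nn_integral_0_iff_AE)
  then show ?thesis using AE_space
  proof eventually_elim
    case (elim q)
    then have "Z \<in> null_sets (\<mu> q)" using Z(1) sets_\<mu> by auto
    moreover have "space (\<mu> q) = space M"
      using elim sets_\<mu> by (intro sets_eq_imp_space_eq) auto
    ultimately show ?case using Z(2) by (intro AE_I'[of Z]) auto
  qed
qed

text \<open>Measurability of the exceptional set lets its measure be computed by integration over
  \<open>Q\<close>; null sets chosen for each q separately need not fit together to a measurable
  set.\<close>

lemma AE_of_disintegration:
  assumes "{x \<in> space M. \<not> P x} \<in> sets M" and "AE q in Q. AE x in \<mu> q. P x"
  shows "AE x in M. P x"
proof -
  let ?Z = "{x \<in> space M. \<not> P x}"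
  have "AE q in Q. emeasure (\<mu> q) ?Z = 0"
    using assms(2) AE_space
  proof eventually_elim
    case (elim q)
    then have "space (\<mu> q) = space M"
      using sets_\<mu> by (intro sets_eq_imp_space_eq) auto
    then show ?case
      using elim AE_iff_measurable[of ?Z "\<mu> q" P] assms(1) sets_\<mu> by auto
  qed
  then have "(\<integral>\<^sup>+ q. emeasure (\<mu> q) ?Z \<partial>Q) = 0"
    using assms(1) mvm by (subst nn_integral_0_iff_AE) (auto simp: measure_valued_map_def)
  then have "emeasure M ?Z = 0"
    using emeasure_disintegration[OF assms(1)] by simp
  then show ?thesis
    using AE_iff_measurable[OF assms(1) refl] by simp
qed

section \<open>Functions on the total space and sections\<close>

abbreviation L0\<mu> :: "'q \<Rightarrow> ('x \<Rightarrow> real) set ralgebra" where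
  "L0\<mu> \<equiv> \<lambda>q. L0 (\<mu> q)"

lemma l0_class_\<mu>_closed: "F \<in> borel_measurable M \<Longrightarrow> q \<in> space Q \<Longrightarrow> l0_class (\<mu> q) F \<in> carrier (L0\<mu> q)"
  by (simp add: measurable_\<mu>)

lemma to_sections_l0_class:
  assumes "F \<in> borel_measurable M"
  shows "to_sections Q \<mu> (l0_class M F) = sec_class Q L0\<mu> (\<lambda>q. l0_class (\<mu> q) F)"
  unfolding to_sections_def
  using AE_disintegration[OF class_rep_l0_class(2)[OF assms]]
  by (intro sec_class_eqI) (auto intro!: l0_class_eqI elim!: eventually_mono)

text \<open>The set where two measurable functions differ is measurable, so agreement in almost
  every fibre gives agreement \<open>M\<close>-almost everywhere. This makes
  \<open>from_sections\<close> a genuine inverse.\<close>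

lemma inj_on_to_sections: "inj_on (to_sections Q \<mu>) (carrier (L0 M))"
proof (rule inj_onI)
  fix a b assume a: "a \<in> carrier (L0 M)" and b: "b \<in> carrier (L0 M)"
    and eq: "to_sections Q \<mu> a = to_sections Q \<mu> b"
  obtain F G where F: "F \<in> borel_measurable M" "a = l0_class M F"
    and G: "G \<in> borel_measurable M" "b = l0_class M G"
    using a b by (auto simp: L0_carrier)
  have "AE q in Q. l0_class (\<mu> q) F = l0_class (\<mu> q) G"
    using eq F G by (intro sec_class_eqD[OF l0_class_\<mu>_closed l0_class_\<mu>_closed])
      (simp_all add: to_sections_l0_class)
  then have "AE q in Q. AE x in \<mu> q. F x = G x"
    using AE_space by eventually_elim (use F G in \<open>simp add: l0_class_eq_iff measurable_\<mu>\<close>)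
  then have "AE x in M. F x = G x"
    using F G by (intro AE_of_disintegration) auto
  then show "a = b" using F G by (simp add: l0_class_eq_iff)
qed

lemma from_to_sections: "a \<in> carrier (L0 M) \<Longrightarrow> from_sections Q M \<mu> (to_sections Q \<mu> a) = a"
  unfolding from_sections_def by (rule the_inv_into_f_f[OF inj_on_to_sections])

lemma L0_sections_eq: "L0_sections Q M \<mu> = to_sections Q \<mu> ` carrier (L0 M)"
proof (intro equalityI subsetI)
  fix s assume "s \<in> L0_sections Q M \<mu>"
  then obtain f F where s: "s = sec_class Q L0\<mu> f" and F: "F \<in> borel_measurable M"
    and ae: "AE q in Q. l0_class (\<mu> q) F = f q"
    by (auto simp: L0_sections_def)
  have "s = to_sections Q \<mu> (l0_class M F)"
    using ae by (auto simp: s to_sections_l0_class F intro!: sec_class_eqI elim!: eventually_mono)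
  then show "s \<in> to_sections Q \<mu> ` carrier (L0 M)" using F by simp
next
  fix s assume "s \<in> to_sections Q \<mu> ` carrier (L0 M)"
  then obtain F where F: "F \<in> borel_measurable M" and s: "s = to_sections Q \<mu> (l0_class M F)"
    by (auto simp: L0_carrier)
  define f where "f = restrict (\<lambda>q. l0_class (\<mu> q) F) (space Q)"
  have ae: "AE q in Q. l0_class (\<mu> q) F = f q"
    by (auto simp: f_def intro!: AE_I2)
  have "s = sec_class Q L0\<mu> f"
    unfolding s to_sections_l0_class[OF F] by (rule sec_class_eqI[OF ae])
  moreover have "f \<in> (\<Pi>\<^sub>E q\<in>space Q. carrier (L0\<mu> q))"
    using F by (auto simp: f_def l0_class_\<mu>_closed)
  ultimately show "s \<in> L0_sections Q M \<mu>"
    unfolding L0_sections_def using F ae by blast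
qed

lemma to_sections_ops:
  assumes "a \<in> carrier (L0 M)" "b \<in> carrier (L0 M)"
  shows "to_sections Q \<mu> a \<oplus>\<^bsub>sec_quot Q L0\<mu>\<^esub> to_sections Q \<mu> b = to_sections Q \<mu> (a \<oplus>\<^bsub>L0 M\<^esub> b)"
    and "to_sections Q \<mu> a \<otimes>\<^bsub>sec_quot Q L0\<mu>\<^esub> to_sections Q \<mu> b = to_sections Q \<mu> (a \<otimes>\<^bsub>L0 M\<^esub> b)"
    and "rscale (sec_quot Q L0\<mu>) c (to_sections Q \<mu> a) = to_sections Q \<mu> (rscale (L0 M) c a)"
proof -
  obtain F G where "F \<in> borel_measurable M" "a = l0_class M F"
    and "G \<in> borel_measurable M" "b = l0_class M G"
    using assms by (auto simp: L0_carrier)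
  then show "to_sections Q \<mu> a \<oplus>\<^bsub>sec_quot Q L0\<mu>\<^esub> to_sections Q \<mu> b = to_sections Q \<mu> (a \<oplus>\<^bsub>L0 M\<^esub> b)"
    and "to_sections Q \<mu> a \<otimes>\<^bsub>sec_quot Q L0\<mu>\<^esub> to_sections Q \<mu> b = to_sections Q \<mu> (a \<otimes>\<^bsub>L0 M\<^esub> b)"
    and "rscale (sec_quot Q L0\<mu>) c (to_sections Q \<mu> a) = to_sections Q \<mu> (rscale (L0 M) c a)"
    by (auto simp: to_sections_l0_class sec_quot_ops sec_quot_rscale measurable_\<mu> L0_ops
        intro!: sec_class_eqI AE_I2)
qed

lemma real_subalgebra_L0_sections: "real_subalgebra (sec_quot Q L0\<mu>) (L0_sections Q M \<mu>)"
proof -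
  have "to_sections Q \<mu> a \<in> carrier (sec_quot Q L0\<mu>)" if a: "a \<in> carrier (L0 M)" for a
  proof -
    obtain F where F: "F \<in> borel_measurable M" "a = l0_class M F"
      using a by (auto simp: L0_carrier)
    show ?thesis
      unfolding F(2) to_sections_l0_class[OF F(1)] by (intro sec_class_in_carrier l0_class_\<mu>_closed F)
  qed
  moreover have "\<zero>\<^bsub>sec_quot Q L0\<mu>\<^esub> = to_sections Q \<mu> \<zero>\<^bsub>L0 M\<^esub>"
    by (simp add: sec_quot_zero to_sections_l0_class L0_zero)
  ultimately show ?thesis
    unfolding real_subalgebra_def vector_subspace_def L0_sections_eq
    by (auto simp: to_sections_ops)
qed

text \<open>These are the two kinds of members of the trivial partition of \<open>Q\<close>, with
  which the density of the coefficient algebra is verified.\<close>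

lemma sec_restrict_to_sections:
  assumes a: "a \<in> carrier (L0 M)"
  shows "sec_restrict Q \<mu> (space Q) (to_sections Q \<mu> a) = to_sections Q \<mu> a"
    and "sec_restrict Q \<mu> {} (to_sections Q \<mu> a) = to_sections Q \<mu> \<zero>\<^bsub>L0 M\<^esub>"
proof -
  obtain F where F: "F \<in> borel_measurable M" "a = l0_class M F"
    using a by (auto simp: L0_carrier)
  have rep: "AE q in Q. class_rep (to_sections Q \<mu> a) q = l0_class (\<mu> q) F"
    unfolding F(2) to_sections_l0_class[OF F(1)] by (intro class_rep_sec_class l0_class_\<mu>_closed F)
  have "AE q in Q. rscale (L0\<mu> q) (indicat_real (space Q) q) (class_rep (to_sections Q \<mu> a) q) = l0_class (\<mu> q) F"
    using rep AE_space by eventually_elim (use F in \<open>simp add: L0_rscale measurable_\<mu>\<close>)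
  then show "sec_restrict Q \<mu> (space Q) (to_sections Q \<mu> a) = to_sections Q \<mu> a"
    unfolding sec_restrict_def F(2) to_sections_l0_class[OF F(1)] by (intro sec_class_eqI)
  have "AE q in Q. rscale (L0\<mu> q) (indicat_real {} q) (class_rep (to_sections Q \<mu> a) q) = l0_class (\<mu> q) (\<lambda>_. 0)"
    using rep AE_space by eventually_elim (use F in \<open>simp add: L0_rscale measurable_\<mu>\<close>)
  then show "sec_restrict Q \<mu> {} (to_sections Q \<mu> a) = to_sections Q \<mu> \<zero>\<^bsub>L0 M\<^esub>"
    unfolding sec_restrict_def L0_zero to_sections_l0_class[OF borel_measurable_const]
    by (intro sec_class_eqI)
qed

end

section \<open>Gluing along the trivial partition\<close>

lemma trivial_partition: "countable_partition M (\<lambda>n. if n = 0 then space M else {})"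
  by (auto simp: countable_partition_def disjoint_family_on_def)

context abelian_monoid
begin

lemma finsum_first:
  assumes "a \<in> carrier G" "0 < k"
  shows "(\<Oplus>n\<in>{..<k::nat}. if n = 0 then a else \<zero>) = a"
  using finsum_singleton[of "0::nat" "{..<k}" "\<lambda>_. a"] assms by (simp add: eq_commute[of 0])

end

lemma (in disintegration) sec_glued_L0_sections: "sec_glued Q M \<mu> (L0_sections Q M \<mu>) = carrier (L0 M)"
proof (intro equalityI subsetI)
  fix a assume a: "a \<in> carrier (L0 M)"
  interpret L: abelian_monoid "L0 M" by (rule L0_abelian_monoid)
  interpret S: Metric_space "carrier (L0 M)" "l0_dist M" by (rule Metric_space_L0[OF sigma_finite_M])
  let ?S = "\<lambda>n::nat. if n = 0 then space Q else {}"
  have "from_sections Q M \<mu> (sec_restrict Q \<mu> (?S n) (to_sections Q \<mu> a)) = (if n = 0 then a else \<zero>\<^bsub>L0 M\<^esub>)" for n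
    using a by (simp add: sec_restrict_to_sections from_to_sections)
  moreover have "limitin (l0_topology M) (\<lambda>k. finsum (L0 M) (\<lambda>n. if n = 0 then a else \<zero>\<^bsub>L0 M\<^esub>) {..<k}) a sequentially"
    \<comment> \<open>The partial sums are constant from k = 1 on; for k = 0 the sum is
      empty.\<close>
    using a by (intro limitin_eventually) (auto intro!: eventually_sequentiallyI[of 1] L.finsum_first)
  ultimately show "a \<in> sec_glued Q M \<mu> (L0_sections Q M \<mu>)"
    unfolding sec_glued_def using a trivial_partition[of Q]
    by (auto simp: L0_sections_eq intro!: exI[of _ ?S] exI[of _ "\<lambda>_. to_sections Q \<mu> a"])
qed (simp add: sec_glued_def)

lemma (in l0_module) glued_carrier: "glued M N (carrier N) = carrier N"
proof (intro equalityI subsetI)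
  fix v assume v: "v \<in> carrier N"
  interpret S: Metric_space "carrier N" "nm_dist M N" by (rule Metric_space_nm[OF sf])
  let ?E = "\<lambda>n::nat. if n = 0 then space M else {}"
  have "l0_ind M (space M) = l0_class M (\<lambda>_. 1)"
    unfolding l0_ind_def by (rule l0_class_eqI) (auto intro!: AE_I2)
  moreover have "l0_ind M {} = l0_class M (\<lambda>_. 0)"
    unfolding l0_ind_def by (rule l0_class_eqI) simp
  ultimately have "act N (l0_ind M (?E n)) v = (if n = 0 then v else \<zero>)" for n
    using v by (simp add: act_l0_class_const rscale_one)
  moreover have "limitin (nm_topology M N) (\<lambda>k. finsum N (\<lambda>n. if n = 0 then v else \<zero>) {..<k}) v sequentially"
    using v by (intro limitin_eventually) (auto intro!: eventually_sequentiallyI[of 1] finsum_first)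
  ultimately show "v \<in> glued M N (carrier N)"
    unfolding glued_def using v trivial_partition[of M]
    by (auto intro!: exI[of _ ?E] exI[of _ "\<lambda>_. v"])
qed (simp add: glued_def)

text \<open>Any map onto the carrier thereby has a generating image, as a completion
  requires.\<close>

lemma (in l0_module) generates_carrier: "generates M N (carrier N)"
proof -
  interpret S: Metric_space "carrier N" "nm_dist M N" by (rule Metric_space_nm[OF sf])
  show ?thesis
    using closure_of_topspace[of S.mtopology]
    by (auto simp: generates_def vector_subspace_def glued_carrier rscale_closed)
qed

section \<open>Bundles from fibrewise representations\<close>

text \<open>The relations for \<open>\<kappa>\<close> hold for almost every q, with exceptions
  depending on the vectors; passing to classes of sections turns them into identities. The resulting
  space of sections is isometric to \<open>N\<close>, which is already complete, so \<open>N\<close>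
  itself serves as the integral.\<close>

lemma bundle_of_fibre_maps:
  fixes Ms :: "'q \<Rightarrow> (('x \<Rightarrow> real) set, 'w) nmodule" and \<kappa> :: "'m \<Rightarrow> 'q \<Rightarrow> 'w"
    and N :: "(('x \<Rightarrow> real) set, 'm) nmodule"
  assumes disj: "disjoint_measure_valued_map Q M \<mu>" and M_eq: "M = integral_measure Q M \<mu>"
    and N: "banach_module M N"
    and Ms: "\<And>q. q \<in> space Q \<Longrightarrow> banach_module (\<mu> q) (Ms q)"
    and \<kappa>_closed: "\<And>v q. \<lbrakk>v \<in> carrier N; q \<in> space Q\<rbrakk> \<Longrightarrow> \<kappa> v q \<in> carrier (Ms q)"
    and \<kappa>_add: "\<And>v w. \<lbrakk>v \<in> carrier N; w \<in> carrier N\<rbrakk> \<Longrightarrow>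
      AE q in Q. \<kappa> (v \<oplus>\<^bsub>N\<^esub> w) q = \<kappa> v q \<oplus>\<^bsub>Ms q\<^esub> \<kappa> w q"
    and \<kappa>_act: "\<And>F v. \<lbrakk>F \<in> borel_measurable M; v \<in> carrier N\<rbrakk> \<Longrightarrow>
      AE q in Q. \<kappa> (act N (l0_class M F) v) q = act (Ms q) (l0_class (\<mu> q) F) (\<kappa> v q)"
    and \<kappa>_norm: "\<And>v. v \<in> carrier N \<Longrightarrow>
      AE q in Q. pnorm (Ms q) (\<kappa> v q) = l0_class (\<mu> q) (class_rep (pnorm N v))"
  shows "\<exists>\<Theta> \<Phi>. banach_module_bundle Q M \<mu> Ms \<Theta> \<Phi> \<and> is_bundle_integral Q M \<mu> Ms \<Theta> N"
proof -
  interpret disintegration Q M \<mu>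
    using disj M_eq by unfold_locales (auto simp: disjoint_measure_valued_map_def)
  interpret N: l0_module M N
    using N sigma_finite_M by (simp add: l0_module_def l0_module_axioms_def banach_A_module_def)
  have fibre: "l0_module (\<mu> q) (Ms q)" if "q \<in> space Q" for q
    using Ms[OF that] sigma_finite_\<mu>[OF that]
    by (simp add: l0_module_def l0_module_axioms_def banach_A_module_def)
  define K where "K v = sec_class Q Ms (\<kappa> v)" for v
  define \<Theta> where "\<Theta> = K ` carrier N"
  have rep: "AE q in Q. class_rep (K v) q = \<kappa> v q" if "v \<in> carrier N" for v
    unfolding K_def by (intro class_rep_sec_class \<kappa>_closed that)
  have K_add: "K v \<oplus>\<^bsub>sec_quot Q Ms\<^esub> K w = K (v \<oplus>\<^bsub>N\<^esub> w)" if "v \<in> carrier N" "w \<in> carrier N" for v w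
    using \<kappa>_add[OF that] that
    by (auto simp: K_def sec_quot_ops sec_quot_rscale \<kappa>_closed intro!: sec_class_eqI elim!: eventually_mono)
  have K_act: "sec_act Q Ms (to_sections Q \<mu> a) (K v) = K (act N a v)"
    if a: "a \<in> carrier (L0 M)" and v: "v \<in> carrier N" for a v
  proof -
    obtain F where F: "F \<in> borel_measurable M" "a = l0_class M F"
      using a by (auto simp: L0_carrier)
    have "AE q in Q. class_rep (to_sections Q \<mu> a) q = l0_class (\<mu> q) F"
      unfolding F(2) to_sections_l0_class[OF F(1)] by (intro class_rep_sec_class l0_class_\<mu>_closed F)
    with rep[OF v] \<kappa>_act[OF F(1) v]
    have "AE q in Q. act (Ms q) (class_rep (to_sections Q \<mu> a) q) (class_rep (K v) q) = \<kappa> (act N a v) q"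
      by eventually_elim (simp add: F)
    then show ?thesis by (auto simp: sec_act_def K_def intro!: sec_class_eqI)
  qed
  \<comment> \<open>Real scalars are the action of constant functions, both in \<open>N\<close> and
    in the fibres.\<close>
  have \<kappa>_rscale: "AE q in Q. \<kappa> (rscale N c v) q = rscale (Ms q) c (\<kappa> v q)" if v: "v \<in> carrier N" for c v
    using \<kappa>_act[OF borel_measurable_const v, of c] AE_space
  proof eventually_elim
    case (elim q)
    then show ?case
      using l0_module.act_l0_class_const[OF fibre \<kappa>_closed[OF v]] v by (simp add: N.act_l0_class_const)
  qed
  have K_rscale: "rscale (sec_quot Q Ms) c (K v) = K (rscale N c v)" if "v \<in> carrier N" for c v
    using \<kappa>_rscale[OF that, of c] that
    by (auto simp: K_def sec_quot_ops sec_quot_rscale \<kappa>_closed intro!: sec_class_eqI elim!: eventually_mono)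
  have K_norm: "sec_norm Q \<mu> Ms (K v) = to_sections Q \<mu> (pnorm N v)" if v: "v \<in> carrier N" for v
    unfolding sec_norm_def to_sections_def using rep[OF v] \<kappa>_norm[OF v]
    by (intro sec_class_eqI) (auto elim!: eventually_elim2)
  have fibre_zero: "\<zero>\<^bsub>Ms q\<^esub> \<in> carrier (Ms q)" if "q \<in> space Q" for q
  proof -
    interpret F: l0_module "\<mu> q" "Ms q" by (rule fibre[OF that])
    show ?thesis by simp
  qed
  \<comment> \<open>The zero section consists of the zeros of the fibres; multiplication by the
    scalar 0 identifies it with the image of the zero of \<open>N\<close>.\<close>
  have K_zero: "\<zero>\<^bsub>sec_quot Q Ms\<^esub> = K \<zero>\<^bsub>N\<^esub>"
  proof -
    have "AE q in Q. \<zero>\<^bsub>Ms q\<^esub> = \<kappa> \<zero>\<^bsub>N\<^esub> q"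
      using \<kappa>_rscale[OF N.zero_closed, of 0] AE_space
    proof eventually_elim
      case (elim q)
      interpret F: l0_module "\<mu> q" "Ms q" by (rule fibre[OF elim(2)])
      show ?case using elim \<kappa>_closed[of "\<zero>\<^bsub>N\<^esub>" q] by simp
    qed
    then show ?thesis by (auto simp: sec_quot_zero K_def intro!: sec_class_eqI)
  qed
  \<comment> \<open>The norm detects equality: if two vectors have the same class, their difference
    has norm 0 in almost every fibre, hence in \<open>N\<close> by
    \<open>inj_on_to_sections\<close>.\<close>
  have inj: "inj_on K (carrier N)"
  proof (rule inj_onI)
    fix v w assume v: "v \<in> carrier N" and w: "w \<in> carrier N" and eq: "K v = K w"
    have vw: "v \<ominus>\<^bsub>N\<^esub> w \<in> carrier N" using v w by simp
    have "AE q in Q. \<kappa> v q = \<kappa> w q"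
      using eq v w unfolding K_def by (intro sec_class_eqD[of Q _ Ms] \<kappa>_closed)
    moreover have "AE q in Q. \<kappa> v q = \<kappa> (v \<ominus>\<^bsub>N\<^esub> w) q \<oplus>\<^bsub>Ms q\<^esub> \<kappa> w q"
    proof -
      have "(v \<ominus>\<^bsub>N\<^esub> w) \<oplus>\<^bsub>N\<^esub> w = v"
        using v w by (simp add: N.minus_eq N.a_assoc N.l_neg)
      then show ?thesis using \<kappa>_add[OF vw w] by simp
    qed
    moreover note \<kappa>_norm[OF vw] AE_space
    ultimately have "AE q in Q. l0_class (\<mu> q) (class_rep (pnorm N (v \<ominus>\<^bsub>N\<^esub> w))) = l0_class (\<mu> q) (\<lambda>_. 0)"
    proof eventually_elim
      case (elim q)
      interpret F: l0_module "\<mu> q" "Ms q" by (rule fibre[OF elim(4)])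
      have "\<kappa> (v \<ominus>\<^bsub>N\<^esub> w) q = \<zero>\<^bsub>Ms q\<^esub>"
        using elim(1,2) F.add.r_cancel_one[OF \<kappa>_closed[OF w elim(4)] \<kappa>_closed[OF vw elim(4)]]
        by simp
      then have "pnorm (Ms q) (\<kappa> (v \<ominus>\<^bsub>N\<^esub> w) q) = \<zero>\<^bsub>L0 (\<mu> q)\<^esub>"
        using F.pnorm_eq_zero[OF F.zero_closed] by simp
      then show ?case using elim(3) by (simp add: L0_zero)
    qed
    then have "to_sections Q \<mu> (pnorm N (v \<ominus>\<^bsub>N\<^esub> w)) = to_sections Q \<mu> \<zero>\<^bsub>L0 M\<^esub>"
      unfolding L0_zero by (subst to_sections_l0_class) (auto simp: to_sections_def intro!: sec_class_eqI)
    then have "pnorm N (v \<ominus>\<^bsub>N\<^esub> w) = \<zero>\<^bsub>L0 M\<^esub>"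
      using inj_onD[OF inj_on_to_sections] N.pnorm_closed[OF vw] L0_closed(1) by blast
    then show "v = w"
      using vw v w by (simp add: N.pnorm_eq_zero N.minus_eq_zero_iff)
  qed
  have bdl: "banach_module_bundle Q M \<mu> Ms \<Theta> (L0_sections Q M \<mu>)"
    unfolding banach_module_bundle_def
  proof (intro conjI ballI)
    interpret S: Metric_space "carrier (L0 M)" "l0_dist M" by (rule Metric_space_L0[OF sigma_finite_M])
    show "S.mtopology closure_of sec_glued Q M \<mu> (L0_sections Q M \<mu>) = carrier (L0 M)"
      using closure_of_topspace[of S.mtopology] by (simp add: sec_glued_L0_sections)
    show "vector_subspace (sec_quot Q Ms) \<Theta>"
      unfolding vector_subspace_def \<Theta>_def
      using sec_class_in_carrier[of Q "\<kappa> v" Ms for v] \<kappa>_closed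
      by (auto simp: K_add K_rscale K_zero N.rscale_closed, auto simp: K_def)
    show "sec_act Q Ms f v \<in> \<Theta>" if "f \<in> L0_sections Q M \<mu>" "v \<in> \<Theta>" for f v
      using that by (auto simp: \<Theta>_def L0_sections_eq K_act N.act_closed)
    show "sec_norm Q \<mu> Ms v \<in> L0_sections Q M \<mu>" if "v \<in> \<Theta>" for v
      using that by (auto simp: \<Theta>_def L0_sections_eq K_norm N.pnorm_closed)
  qed (use disj M_eq Ms real_subalgebra_L0_sections in auto)
  define \<iota> where "\<iota> = the_inv_into (carrier N) K"
  have \<iota>K: "\<iota> (K v) = v" if "v \<in> carrier N" for v
    unfolding \<iota>_def using inj that by (rule the_inv_into_f_f)
  have \<iota>\<Theta>: "\<iota> ` \<Theta> = carrier N"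
    by (force simp: \<Theta>_def \<iota>K image_image)
  have "is_completion M (bundle_sections Q M \<mu> Ms \<Theta>) N \<iota>"
    unfolding is_completion_def
  proof (intro conjI)
    show "generates M N (\<iota> ` carrier (bundle_sections Q M \<mu> Ms \<Theta>))"
      using N.generates_carrier by (simp add: bundle_sections_def \<iota>\<Theta>)
  qed (auto simp: N bundle_sections_def \<Theta>_def \<iota>K K_add K_rscale K_norm N.rscale_closed
      N.pnorm_closed from_to_sections)
  with bdl show ?thesis
    by (auto simp: is_bundle_integral_def)
qed

section \<open>The embedding into bounded sequences and the final assembly\<close>

lemma banach_module_isomorphic_refl: "banach_module_isomorphic M N N"
  unfolding banach_module_isomorphic_def by (rule exI[of _ id]) auto

theorem theorem3p7:
  fixes M :: "'x measure"
    and Q :: "'q measure"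
    and \<mu> :: "'q \<Rightarrow> 'x measure"
    and N :: "(('x \<Rightarrow> real) set, 'm) nmodule"
  assumes "sigma_finite_measure M"
    and "banach_module M N"
    and "countably_generated M N"
    and "sigma_finite_measure Q"
    and "disjoint_measure_valued_map Q M \<mu>"
    and "M = integral_measure Q M \<mu>"
  shows "\<exists>(Ms :: 'q \<Rightarrow> (('x \<Rightarrow> real) set, ('x, 'm) fibre) nmodule) \<Theta> \<Phi>.
           banach_module_bundle Q M \<mu> Ms \<Theta> \<Phi> \<and>
           (\<exists>I :: (('x \<Rightarrow> real) set, 'm) nmodule.
              is_bundle_integral Q M \<mu> Ms \<Theta> I \<and> banach_module_isomorphic M N I)"
proof -
  interpret disintegration Q M \<mu>
    using assms(5,6) by unfold_locales (auto simp: disjoint_measure_valued_map_def)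
  interpret N: l0_module M N
    using assms(1,2) by (simp add: l0_module_def l0_module_axioms_def banach_A_module_def)
  obtain T :: "nat \<Rightarrow> 'm \<Rightarrow> 'x \<Rightarrow> real"
    where T_meas: "\<And>n u. u \<in> carrier N \<Longrightarrow> T n u \<in> borel_measurable M"
    and T_add: "\<And>n u v. \<lbrakk>u \<in> carrier N; v \<in> carrier N\<rbrakk> \<Longrightarrow> AE x in M. T n (u \<oplus>\<^bsub>N\<^esub> v) x = T n u x + T n v x"
    and T_le: "\<And>n u. u \<in> carrier N \<Longrightarrow> AE x in M. \<bar>T n u x\<bar> \<le> class_rep (pnorm N u) x"
    and T_norm: "\<And>u. u \<in> carrier N \<Longrightarrow> AE x in M. \<forall>d>0. \<exists>n. class_rep (pnorm N u) x - d < T n u x"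
    using N.norming_functionals[OF assms(3)] by blast
  define I :: "nat set" where "I = (if carrier N = {\<zero>\<^bsub>N\<^esub>} then {} else UNIV)"
  \<comment> \<open>The functionals are bounded by the norm only almost everywhere; clamping makes
    the sequence bounded at every x, as \<open>linf_fun\<close> demands. The absolute values guard
    against a representative of the norm that is negative on a null set.\<close>
  define F where "F u x n = (if n \<in> I then
    max (- \<bar>class_rep (pnorm N u) x\<bar>) (min \<bar>class_rep (pnorm N u) x\<bar> (T n u x)) else 0)" for u x n
  have F_fun: "F u \<in> linf_fun I M" if u: "u \<in> carrier N" for u
    unfolding linf_fun_def mem_Collect_eq
  proof (intro conjI allI impI)
    show "bdd_seq (F u x)" for x
      by (rule bdd_seqI[of _ "\<bar>class_rep (pnorm N u) x\<bar>"]) (auto simp: F_def)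
    show "(\<lambda>x. F u x n) \<in> borel_measurable M" for n
      unfolding F_def using u
      by (cases "n \<in> I") (auto intro!: borel_measurable_max borel_measurable_min borel_measurable_uminus
        borel_measurable_abs T_meas N.pn_measurable)
  qed (simp add: F_def)
  have F_eq: "AE x in M. \<forall>n. F u x n = (if n \<in> I then T n u x else 0)" if "u \<in> carrier N" for u
    unfolding AE_all_countable
  proof
    fix n show "AE x in M. F u x n = (if n \<in> I then T n u x else 0)"
      using T_le[OF that, of n] by eventually_elim (auto simp: F_def)
  qed
  have F_add: "AE x in M. F (u \<oplus>\<^bsub>N\<^esub> v) x = (\<lambda>n. F u x n + F v x n)" if "u \<in> carrier N" "v \<in> carrier N" for u v
  proof -
    have "AE x in M. \<forall>n. T n (u \<oplus>\<^bsub>N\<^esub> v) x = T n u x + T n v x"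
      unfolding AE_all_countable using T_add[OF that] by blast
    with F_eq[OF that(1)] F_eq[OF that(2)] F_eq[OF N.a_closed[OF that]] show ?thesis
      by eventually_elim auto
  qed
  have F_act: "AE x in M. F (act N (l0_class M f) u) x = (\<lambda>n. f x * F u x n)"
    if "f \<in> borel_measurable M" "u \<in> carrier N" for f u
  proof -
    have f: "l0_class M f \<in> carrier (L0 M)" using that by simp
    have "AE x in M. \<forall>n. T n (act N (l0_class M f) u) x = class_rep (l0_class M f) x * T n u x"
      unfolding AE_all_countable
      by (intro allI N.additive_bounded_imp_l0_linear T_add T_le f that(2))
    with class_rep_l0_class(2)[OF that(1)] F_eq[OF that(2)] F_eq[OF N.act_closed[OF f that(2)]]
    show ?thesis by eventually_elim auto
  qed
  have F_norm: "AE x in M. sup_norm (F u x) = class_rep (pnorm N u) x" if u: "u \<in> carrier N" for u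
  proof (cases "carrier N = {\<zero>\<^bsub>N\<^esub>}")
    case True
    have "F u x = (\<lambda>_. 0)" for x
      using True by (auto simp: F_def I_def)
    then show ?thesis using u True N.pn_zero by simp
  next
    case False
    have "AE x in M. \<forall>n. \<bar>T n u x\<bar> \<le> class_rep (pnorm N u) x"
      unfolding AE_all_countable using T_le[OF u] by blast
    with F_eq[OF u] T_norm[OF u] show ?thesis
    proof eventually_elim
      case (elim x)
      have F: "F u x = (\<lambda>n. T n u x)" using elim(1) False by (auto simp: I_def)
      have "class_rep (pnorm N u) x \<le> sup_norm (F u x) + d" if "d > 0" for d
      proof -
        obtain n where "class_rep (pnorm N u) x - d < T n u x" using elim(2) \<open>d > 0\<close> by blast
        then show ?thesis
          using sup_norm_upper[OF linf_funD(2)[OF F_fun[OF u]], of x n] by (simp add: F)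
      qed
      then have "class_rep (pnorm N u) x \<le> sup_norm (F u x)" by (rule field_le_epsilon)
      moreover have "sup_norm (F u x) \<le> class_rep (pnorm N u) x"
        using elim(3) by (intro sup_norm_least) (simp add: F)
      ultimately show ?case by simp
    qed
  qed
  obtain v0 where v0: "v0 \<in> carrier N" "carrier N \<noteq> {\<zero>\<^bsub>N\<^esub>} \<Longrightarrow> v0 \<noteq> \<zero>\<^bsub>N\<^esub>"
    using N.zero_closed by blast
  \<comment> \<open>A real number is coded by its multiple of \<open>v0\<close>, entry by entry and
    representative by representative. This is injective if \<open>v0\<close> is nonzero; in the zero
    module \<open>I\<close> is empty and the carrier of \<open>linf\<close> has a single
    element.\<close>
  define h where "h = (\<lambda>A. (\<lambda>G (x::'x) (n::nat). rscale N (G x n) v0) ` A)"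
  have h_inj: "inj_on h (carrier (linf I (\<mu> q)))" for q
  proof (cases "carrier N = {\<zero>\<^bsub>N\<^esub>}")
    case True
    then have "linf_fun I (\<mu> q) \<subseteq> {\<lambda>x n. 0}" by (auto simp: linf_fun_def I_def fun_eq_iff)
    then have "carrier (linf I (\<mu> q)) \<subseteq> {linf_class I (\<mu> q) (\<lambda>x n. 0)}" by (auto simp: linf_carrier)
    then show ?thesis by (auto simp: inj_on_def)
  next
    case False
    have "c = d" if eq: "rscale N c v0 = rscale N d v0" for c d
    proof (rule ccontr)
      assume "c \<noteq> d"
      have "rscale N (c - d) v0 = \<zero>\<^bsub>N\<^esub>"
        using eq v0(1) by (simp add: N.rscale_diff N.minus_eq_zero_iff N.rscale_closed)
      then have "rscale N (1 / (c - d) * (c - d)) v0 = \<zero>\<^bsub>N\<^esub>"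
        using v0(1) by (simp flip: N.rscale_rscale del: times_divide_eq_left)
      then show False using \<open>c \<noteq> d\<close> v0 False by (simp add: N.rscale_one)
    qed
    then have "inj (\<lambda>G (x::'x) (n::nat). rscale N (G x n) v0)"
      by (intro injI ext) meson
    then have "inj h" by (intro injI) (simp add: h_def inj_image_eq_iff)
    then show ?thesis by (rule inj_on_subset) simp
  qed
  define Ms where "Ms q = nm_transport h (linf I (\<mu> q))" for q
  \<comment> \<open>The function \<open>F u\<close> is fixed before q and reduced modulo every
    \<open>\<mu> q\<close>, so relations that hold \<open>M\<close>-almost everywhere descend to
    almost every fibre.\<close>
  define \<kappa> where "\<kappa> u q = h (linf_class I (\<mu> q) (F u))" for u q
  have F_fun_q: "F u \<in> linf_fun I (\<mu> q)" if "u \<in> carrier N" "q \<in> space Q" for u q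
    using F_fun[OF that(1)] measurable_\<mu>[OF _ that(2)] by (auto simp: linf_fun_def)
  have cl: "linf_class I (\<mu> q) (F u) \<in> carrier (linf I (\<mu> q))" if "u \<in> carrier N" "q \<in> space Q" for u q
    using F_fun_q[OF that] by (auto simp: linf_carrier)
  note ops = nm_transport_ops[OF h_inj cl]
  have "\<exists>\<Theta> \<Phi>. banach_module_bundle Q M \<mu> Ms \<Theta> \<Phi> \<and> is_bundle_integral Q M \<mu> Ms \<Theta> N"
  proof (rule bundle_of_fibre_maps[where \<kappa> = \<kappa>])
    show "banach_module (\<mu> q) (Ms q)" if "q \<in> space Q" for q
      unfolding Ms_def using sigma_finite_\<mu>[OF that]
      by (intro banach_module_transport banach_module_linf h_inj)
    show "\<kappa> v q \<in> carrier (Ms q)" if "v \<in> carrier N" "q \<in> space Q" for v q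
      using cl[OF that] by (simp add: Ms_def \<kappa>_def nm_transport_simps)
    show "AE q in Q. \<kappa> (v \<oplus>\<^bsub>N\<^esub> w) q = \<kappa> v q \<oplus>\<^bsub>Ms q\<^esub> \<kappa> w q"
      if v: "v \<in> carrier N" and w: "w \<in> carrier N" for v w
      using AE_disintegration[OF F_add[OF v w]] AE_space
    proof eventually_elim
      case (elim q)
      have "\<kappa> v q \<oplus>\<^bsub>Ms q\<^esub> \<kappa> w q = h (linf_class I (\<mu> q) (\<lambda>x n. F v x n + F w x n))"
        unfolding \<kappa>_def Ms_def using ops(1)[OF v elim(2) cl[OF w elim(2)]] F_fun_q v w elim(2)
        by (simp add: linf_add)
      also have "\<dots> = \<kappa> (v \<oplus>\<^bsub>N\<^esub> w) q"
        unfolding \<kappa>_def using elim(1) linf_class_eqI[where M = "\<mu> q" and F = "F (v \<oplus>\<^bsub>N\<^esub> w)"] by simp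
      finally show ?case ..
    qed
    show "AE q in Q. \<kappa> (act N (l0_class M f) v) q = act (Ms q) (l0_class (\<mu> q) f) (\<kappa> v q)"
      if f: "f \<in> borel_measurable M" and v: "v \<in> carrier N" for f v
      using AE_disintegration[OF F_act[OF f v]] AE_space
    proof eventually_elim
      case (elim q)
      have "act (Ms q) (l0_class (\<mu> q) f) (\<kappa> v q) = h (linf_class I (\<mu> q) (\<lambda>x n. f x * F v x n))"
        unfolding \<kappa>_def Ms_def using ops(3)[OF v elim(2)] F_fun_q v f elim(2)
        by (simp add: linf_act measurable_\<mu>)
      also have "\<dots> = \<kappa> (act N (l0_class M f) v) q"
        unfolding \<kappa>_def using elim(1) linf_class_eqI[where M = "\<mu> q" and F = "F (act N (l0_class M f) v)"] by simp
      finally show ?case ..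
    qed
    show "AE q in Q. pnorm (Ms q) (\<kappa> v q) = l0_class (\<mu> q) (class_rep (pnorm N v))"
      if v: "v \<in> carrier N" for v
      using AE_disintegration[OF F_norm[OF v]] AE_space
    proof eventually_elim
      case (elim q)
      then show ?case
        unfolding \<kappa>_def Ms_def using ops(4)[OF v elim(2)] F_fun_q[OF v elim(2)] l0_class_eqI[OF elim(1)]
        by (simp add: linf_pnorm)
    qed
  qed (use assms in auto)
  then show ?thesis
    using banach_module_isomorphic_refl by blast
qed

end
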